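(* Let $n\ge1$, let $(M^{2n+1},\eta,H)$ be a smooth autonomous contact Hamiltonian system, with $X=X_H$, $a=R(H)$ and $\mu=\eta\wedge(d\eta)^n$. Let $\Phi:M\to M$ be any contact canonoid map for it (not necessarily a local diffeomorphism), and let $K=-(\Phi^*\eta)(X)$. Then the one-form $$\beta=\frac{H}{K}\,\Phi^*\eta$$ satisfies $\mathcal L_X\beta=-a\beta$ on the open set $\{K\neq0\}$. Consequently the coefficients $C_1,\dots,C_{n+1}$ defined on $\{K\ne0\}$ by $$(\eta+t\beta)\wedge(d\eta+t\,d\beta)^n=\Bigl(1+\sum_{j=1}^{n+1}C_jt^j\Bigr)\mu$$ are conserved, $X(C_j)=0$, on $\{K\neq0\}$, including at singular points of $\Phi$ and without any assumption that $H\neq0$.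
   Context: A contact Hamiltonian system $(M^{2n+1},\eta,H)$ is a smooth manifold $M$ of dimension $2n+1$ with a contact form $\eta$ (i.e. $\eta\wedge(d\eta)^n$ is nowhere zero) and a smooth function $H$. The Reeb vector field $R$ is defined by $\eta(R)=1$, $\iota_Rd\eta=0$. The contact Hamiltonian vector field $X_H$ is defined by the convention $\eta(X_H)=-H$, $\iota_{X_H}d\eta=dH-R(H)\eta$. A smooth map $\Phi:M\to M$ is a contact canonoid map for $(M,\eta,H)$ if there exists $b\in C^\infty(M)$ with $\mathcal L_{X_H}(\Phi^*\eta)=-b\,\Phi^*\eta$. *)

theory Defs
  imports "HOL-Analysis.Analysis"
begin

section \<open>Smooth maps between Euclidean spaces\<close>

text \<open>\<open>smooth_on S f\<close> is meant for open \<open>S\<close>: all iterated directional derivatives of \<open>f\<close>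
  exist on \<open>S\<close> as derivatives of (totally) differentiable functions.\<close>

fun times_differentiable_on ::
    "nat \<Rightarrow> 'e::euclidean_space set \<Rightarrow> ('e \<Rightarrow> 'f::real_normed_vector) \<Rightarrow> bool" where
  "times_differentiable_on 0 S f \<longleftrightarrow> continuous_on S f"
| "times_differentiable_on (Suc k) S f \<longleftrightarrow>
     (\<forall>x\<in>S. f differentiable (at x)) \<and>
     (\<forall>v. times_differentiable_on k S (\<lambda>x. frechet_derivative f (at x) v))"

definition smooth_on :: "'e::euclidean_space set \<Rightarrow> ('e \<Rightarrow> 'f::real_normed_vector) \<Rightarrow> bool" where
  "smooth_on S f \<longleftrightarrow> (\<forall>k. times_differentiable_on k S f)"


section \<open>Smooth manifolds\<close>

type_synonym ('m, 'e) chart = "'m set \<times> ('m \<Rightarrow> 'e)"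

abbreviation cdom :: "('m, 'e) chart \<Rightarrow> 'm set" where "cdom \<equiv> fst"
abbreviation cmap :: "('m, 'e) chart \<Rightarrow> 'm \<Rightarrow> 'e" where "cmap \<equiv> snd"

definition cinv :: "('m, 'e) chart \<Rightarrow> 'e \<Rightarrow> 'm" where
  "cinv c = inv_into (cdom c) (cmap c)"

text \<open>The manifold is the whole type \<open>'m\<close>, of dimension \<open>DIM('e)\<close>; the atlas \<open>A\<close> need not be
  maximal.\<close>

definition smooth_manifold ::
    "('m::{t2_space, second_countable_topology}, 'e::euclidean_space) chart set \<Rightarrow> bool" where
  "smooth_manifold A \<longleftrightarrow>
     (\<Union>c\<in>A. cdom c) = UNIV \<and>
     (\<forall>c\<in>A. open (cdom c) \<and> open (cmap c ` cdom c) \<and>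
        homeomorphism (cdom c) (cmap c ` cdom c) (cmap c) (cinv c)) \<and>
     (\<forall>c\<in>A. \<forall>c'\<in>A. smooth_on (cmap c ` (cdom c \<inter> cdom c')) (cmap c' \<circ> cinv c))"

definition smooth_fun :: "('m, 'e::euclidean_space) chart set \<Rightarrow> 'm set \<Rightarrow> ('m \<Rightarrow> real) \<Rightarrow> bool" where
  "smooth_fun A U f \<longleftrightarrow> (\<forall>c\<in>A. smooth_on (cmap c ` (cdom c \<inter> U)) (f \<circ> cinv c))"

definition smooth_self_map ::
    "('m::topological_space, 'e::euclidean_space) chart set \<Rightarrow> ('m \<Rightarrow> 'm) \<Rightarrow> bool" where
  "smooth_self_map A \<Phi> \<longleftrightarrow>
     continuous_on UNIV \<Phi> \<and>
     (\<forall>c\<in>A. \<forall>c'\<in>A. smooth_on (cmap c ` (cdom c \<inter> \<Phi> -` cdom c')) (cmap c' \<circ> \<Phi> \<circ> cinv c))"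


section \<open>Tangent vectors, vector fields and differential forms\<close>

text \<open>Each point \<open>p\<close> has a preferred chart \<open>chart_at A p\<close> around it, and the tangent space at \<open>p\<close>
  is identified with \<open>'e\<close> through that chart. So a vector field is a function \<open>'m \<Rightarrow> 'e\<close>. The
  identifications at different points are unrelated; differentiation and smoothness are always
  taken in a common chart, after moving tangent vectors with \<open>from_chart\<close> and \<open>to_chart\<close>.\<close>

definition chart_at :: "('m, 'e) chart set \<Rightarrow> 'm \<Rightarrow> ('m, 'e) chart" where
  "chart_at A p = (SOME c. c \<in> A \<and> p \<in> cdom c)"

text \<open>\<open>to_chart A c p u\<close> is the coordinate vector in the chart \<open>c\<close> of the tangent vector \<open>u\<close> at \<open>p\<close>;
  \<open>from_chart A c p\<close> is the inverse map.\<close>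

definition to_chart ::
    "('m, 'e::euclidean_space) chart set \<Rightarrow> ('m, 'e) chart \<Rightarrow> 'm \<Rightarrow> 'e \<Rightarrow> 'e" where
  "to_chart A c p =
     frechet_derivative (cmap c \<circ> cinv (chart_at A p)) (at (cmap (chart_at A p) p))"

definition from_chart ::
    "('m, 'e::euclidean_space) chart set \<Rightarrow> ('m, 'e) chart \<Rightarrow> 'm \<Rightarrow> 'e \<Rightarrow> 'e" where
  "from_chart A c p = frechet_derivative (cmap (chart_at A p) \<circ> cinv c) (at (cmap c p))"

definition local_field ::
    "('m, 'e::euclidean_space) chart set \<Rightarrow> ('m, 'e) chart \<Rightarrow> ('m \<Rightarrow> 'e) \<Rightarrow> 'e \<Rightarrow> 'e" where
  "local_field A c X y = to_chart A c (cinv c y) (X (cinv c y))"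

definition smooth_field ::
    "('m, 'e::euclidean_space) chart set \<Rightarrow> ('m \<Rightarrow> 'e) \<Rightarrow> bool" where
  "smooth_field A X \<longleftrightarrow> (\<forall>c\<in>A. smooth_on (cmap c ` cdom c) (local_field A c X))"

text \<open>The derivative \<open>X(f)\<close> of a function along a vector field.\<close>

definition field_apply ::
    "('m, 'e::euclidean_space) chart set \<Rightarrow> ('m \<Rightarrow> 'e) \<Rightarrow> ('m \<Rightarrow> real) \<Rightarrow> 'm \<Rightarrow> real" where
  "field_apply A X f p =
     frechet_derivative (f \<circ> cinv (chart_at A p)) (at (cmap (chart_at A p) p)) (X p)"

definition tangent_map ::
    "('m, 'e::euclidean_space) chart set \<Rightarrow> ('m \<Rightarrow> 'm) \<Rightarrow> 'm \<Rightarrow> 'e \<Rightarrow> 'e" where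
  "tangent_map A \<Phi> p =
     frechet_derivative (cmap (chart_at A (\<Phi> p)) \<circ> \<Phi> \<circ> cinv (chart_at A p))
       (at (cmap (chart_at A p) p))"

text \<open>A \<open>k\<close>-form is a function of a point and of a sequence of tangent vectors at that point, of which
  only the first \<open>k\<close> matter.\<close>

type_synonym ('m, 'e) form = "'m \<Rightarrow> (nat \<Rightarrow> 'e) \<Rightarrow> real"

definition alternating_form :: "nat \<Rightarrow> ((nat \<Rightarrow> 'e::real_vector) \<Rightarrow> real) \<Rightarrow> bool" where
  "alternating_form k f \<longleftrightarrow>
     (\<forall>v w. (\<forall>i<k. v i = w i) \<longrightarrow> f v = f w) \<and>
     (\<forall>v. \<forall>i<k. linear (\<lambda>x. f (v(i := x)))) \<and>
     (\<forall>v i j. i < k \<longrightarrow> j < k \<longrightarrow> i \<noteq> j \<longrightarrow> v i = v j \<longrightarrow> f v = 0)"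

definition local_form ::
    "('m, 'e::euclidean_space) chart set \<Rightarrow> ('m, 'e) chart \<Rightarrow> ('m, 'e) form \<Rightarrow> ('e, 'e) form" where
  "local_form A c \<omega> y v = \<omega> (cinv c y) (\<lambda>i. from_chart A c (cinv c y) (v i))"

definition smooth_form ::
    "('m, 'e::euclidean_space) chart set \<Rightarrow> nat \<Rightarrow> 'm set \<Rightarrow> ('m, 'e) form \<Rightarrow> bool" where
  "smooth_form A k U \<omega> \<longleftrightarrow>
     (\<forall>p\<in>U. alternating_form k (\<omega> p)) \<and>
     (\<forall>c\<in>A. \<forall>v. smooth_on (cmap c ` (cdom c \<inter> U)) (\<lambda>y. local_form A c \<omega> y v))"

definition pullback ::
    "('m, 'e::euclidean_space) chart set \<Rightarrow> ('m \<Rightarrow> 'm) \<Rightarrow> ('m, 'e) form \<Rightarrow> ('m, 'e) form" where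
  "pullback A \<Phi> \<omega> p v = \<omega> (\<Phi> p) (\<lambda>i. tangent_map A \<Phi> p (v i))"

definition fun_form :: "('m \<Rightarrow> real) \<Rightarrow> ('m, 'e) form" where
  "fun_form f p v = f p"

definition interior_product :: "('m \<Rightarrow> 'e) \<Rightarrow> ('m, 'e) form \<Rightarrow> ('m, 'e) form" where
  "interior_product X \<omega> p v = \<omega> p (case_nat (X p) v)"

text \<open>Both derivatives at \<open>p\<close> are computed in the preferred chart at \<open>p\<close>, with the usual coordinate
  formulas (the invariant formulas evaluated on constant coordinate fields): for a \<open>k\<close>-form,
  \<open>d\<omega>(v\<^sub>0,\<dots>,v\<^sub>k) = \<Sum>\<^sub>i (-1)\<^sup>i D\<omega>[v\<^sub>i](v\<^sub>0,\<dots>,v\<^sub>i omitted,\<dots>,v\<^sub>k)\<close> and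
  \<open>(L\<^sub>X \<omega>)(v\<^sub>0,\<dots>) = D\<omega>[X](v\<^sub>0,\<dots>) + \<Sum>\<^sub>i \<omega>(v\<^sub>0,\<dots>,DX[v\<^sub>i],\<dots>)\<close>.\<close>

definition ext_deriv ::
    "('m, 'e::euclidean_space) chart set \<Rightarrow> nat \<Rightarrow> ('m, 'e) form \<Rightarrow> ('m, 'e) form" where
  "ext_deriv A k \<omega> p v =
     (let c = chart_at A p in
      \<Sum>i\<le>k. (-1) ^ i *
        frechet_derivative (\<lambda>y. local_form A c \<omega> y (\<lambda>j. if j < i then v j else v (Suc j)))
          (at (cmap c p)) (v i))"

definition lie_deriv ::
    "('m, 'e::euclidean_space) chart set \<Rightarrow> nat \<Rightarrow> ('m \<Rightarrow> 'e) \<Rightarrow> ('m, 'e) form \<Rightarrow> ('m, 'e) form" where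
  "lie_deriv A k X \<omega> p v =
     (let c = chart_at A p in
      frechet_derivative (\<lambda>y. local_form A c \<omega> y v) (at (cmap c p)) (X p) +
      (\<Sum>i<k. \<omega> p (v(i := frechet_derivative (local_field A c X) (at (cmap c p)) (v i)))))"

definition wedge :: "nat \<Rightarrow> nat \<Rightarrow> ('m, 'e) form \<Rightarrow> ('m, 'e) form \<Rightarrow> ('m, 'e) form" where
  "wedge k l \<omega> \<tau> p v =
     (\<Sum>\<sigma> | \<sigma> permutes {..<k + l}.
        of_int (sign \<sigma>) * \<omega> p (\<lambda>i. v (\<sigma> i)) * \<tau> p (\<lambda>i. v (\<sigma> (k + i)))) / (fact k * fact l)"

fun wedge_power :: "nat \<Rightarrow> ('m, 'e) form \<Rightarrow> nat \<Rightarrow> ('m, 'e) form" where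
  "wedge_power k \<omega> 0 = fun_form (\<lambda>_. 1)"
| "wedge_power k \<omega> (Suc m) = wedge k (k * m) \<omega> (wedge_power k \<omega> m)"


section \<open>Contact Hamiltonian systems\<close>

text \<open>\<open>contact_top n \<eta> \<theta>\<close> is \<open>\<eta> \<and> \<theta>\<^sup>n\<close> for a one-form \<open>\<eta>\<close> and a two-form \<open>\<theta>\<close>.\<close>

definition contact_top :: "nat \<Rightarrow> ('m, 'e) form \<Rightarrow> ('m, 'e) form \<Rightarrow> ('m, 'e) form" where
  "contact_top n \<eta> \<theta> = wedge 1 (2 * n) \<eta> (wedge_power 2 \<theta> n)"

definition contact_form ::
    "('m, 'e::euclidean_space) chart set \<Rightarrow> nat \<Rightarrow> ('m, 'e) form \<Rightarrow> bool" where
  "contact_form A n \<eta> \<longleftrightarrow>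
     smooth_form A 1 UNIV \<eta> \<and> (\<forall>p. \<exists>v. contact_top n \<eta> (ext_deriv A 1 \<eta>) p v \<noteq> 0)"

text \<open>For a contact form the Reeb field and the contact Hamiltonian field exist and are uniquely
  determined by the equations below.\<close>

definition is_reeb_field ::
    "('m, 'e::euclidean_space) chart set \<Rightarrow> ('m, 'e) form \<Rightarrow> ('m \<Rightarrow> 'e) \<Rightarrow> bool" where
  "is_reeb_field A \<eta> R \<longleftrightarrow>
     smooth_field A R \<and>
     interior_product R \<eta> = fun_form (\<lambda>_. 1) \<and>
     interior_product R (ext_deriv A 1 \<eta>) = (\<lambda>p v. 0)"

definition is_hamiltonian_field ::
    "('m, 'e::euclidean_space) chart set \<Rightarrow> ('m, 'e) form \<Rightarrow> ('m \<Rightarrow> 'e) \<Rightarrow> ('m \<Rightarrow> real)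
       \<Rightarrow> ('m \<Rightarrow> 'e) \<Rightarrow> bool" where
  "is_hamiltonian_field A \<eta> R H X \<longleftrightarrow>
     smooth_field A X \<and>
     interior_product X \<eta> = fun_form (\<lambda>p. - H p) \<and>
     interior_product X (ext_deriv A 1 \<eta>) =
       (\<lambda>p v. ext_deriv A 0 (fun_form H) p v - field_apply A R H p * \<eta> p v)"

definition contact_canonoid ::
    "('m::topological_space, 'e::euclidean_space) chart set \<Rightarrow> ('m, 'e) form \<Rightarrow> ('m \<Rightarrow> 'e)
       \<Rightarrow> ('m \<Rightarrow> 'm) \<Rightarrow> bool" where
  "contact_canonoid A \<eta> X \<Phi> \<longleftrightarrow>
     smooth_self_map A \<Phi> \<and>
     (\<exists>b. smooth_fun A UNIV b \<and>
        lie_deriv A 1 X (pullback A \<Phi> \<eta>) = (\<lambda>p v. - b p * pullback A \<Phi> \<eta> p v))"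

text \<open>\<open>C\<^sub>1, \<dots>, C\<^sub>n\<^sub>+\<^sub>1\<close> are the coefficients on \<open>U\<close> of
  \<open>(\<eta> + t\<beta>) \<and> (d\<eta> + t d\<beta>)\<^sup>n\<close> relative to \<open>\<eta> \<and> (d\<eta>)\<^sup>n\<close>.\<close>

definition pencil_coeffs ::
    "('m, 'e::euclidean_space) chart set \<Rightarrow> nat \<Rightarrow> ('m, 'e) form \<Rightarrow> ('m, 'e) form \<Rightarrow> 'm set
       \<Rightarrow> (nat \<Rightarrow> 'm \<Rightarrow> real) \<Rightarrow> bool" where
  "pencil_coeffs A n \<eta> \<beta> U C \<longleftrightarrow>
     (\<forall>p\<in>U. \<forall>t v.
        contact_top n (\<lambda>q u. \<eta> q u + t * \<beta> q u)
          (\<lambda>q u. ext_deriv A 1 \<eta> q u + t * ext_deriv A 1 \<beta> q u) p v =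
        (1 + (\<Sum>j=1..n+1. C j p * t ^ j)) * contact_top n \<eta> (ext_deriv A 1 \<eta>) p v)"

end

theory Submission
  imports Defs "HOL-Computational_Algebra.Polynomial"
begin

text \<open>Write \<open>\<zeta> = \<Phi>\<^sup>*\<eta>\<close> and \<open>L\<^sub>X \<zeta> = -b\<zeta>\<close>. Evaluating on \<open>X\<close> gives \<open>X(K) = -bK\<close>, and \<open>X(H) = -aH\<close>, so
  \<open>X(H/K) = (b - a) H/K\<close> and \<open>L\<^sub>X \<beta> = -a\<beta>\<close>. Since \<open>\<beta>(X) = -H = \<eta>(X)\<close>, Cartan's formula turns this into
  \<open>\<iota>\<^sub>X d\<alpha> = dh - a\<alpha>\<close> for \<open>\<alpha> = \<eta> + t\<beta>\<close> and \<open>h = (1 + t)H\<close>. Hence \<open>L\<^sub>X d\<alpha> = -a d\<alpha> - da \<and> \<alpha>\<close>, and as the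
  last term does not contribute to the top form, \<open>L\<^sub>X (\<alpha> \<and> (d\<alpha>)\<^sup>n) = -(n + 1) a \<alpha> \<and> (d\<alpha>)\<^sup>n\<close> with the same
  factor for every \<open>t\<close>. The ratio of this form to its value at \<open>t = 0\<close> is therefore constant along \<open>X\<close>.\<close>

section \<open>Exterior algebra\<close>

text \<open>The argument must not divide by \<open>H\<close>, nor assume that \<beta> or a member
  \<eta> + t\<beta> of the pencil is a contact form. Hence the data carried through are the two
  equations \<alpha>(X) = -h and i_X d\<alpha> = dh - a\<alpha>: they are linear in the pair
  (\<alpha>, h), so having them for (\<eta>, H) and (\<beta>, H) gives them for every t, degenerate
  members included. Nondegeneracy of \<eta> supplies the nonzero denominator. \<Phi> enters through
  the smooth one-form \<zeta> alone, which is why its singular points need no separate treatment. No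
  flow is constructed: the Lie derivative of the top form is the derivative at s = 0 along the line
  x + s X(x), with arguments v + s DX(x) v; these have the one-jets of the flow and of its tangent
  map. In place of graded wedge identities the proof uses closure properties of the top form and its
  dependence on values on the kernel of \<alpha>. A further obstacle is that tangent spaces are
  identified through a chart chosen separately at each point, so every derivative must first be
  rewritten in one common chart.\<close>

lemma alternating_form_cong:
  "alternating_form k f \<Longrightarrow> (\<And>i. i < k \<Longrightarrow> v i = w i) \<Longrightarrow> f v = f w"
  unfolding alternating_form_def by blast

lemma alternating_form_linear:
  "alternating_form k f \<Longrightarrow> i < k \<Longrightarrow> linear (\<lambda>x. f (v(i := x)))"
  unfolding alternating_form_def by blast

lemma alternating_form_eq_0:
  "alternating_form k f \<Longrightarrow> i < k \<Longrightarrow> j < k \<Longrightarrow> i \<noteq> j \<Longrightarrow> v i = v j \<Longrightarrow> f v = 0"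
  unfolding alternating_form_def by blast

lemma alternating_form_combination:
  assumes "alternating_form k f" "alternating_form k g"
  shows "alternating_form k (\<lambda>v. a * f v + b * g v)"
  unfolding alternating_form_def
proof (intro conjI allI impI)
  show "a * f v + b * g v = a * f w + b * g w" if "\<forall>i<k. v i = w i" for v w
    using alternating_form_cong[OF assms(1), of v w] alternating_form_cong[OF assms(2), of v w] that
    by simp
  show "linear (\<lambda>x. a * f (v(i := x)) + b * g (v(i := x)))" if "i < k" for v i
    using linear_compose_scale_right[OF alternating_form_linear[OF assms(1) that], of a]
      linear_compose_scale_right[OF alternating_form_linear[OF assms(2) that], of b]
    by (intro linear_compose_add) simp_all
  show "a * f v + b * g v = 0" if "i < k" "j < k" "i \<noteq> j" "v i = v j" for v i j
    using alternating_form_eq_0[OF assms(1) that] alternating_form_eq_0[OF assms(2) that] by simp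
qed

lemma alternating_form_1:
  assumes "linear g"
  shows "alternating_form 1 (\<lambda>v. g (v 0))"
  unfolding alternating_form_def using assms by auto

lemma alternating_form_2:
  fixes B :: "'a::real_vector \<Rightarrow> 'a \<Rightarrow> real"
  assumes "\<And>y. linear (\<lambda>x. B x y)" "\<And>x. linear (B x)" "\<And>x. B x x = 0"
  shows "alternating_form 2 (\<lambda>v. B (v 0) (v 1))"
  unfolding alternating_form_def
proof (intro conjI allI impI)
  show "linear (\<lambda>x. B ((v(i := x)) 0) ((v(i := x)) 1))" if "i < 2" for v and i :: nat
  proof -
    consider "i = 0" | "i = 1" using \<open>i < 2\<close> by linarith
    then show ?thesis by cases (use assms(1,2) in auto)
  qed
qed (use assms(3) in \<open>auto simp: less_2_cases_iff\<close>)

text \<open>Polarisation: f vanishes with \<open>v i + v j\<close> in both slots, and expanding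
  leaves the two mixed terms.\<close>

lemma alternating_form_swap:
  assumes f: "alternating_form k f" and ij: "i < k" "j < k" "i \<noteq> j"
  shows "f (v \<circ> Transposition.transpose i j) = - f v"
proof -
  define g where "g a b = f (v(i := a, j := b))" for a b
  have g0: "g a a = 0" for a
    unfolding g_def by (rule alternating_form_eq_0[OF f ij]) (use ij in auto)
  have L1: "linear (\<lambda>a. g a b)" for b
    using alternating_form_linear[OF f ij(1), of "v(j := b)"] ij(3) by (simp add: g_def fun_upd_twist)
  have g1: "g (a + a') b = g a b + g a' b" for a a' b
    by (rule linear_add[OF L1])
  have L2: "linear (\<lambda>b. g a b)" for a
    using alternating_form_linear[OF f ij(2), of "v(i := a)"] by (simp add: g_def)
  have g2: "g a (b + b') = g a b + g a b'" for a b b'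
    by (rule linear_add[OF L2])
  have "g (v j) (v i) + g (v i) (v j) = 0"
    using g0[of "v i + v j"] unfolding g1 g2 by (simp add: g0)
  then have "g (v j) (v i) = - g (v i) (v j)"
    by (simp add: eq_neg_iff_add_eq_0)
  moreover have "g (v i) (v j) = f v" by (simp add: g_def)
  moreover have "v(i := v j, j := v i) = v \<circ> Transposition.transpose i j"
    by (auto simp: fun_eq_iff Transposition.transpose_def)
  ultimately show ?thesis by (simp add: g_def)
qed

text \<open>One slot at a time: changing entry m by a multiple of \<open>v i\<close> adds a term
  with \<open>v i\<close> in both slots i and m, which vanishes. Slot i is never changed, so the
  pivot survives every step.\<close>

lemma alternating_form_pivot:
  assumes f: "alternating_form k f" and i: "i < k"
  shows "f (\<lambda>j. if j = i then v j else v j - c j *\<^sub>R v i) = f v"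
proof -
  define w where "w m = (\<lambda>j. if j = i \<or> m \<le> j then v j else v j - c j *\<^sub>R v i)" for m
  have "m \<le> k \<Longrightarrow> f (w m) = f v" for m
  proof (induction m)
    case 0
    then show ?case by (simp add: w_def)
  next
    case (Suc m)
    show ?case
    proof (cases "m = i")
      case True
      then have "w (Suc m) = w m" by (auto simp: w_def fun_eq_iff)
      with Suc show ?thesis by simp
    next
      case False
      then have m: "m < k" and "i \<noteq> m" using Suc.prems by auto
      have "w (Suc m) = (w m)(m := v m - c m *\<^sub>R v i)"
        using False by (auto simp: w_def fun_eq_iff)
      then have "f (w (Suc m)) = f ((w m)(m := v m)) - c m * f ((w m)(m := v i))"
        by (simp add: linear_diff[OF alternating_form_linear[OF f m]]
            linear_scale[OF alternating_form_linear[OF f m]])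
      also have "f ((w m)(m := v i)) = 0"
        using \<open>i \<noteq> m\<close> by (intro alternating_form_eq_0[OF f i m]) (auto simp: w_def)
      also have "(w m)(m := v m) = w m" by (auto simp: w_def)
      finally show ?thesis using Suc by simp
    qed
  qed
  then have "f (w k) = f v" by simp
  moreover have "f (\<lambda>j. if j = i then v j else v j - c j *\<^sub>R v i) = f (w k)"
    by (rule alternating_form_cong[OF f]) (simp add: w_def)
  ultimately show ?thesis by simp
qed

text \<open>Gaussian elimination with a vector outside the kernel as pivot.\<close>

lemma alternating_form_eqI_kernel:
  fixes a :: "'a::real_vector \<Rightarrow> real"
  assumes a: "linear a" and f: "alternating_form k f" and g: "alternating_form k g"
    and eq: "\<And>v. (\<And>i. 0 < i \<Longrightarrow> a (v i) = 0) \<Longrightarrow> f v = g v"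
  shows "f v = g v"
proof -
  define h where "h = (\<lambda>v. 1 * f v + (-1) * g v)"
  have h: "alternating_form k h"
    unfolding h_def by (intro alternating_form_combination f g)
  have h0: "h v = 0" if "\<And>i. 0 < i \<Longrightarrow> a (v i) = 0" for v
    using eq[of v] that by (simp add: h_def)
  have "h v = 0"
  proof (cases "\<exists>i<k. a (v i) \<noteq> 0")
    case False
    \<comment> \<open>Entries past \<open>k\<close> do not affect \<open>h\<close>, but
      \<open>h0\<close> constrains them too, so they are set to 0.\<close>
    then have "h (\<lambda>i. if i < k then v i else 0) = 0"
      using linear_0[OF a] by (intro h0) auto
    then show ?thesis
      using alternating_form_cong[OF h, of v "\<lambda>i. if i < k then v i else 0"] by simp
  next
    case True
    then obtain i where i: "i < k" "a (v i) \<noteq> 0" by blast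
    define w where "w = (\<lambda>j. if j = i then v j else v j - (a (v j) / a (v i)) *\<^sub>R v i)"
    have w: "h w = h v"
      unfolding w_def by (rule alternating_form_pivot[OF h i(1)])
    have aw: "a (w j) = 0" if "j \<noteq> i" for j
      using that i(2) by (simp add: w_def linear_diff[OF a] linear_scale[OF a])
    \<comment> \<open>After elimination only the pivot slot can lie outside the kernel.
      \<open>h0\<close> leaves slot 0 free, so a transposition moves the pivot there.\<close>
    show ?thesis
    proof (cases "i = 0")
      case True
      then have "h w = 0" by (intro h0 aw) auto
      with w show ?thesis by simp
    next
      case False
      have "h (w \<circ> Transposition.transpose 0 i) = 0"
        using aw False by (intro h0) (auto simp: Transposition.transpose_def)
      then show ?thesis
        using alternating_form_swap[OF h _ i(1), of 0 w] False i(1) w by simp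
    qed
  qed
  then show ?thesis by (simp add: h_def)
qed

text \<open>A transposition only changes the sign. Following zeros instead of values spares the sign
  of \<sigma>; the induction needs all v at once because each transposition changes the
  argument.\<close>

lemma alternating_form_permute_eq_0:
  assumes f: "alternating_form k f" and "\<sigma> permutes {..<k}" and "f v = 0"
  shows "f (v \<circ> \<sigma>) = 0"
proof -
  have "\<forall>v. f v = 0 \<longrightarrow> f (v \<circ> \<sigma>) = 0"
    using assms(2) finite_lessThan
  proof (induction rule: permutes_induct)
    case id
    then show ?case by simp
  next
    case (swap a b p)
    show ?case
    proof (intro allI impI)
      fix v assume "f v = 0"
      then have "f (v \<circ> Transposition.transpose a b) = 0"
        using alternating_form_swap[OF f, of a b v] swap by (cases "a = b") auto
      with swap show "f (v \<circ> (Transposition.transpose a b \<circ> p)) = 0"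
        unfolding comp_assoc[symmetric] by blast
    qed
  qed
  with assms(3) show ?thesis by blast
qed

text \<open>Multilinear expansion reduces to sequences of basis vectors, and such a sequence either
  repeats a vector or rearranges b.\<close>

lemma alternating_form_top_eq_0:
  fixes f :: "(nat \<Rightarrow> 'e::euclidean_space) \<Rightarrow> real"
  assumes f: "alternating_form DIM('e) f" and b: "bij_betw b {..<DIM('e)} Basis" and "f b = 0"
  shows "f v = 0"
proof -
  let ?k = "DIM('e)"
  have basis: "f v = 0" if v: "\<And>i. i < ?k \<Longrightarrow> v i \<in> Basis" for v
  proof (cases "inj_on v {..<?k}")
    case True
    \<comment> \<open>\<open>permutes\<close> demands the identity outside the index set; f does not
      see those entries.\<close>
    define \<sigma> where "\<sigma> = (\<lambda>i. if i < ?k then inv_into {..<?k} b (v i) else i)"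
    have \<sigma>: "\<sigma> i < ?k" "b (\<sigma> i) = v i" if "i < ?k" for i
      using that v[OF that] b inv_into_into[of "v i" b "{..<?k}"] f_inv_into_f[of "v i" b "{..<?k}"]
      by (auto simp: \<sigma>_def bij_betw_def)
    have "inj_on \<sigma> {..<?k}"
      using True \<sigma>(2) unfolding inj_on_def by (metis lessThan_iff)
    moreover have "\<sigma> ` {..<?k} \<subseteq> {..<?k}" using \<sigma> by auto
    ultimately have "bij_betw \<sigma> {..<?k} {..<?k}"
      by (simp add: bij_betw_def endo_inj_surj)
    then have "\<sigma> permutes {..<?k}"
      by (rule bij_imp_permutes) (simp add: \<sigma>_def)
    then have "f (b \<circ> \<sigma>) = 0"
      by (rule alternating_form_permute_eq_0[OF f _ assms(3)])
    moreover have "f v = f (b \<circ> \<sigma>)"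
      by (rule alternating_form_cong[OF f]) (simp add: \<sigma>)
    ultimately show ?thesis by simp
  next
    case False
    then obtain i j where "i < ?k" "j < ?k" "i \<noteq> j" "v i = v j"
      unfolding inj_on_def by auto
    then show ?thesis by (rule alternating_form_eq_0[OF f])
  qed
  \<comment> \<open>Slots from m on hold basis vectors, those below m are still arbitrary; each step
    expands one more slot in the basis.\<close>
  have "m \<le> ?k \<Longrightarrow> (\<And>i. m \<le> i \<Longrightarrow> i < ?k \<Longrightarrow> v i \<in> Basis) \<Longrightarrow> f v = 0" for m v
  proof (induction m arbitrary: v)
    case 0
    then show ?case by (intro basis) auto
  next
    case (Suc m)
    then have m: "m < ?k" by simp
    have "f v = f (v(m := v m))" by simp
    also have "\<dots> = (\<Sum>e\<in>Basis. f (v(m := (v m \<bullet> e) *\<^sub>R e)))"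
      using linear_sum[OF alternating_form_linear[OF f m], of v "\<lambda>e. (v m \<bullet> e) *\<^sub>R e" Basis]
      by (simp add: euclidean_representation)
    also have "\<dots> = (\<Sum>e\<in>Basis. (v m \<bullet> e) * f (v(m := e)))"
      by (simp add: linear_scale[OF alternating_form_linear[OF f m]])
    also have "\<dots> = 0"
    proof (rule sum.neutral, rule ballI)
      fix e :: 'e assume "e \<in> Basis"
      then have "f (v(m := e)) = 0"
        using Suc.prems by (intro Suc.IH) auto
      then show "(v m \<bullet> e) * f (v(m := e)) = 0" by simp
    qed
    finally show ?case .
  qed
  from this[of ?k v] show ?thesis by simp
qed

text \<open>Top-degree forms span a line. The product form of the statement covers vanishing forms
  as well; it will extend an identity known on one frame to all arguments.\<close>

lemma alternating_form_top_proportional: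
  fixes f g :: "(nat \<Rightarrow> 'e::euclidean_space) \<Rightarrow> real"
  assumes f: "alternating_form DIM('e) f" and g: "alternating_form DIM('e) g"
  shows "f v * g u = f u * g v"
proof -
  obtain b :: "nat \<Rightarrow> 'e" where b: "bij_betw b {..<DIM('e)} Basis"
    using ex_bij_betw_nat_finite[OF finite_Basis] by (auto simp: atLeast0LessThan)
  \<comment> \<open>The combination vanishes at \<open>b\<close> by construction, hence
    everywhere.\<close>
  have *: "g b * f v + (- f b) * g v = 0" for v
    by (rule alternating_form_top_eq_0[OF alternating_form_combination[OF f g] b]) simp
  show ?thesis
  proof (cases "g b = 0")
    case True
    then show ?thesis using alternating_form_top_eq_0[OF g b] by simp
  next
    case False
    then have "f v = f b / g b * g v" for v
      using *[of v] by (simp add: field_simps)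
    then show ?thesis by (metis mult.assoc mult.commute)
  qed
qed

section \<open>Wedge products and the top form are alternating\<close>

lemma alternating_form_wedge:
  assumes f: "alternating_form k (\<omega> p)" and g: "alternating_form l (\<tau> p)"
  shows "alternating_form (k + l) (wedge k l \<omega> \<tau> p)"
  unfolding alternating_form_def
proof (intro conjI allI impI)
  let ?P = "{\<sigma>. \<sigma> permutes {..<k + l}}"
  show "wedge k l \<omega> \<tau> p v = wedge k l \<omega> \<tau> p w" if vw: "\<forall>i<k + l. v i = w i" for v w
  proof -
    have "\<omega> p (\<lambda>i. v (\<sigma> i)) = \<omega> p (\<lambda>i. w (\<sigma> i))"
      "\<tau> p (\<lambda>i. v (\<sigma> (k + i))) = \<tau> p (\<lambda>i. w (\<sigma> (k + i)))" if "\<sigma> \<in> ?P" for \<sigma>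
    proof -
      have "\<sigma> i < k + l" if "i < k + l" for i
        using permutes_in_image[of \<sigma> "{..<k + l}" i] that \<open>\<sigma> \<in> ?P\<close> by simp
      with vw show "\<omega> p (\<lambda>i. v (\<sigma> i)) = \<omega> p (\<lambda>i. w (\<sigma> i))"
        "\<tau> p (\<lambda>i. v (\<sigma> (k + i))) = \<tau> p (\<lambda>i. w (\<sigma> (k + i)))"
        by (auto intro!: alternating_form_cong[OF f] alternating_form_cong[OF g])
    qed
    then show ?thesis
      unfolding wedge_def by (intro arg_cong2[where f = "(/)"] sum.cong) auto
  qed
  show "linear (\<lambda>x. wedge k l \<omega> \<tau> p (v(m := x)))" if m: "m < k + l" for v m
  proof -
    have "linear (\<lambda>x. of_int (sign \<sigma>) * \<omega> p (\<lambda>i. (v(m := x)) (\<sigma> i)) *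
        \<tau> p (\<lambda>i. (v(m := x)) (\<sigma> (k + i))))" if "\<sigma> \<in> ?P" for \<sigma>
    proof -
      have \<sigma>: "\<sigma> permutes {..<k + l}" using that by simp
      \<comment> \<open>\<open>j\<close> is the one position at which \<sigma> places the argument
        of index m, so x occurs in exactly one factor: in \<omega> if j < k, otherwise in
        \<tau>.\<close>
      define j where "j = inv \<sigma> m"
      have j: "\<sigma> i = m \<longleftrightarrow> i = j" for i
        unfolding j_def using permutes_inv_eq[OF \<sigma>] by metis
      have jlt: "j < k + l"
        unfolding j_def using permutes_in_image[OF permutes_inv[OF \<sigma>], of m] m by simp
      show ?thesis
      proof (cases "j < k")
        case True
        have 1: "\<omega> p (\<lambda>i. (v(m := x)) (\<sigma> i)) = \<omega> p ((\<lambda>i. v (\<sigma> i))(j := x))" for x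
          by (rule arg_cong[where f = "\<omega> p"]) (auto simp: fun_eq_iff j)
        have 2: "\<tau> p (\<lambda>i. (v(m := x)) (\<sigma> (k + i))) = \<tau> p (\<lambda>i. v (\<sigma> (k + i)))" for x
          by (rule arg_cong[where f = "\<tau> p"]) (use True in \<open>auto simp: fun_eq_iff j\<close>)
        have L: "linear (\<lambda>x. \<omega> p ((\<lambda>i. v (\<sigma> i))(j := x)))"
          by (rule alternating_form_linear[OF f True])
        show ?thesis
          unfolding 1 2 by (rule linearI) (simp_all add: linear_add[OF L] linear_scale[OF L] distrib_left distrib_right mult_ac)
      next
        case False
        then obtain j' where j': "j = k + j'" "j' < l"
          using jlt by (metis add_less_cancel_left le_Suc_ex not_le)
        have 1: "\<omega> p (\<lambda>i. (v(m := x)) (\<sigma> i)) = \<omega> p (\<lambda>i. v (\<sigma> i))" for x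
          by (rule alternating_form_cong[OF f]) (use False in \<open>auto simp: j\<close>)
        have 2: "\<tau> p (\<lambda>i. (v(m := x)) (\<sigma> (k + i))) = \<tau> p ((\<lambda>i. v (\<sigma> (k + i)))(j' := x))" for x
          by (rule arg_cong[where f = "\<tau> p"]) (auto simp: fun_eq_iff j j')
        have L: "linear (\<lambda>x. \<tau> p ((\<lambda>i. v (\<sigma> (k + i)))(j' := x)))"
          by (rule alternating_form_linear[OF g j'(2)])
        show ?thesis
          unfolding 1 2 by (rule linearI) (simp_all add: linear_add[OF L] linear_scale[OF L] distrib_left distrib_right mult_ac)
      qed
    qed
    then have L: "linear (\<lambda>x. \<Sum>\<sigma>\<in>?P. of_int (sign \<sigma>) * \<omega> p (\<lambda>i. (v(m := x)) (\<sigma> i)) *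
        \<tau> p (\<lambda>i. (v(m := x)) (\<sigma> (k + i))))"
      by (intro linear_compose_sum ballI)
    show ?thesis
      using linear_compose_scale_right[OF L, of "1 / (fact k * fact l)"] unfolding wedge_def
      by (simp only: real_scaleR_def times_divide_eq_left mult_1)
  qed
  show "wedge k l \<omega> \<tau> p v = 0" if ij: "i < k + l" "j < k + l" "i \<noteq> j" "v i = v j" for v i j
  proof -
    define F where "F \<sigma> = of_int (sign \<sigma>) * \<omega> p (\<lambda>i. v (\<sigma> i)) * \<tau> p (\<lambda>i. v (\<sigma> (k + i)))" for \<sigma>
    have t: "Transposition.transpose i j permutes {..<k + l}"
      using ij by (intro permutes_swap_id) auto
    have v: "v (Transposition.transpose i j x) = v x" for x
      using ij(4) by (auto simp: Transposition.transpose_def)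
    \<comment> \<open>Composing \<sigma> with the transposition leaves the arguments unchanged,
      because \<open>v i = v j\<close>, and flips the sign. Reindexing shows that the sum is its own
      negative.\<close>
    have "F (Transposition.transpose i j \<circ> \<sigma>) = - F \<sigma>" if "\<sigma> \<in> ?P" for \<sigma>
    proof -
      have "sign (Transposition.transpose i j \<circ> \<sigma>) = - sign \<sigma>"
        using that ij(3) t
        by (subst sign_compose)
          (auto simp: sign_swap_id permutation_swap_id intro: permutation_permutes[THEN iffD2])
      then show ?thesis by (simp add: F_def v)
    qed
    then have "(\<Sum>\<sigma>\<in>?P. F \<sigma>) = - (\<Sum>\<sigma>\<in>?P. F \<sigma>)"
      using setum_permutations_compose_left[OF t, of F] by (simp add: sum_negf)
    then show ?thesis by (simp add: wedge_def F_def)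
  qed
qed

lemma alternating_form_wedge_power:
  "alternating_form k (\<omega> p) \<Longrightarrow> alternating_form (k * m) (wedge_power k \<omega> m p)"
proof (induction m)
  case 0
  show ?case by (simp add: alternating_form_def fun_form_def)
next
  case (Suc m)
  then show ?case using alternating_form_wedge[of k \<omega> p "k * m"] by simp
qed

lemma alternating_form_contact_top:
  assumes "alternating_form 1 (\<eta> p)" "alternating_form 2 (\<theta> p)"
  shows "alternating_form (2 * n + 1) (contact_top n \<eta> \<theta> p)"
  using alternating_form_wedge[where \<omega> = \<eta> and \<tau> = "wedge_power 2 \<theta> n" and p = p, OF assms(1) alternating_form_wedge_power[of 2 \<theta> p n, OF assms(2)]]
  by (simp add: contact_top_def)

section \<open>Wedge products: pointwise dependence, substitution, scaling\<close>

lemma wedge_cong: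
  "\<omega> p = \<omega>' q \<Longrightarrow> \<tau> p = \<tau>' q \<Longrightarrow> wedge k l \<omega> \<tau> p = wedge k l \<omega>' \<tau>' q"
  by (simp add: wedge_def fun_eq_iff)

lemma wedge_power_cong: "\<omega> p = \<omega>' q \<Longrightarrow> wedge_power k \<omega> m p = wedge_power k \<omega>' m q"
proof (induction m)
  case 0
  show ?case by (simp add: fun_form_def fun_eq_iff)
next
  case (Suc m)
  show ?case
    unfolding wedge_power.simps by (intro wedge_cong Suc)
qed

text \<open>The two base spaces may differ, as everything is pointwise.\<close>

lemma contact_top_cong:
  "\<eta> p = \<eta>' q \<Longrightarrow> \<theta> p = \<theta>' q \<Longrightarrow> contact_top n \<eta> \<theta> p = contact_top n \<eta>' \<theta>' q"
  unfolding contact_top_def by (intro wedge_cong wedge_power_cong)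

lemma wedge_power_comp:
  "wedge_power k (\<lambda>q u. \<omega> q (\<lambda>i. g q (u i))) m p v = wedge_power k \<omega> m p (\<lambda>i. g p (v i))"
  by (induction m arbitrary: v) (simp_all add: fun_form_def wedge_def)

text \<open>Serves twice: for passing to a chart, with \<open>g\<close> the change of tangent
  coordinates, and for carrying arguments along \<open>X\<close>.\<close>

lemma contact_top_comp:
  "contact_top n (\<lambda>q u. \<eta> q (\<lambda>i. g q (u i))) (\<lambda>q u. \<theta> q (\<lambda>i. g q (u i))) p v =
    contact_top n \<eta> \<theta> p (\<lambda>i. g p (v i))"
  by (simp add: contact_top_def wedge_def wedge_power_comp)

lemma wedge_scale:
  "wedge k l (\<lambda>q u. a q * \<omega> q u) (\<lambda>q u. b q * \<tau> q u) p v = a p * b p * wedge k l \<omega> \<tau> p v"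
  by (simp add: wedge_def sum_distrib_left mult_ac)

lemma wedge_power_scale:
  "wedge_power k (\<lambda>q u. c q * \<omega> q u) m = (\<lambda>p v. c p ^ m * wedge_power k \<omega> m p v)"
proof (induction m)
  case (Suc m)
  show ?case by (simp add: wedge_scale Suc)
qed (simp add: fun_form_def fun_eq_iff)

text \<open>One factor c comes from \<eta> and one from each of the n copies of \<theta>. This is
  the origin of the n + 1 in the Lie derivative of the top form.\<close>

lemma contact_top_scale:
  "contact_top n (\<lambda>q u. c q * \<eta> q u) (\<lambda>q u. c q * \<theta> q u) p v = c p ^ (n + 1) * contact_top n \<eta> \<theta> p v"
  by (simp add: contact_top_def wedge_power_scale wedge_scale)

text \<open>\<open>P\<close> will be membership in the kernel of \<eta>. It is asked of every entry
  of v, so it survives the permutations and shifts inside the wedge.\<close>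

lemma wedge_power_cong_kernel:
  assumes "\<And>u. (\<And>i. P (u i)) \<Longrightarrow> \<theta> p u = \<theta>' p u" and "\<And>i. P (v i)"
  shows "wedge_power k \<theta> m p v = wedge_power k \<theta>' m p v"
  using assms(2)
proof (induction m arbitrary: v)
  case (Suc m)
  have "\<theta> p (\<lambda>i. v (\<sigma> i)) = \<theta>' p (\<lambda>i. v (\<sigma> i))" for \<sigma>
    by (rule assms(1)) (rule Suc.prems)
  moreover have "wedge_power k \<theta> m p (\<lambda>i. v (\<sigma> (k + i))) = wedge_power k \<theta>' m p (\<lambda>i. v (\<sigma> (k + i)))" for \<sigma>
    by (rule Suc.IH) (rule Suc.prems)
  ultimately show ?case by (simp add: wedge_def)
qed simp

text \<open>This replaces the rule \<open>\<eta> \<and> \<eta> = 0\<close> and the graded commutativity and associativity of the wedge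
  product.\<close>

lemma contact_top_cong_kernel:
  fixes \<eta> \<theta> \<theta>' :: "('m, 'e::euclidean_space) form"
  assumes \<eta>: "alternating_form 1 (\<eta> p)" and \<theta>: "alternating_form 2 (\<theta> p)" "alternating_form 2 (\<theta>' p)"
    and eq: "\<And>u. (\<And>i. \<eta> p (\<lambda>_. u i) = 0) \<Longrightarrow> \<theta> p u = \<theta>' p u"
  shows "contact_top n \<eta> \<theta> p v = contact_top n \<eta> \<theta>' p v"
proof (rule alternating_form_eqI_kernel[where a = "\<lambda>x. \<eta> p (\<lambda>_. x)" and k = "2 * n + 1"])
  have e: "\<eta> p u = \<eta> p (\<lambda>_. u 0)" for u
    by (rule alternating_form_cong[OF \<eta>]) simp
  have "linear (\<lambda>x. \<eta> p ((\<lambda>_. 0)(0 := x)))"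
    by (rule alternating_form_linear[OF \<eta>]) simp
  then show "linear (\<lambda>x. \<eta> p (\<lambda>_. x))"
    by (subst (asm) e) simp
  fix v :: "nat \<Rightarrow> 'e" assume v: "\<And>i. 0 < i \<Longrightarrow> \<eta> p (\<lambda>_. v i) = 0"
  \<comment> \<open>All arguments but the first now lie in the kernel. If \<open>\<sigma> 0\<close>
    is not 0, the factor \<eta> receives one of these and vanishes; otherwise the power of \<theta>
    receives only these, where \<theta> and \<theta>' agree.\<close>
  have "\<eta> p (\<lambda>i. v (\<sigma> i)) * wedge_power 2 \<theta> n p (\<lambda>i. v (\<sigma> (1 + i))) =
      \<eta> p (\<lambda>i. v (\<sigma> i)) * wedge_power 2 \<theta>' n p (\<lambda>i. v (\<sigma> (1 + i)))"
    if \<sigma>: "\<sigma> permutes {..<1 + 2 * n}" for \<sigma>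
  proof (cases "\<sigma> 0 = 0")
    case True
    then have "\<sigma> (1 + i) > 0" for i
      using permutes_inj[OF \<sigma>] by (metis add_is_0 bot_nat_0.not_eq_extremum injD one_neq_zero)
    then have "wedge_power 2 \<theta> n p (\<lambda>i. v (\<sigma> (1 + i))) = wedge_power 2 \<theta>' n p (\<lambda>i. v (\<sigma> (1 + i)))"
      by (intro wedge_power_cong_kernel[where P = "\<lambda>x. \<eta> p (\<lambda>_. x) = 0"] eq v) auto
    then show ?thesis by simp
  next
    case False
    then have "\<eta> p (\<lambda>i. v (\<sigma> i)) = 0" by (subst e) (simp add: v)
    then show ?thesis by simp
  qed
  then show "contact_top n \<eta> \<theta> p v = contact_top n \<eta> \<theta>' p v"
    unfolding contact_top_def wedge_def
    by (intro arg_cong2[where f = "(/)"] sum.cong) (auto simp: mult.assoc)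
qed (intro alternating_form_contact_top \<eta> \<theta>)+

text \<open>The predicate \<open>Q\<close> will stand for polynomials in \<open>t\<close> of bounded degree, for smooth functions, and
  for pairs of curves with the same one-jet.\<close>

lemma contact_top_closed:
  fixes Q :: "nat \<Rightarrow> ('x \<Rightarrow> real) \<Rightarrow> bool"
  assumes const: "\<And>c. Q 0 (\<lambda>_. c)"
    and add: "\<And>d f g. Q d f \<Longrightarrow> Q d g \<Longrightarrow> Q d (\<lambda>x. f x + g x)"
    and mult: "\<And>d e f g. Q d f \<Longrightarrow> Q e g \<Longrightarrow> Q (d + e) (\<lambda>x. f x * g x)"
    and \<eta>: "\<And>v. Q 1 (\<lambda>x. \<eta> x (p x) v)" and \<theta>: "\<And>v. Q 1 (\<lambda>x. \<theta> x (p x) v)"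
  shows "Q (n + 1) (\<lambda>x. contact_top n (\<eta> x) (\<theta> x) (p x) v)"
proof -
  have scale: "Q d (\<lambda>x. c * f x)" if "Q d f" for c d f
    using mult[OF const that, of c] by simp
  \<comment> \<open>The index set is nonempty because constants, zero included, are given to satisfy
    \<open>Q 0\<close> only.\<close>
  have sum: "Q d (\<lambda>x. \<Sum>i\<in>I. f i x)" if "finite I" "I \<noteq> {}" "\<And>i. i \<in> I \<Longrightarrow> Q d (f i)"
    for d I and f :: "(nat \<Rightarrow> nat) \<Rightarrow> 'x \<Rightarrow> real"
    using that by (induction I rule: finite_ne_induct) (auto intro: add)
  have wedge: "Q (d + e) (\<lambda>x. wedge k l (\<omega> x) (\<tau> x) (p x) v)"
    if "\<And>v. Q d (\<lambda>x. \<omega> x (p x) v)" "\<And>v. Q e (\<lambda>x. \<tau> x (p x) v)" for d e k l \<omega> \<tau> v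
  proof -
    have "finite {\<sigma>. \<sigma> permutes {..<k + l}}" "{\<sigma>. \<sigma> permutes {..<k + l}} \<noteq> {}"
      by (auto simp: finite_permutations intro: permutes_id)
    then have "Q (d + e) (\<lambda>x. (1 / (fact k * fact l)) * (\<Sum>\<sigma> | \<sigma> permutes {..<k + l}.
        of_int (sign \<sigma>) * (\<omega> x (p x) (\<lambda>i. v (\<sigma> i)) * \<tau> x (p x) (\<lambda>i. v (\<sigma> (k + i))))))"
      by (intro scale sum mult that)
    then show ?thesis by (simp add: wedge_def mult.assoc)
  qed
  have "Q m (\<lambda>x. wedge_power 2 (\<theta> x) m (p x) v)" for m v
  proof (induction m arbitrary: v)
    case 0
    then show ?case using const[of 1] by (simp add: fun_form_def)
  next
    case (Suc m)
    show ?case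
      using wedge[of 1 \<theta> m "\<lambda>x. wedge_power 2 (\<theta> x) m" 2 "2 * m" v, OF \<theta> Suc] by simp
  qed
  from wedge[of 1 \<eta> n "\<lambda>x. wedge_power 2 (\<theta> x) n" 1 "2 * n" v, OF \<eta> this]
  show ?thesis by (simp add: contact_top_def)
qed

text \<open>Each of the n + 1 factors is affine in t. This bounds the number of coefficients and
  will provide their existence.\<close>

lemma contact_top_polynomial:
  "\<exists>P::real poly. degree P \<le> n + 1 \<and>
    (\<forall>t. contact_top n (\<lambda>q u. \<eta> q u + t * \<beta> q u) (\<lambda>q u. \<theta> q u + t * \<tau> q u) p v = poly P t)"
proof -
  define Q :: "nat \<Rightarrow> (real \<Rightarrow> real) \<Rightarrow> bool"
    where "Q d f \<longleftrightarrow> (\<exists>P. degree P \<le> d \<and> f = poly P)" for d f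
  have affine: "Q 1 (\<lambda>t. a + t * b)" for a b
    unfolding Q_def by (rule exI[of _ "[:a, b:]"]) (auto simp: fun_eq_iff)
  have "Q (n + 1) (\<lambda>t. contact_top n (\<lambda>q u. \<eta> q u + t * \<beta> q u) (\<lambda>q u. \<theta> q u + t * \<tau> q u) p v)"
  proof (rule contact_top_closed[where p = "\<lambda>_. p" and Q = Q])
    show "Q 0 (\<lambda>_. c)" for c
      unfolding Q_def by (rule exI[of _ "[:c:]"]) (auto simp: fun_eq_iff)
    show "Q d (\<lambda>x. f x + g x)" if fg: "Q d f" "Q d g" for d f g
    proof -
      obtain F G where "degree F \<le> d" "f = poly F" "degree G \<le> d" "g = poly G"
        using fg unfolding Q_def by blast
      then show ?thesis
        unfolding Q_def by (intro exI[of _ "F + G"]) (auto intro: degree_add_le)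
    qed
    show "Q (d + e) (\<lambda>x. f x * g x)" if fg: "Q d f" "Q e g" for d e f g
    proof -
      obtain F G where "degree F \<le> d" "f = poly F" "degree G \<le> e" "g = poly G"
        using fg unfolding Q_def by blast
      then show ?thesis
        unfolding Q_def using degree_mult_le[of F G] by (intro exI[of _ "F * G"]) auto
    qed
  qed (rule affine)+
  then show ?thesis
    unfolding Q_def by (simp only: fun_eq_iff)
qed

section \<open>Calculus of smooth maps on open sets\<close>

lemma frechet_derivative_cong_open:
  assumes "open S" "x \<in> S" "\<And>y. y \<in> S \<Longrightarrow> f y = g y"
  shows "frechet_derivative f (at x) = frechet_derivative g (at x)"
proof -
  have "(f has_derivative D) (at x) \<longleftrightarrow> (g has_derivative D) (at x)" for D
    using assms has_derivative_transform_within_open[of f D x UNIV S g]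
      has_derivative_transform_within_open[of g D x UNIV S f] by auto
  then show ?thesis
    unfolding frechet_derivative_def by simp
qed

lemma differentiable_cong_open:
  assumes "open S" "x \<in> S" "\<And>y. y \<in> S \<Longrightarrow> f y = g y" "f differentiable (at x)"
  shows "g differentiable (at x)"
  using assms has_derivative_transform_within_open[of f _ x UNIV S g]
  unfolding differentiable_def by blast

lemma frechet_derivative_eqI:
  "(f has_derivative D) (at x) \<Longrightarrow> frechet_derivative f (at x) = D"
  by (metis frechet_derivative_at)

lemma has_frechet_derivative:
  "f differentiable (at x) \<Longrightarrow> (f has_derivative frechet_derivative f (at x)) (at x)"
  by (simp add: frechet_derivative_works)

section \<open>Closure properties of k times differentiable functions\<close>

lemma times_differentiable_on_Suc_imp:
  "times_differentiable_on (Suc k) S f \<Longrightarrow> times_differentiable_on k S f"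
proof (induction k arbitrary: f)
  case 0
  then show ?case
    by (auto intro!: continuous_at_imp_continuous_on differentiable_imp_continuous_within)
next
  case (Suc k)
  then show ?case
    by (metis times_differentiable_on.simps(2))
qed

lemma times_differentiable_on_cong:
  assumes "open S"
  shows "(\<And>x. x \<in> S \<Longrightarrow> f x = g x) \<Longrightarrow> times_differentiable_on k S f \<Longrightarrow>
    times_differentiable_on k S g"
proof (induction k arbitrary: f g)
  case 0
  then show ?case
    by (auto cong: continuous_on_cong_simp)
next
  case (Suc k)
  have D: "frechet_derivative f (at x) v = frechet_derivative g (at x) v" if "x \<in> S" for x v
    using frechet_derivative_cong_open[OF assms that, of f g] Suc.prems by metis
  show ?case
  proof (simp, intro conjI ballI allI)
    show "g differentiable (at x)" if "x \<in> S" for x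
      using differentiable_cong_open[OF assms that, of f g] Suc.prems that by auto
    show "times_differentiable_on k S (\<lambda>x. frechet_derivative g (at x) v)" for v
      using Suc.prems(2) by (intro Suc.IH[OF D]) auto
  qed
qed

text \<open>Smoothness of the pullback and of the coefficients \<open>C j\<close> is visible only
  near each point, where a suitable chart or frame is available; this glues the local
  results.\<close>

lemma times_differentiable_on_local:
  assumes "\<And>x. x \<in> S \<Longrightarrow> \<exists>T. open T \<and> x \<in> T \<and> times_differentiable_on k T f"
  shows "times_differentiable_on k S f"
  using assms
proof (induction k arbitrary: f)
  case 0
  show ?case
  proof (simp, rule continuous_at_imp_continuous_on, rule ballI)
    fix x assume "x \<in> S"
    with 0 obtain T where "open T" "x \<in> T" "continuous_on T f" by auto
    then show "isCont f x" by (simp add: continuous_on_eq_continuous_at)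
  qed
next
  case (Suc k)
  show ?case
  proof (simp, intro conjI ballI allI)
    show "f differentiable (at x)" if "x \<in> S" for x
      using Suc.prems[OF that] by auto
    show "times_differentiable_on k S (\<lambda>x. frechet_derivative f (at x) v)" for v
      using Suc.prems by (intro Suc.IH) (auto, blast)
  qed
qed

lemma times_differentiable_on_subset:
  "times_differentiable_on k T f \<Longrightarrow> S \<subseteq> T \<Longrightarrow> times_differentiable_on k S f"
  by (induction k arbitrary: f) (auto intro: continuous_on_subset)

text \<open>Admits an explicit derivative known on S only, in place of the choice operator behind
  \<open>frechet_derivative\<close>.\<close>

lemma times_differentiable_on_SucI:
  assumes "open S" and d: "\<And>x. x \<in> S \<Longrightarrow> (f has_derivative f' x) (at x)"
    and "\<And>v. times_differentiable_on k S (\<lambda>x. f' x v)"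
  shows "times_differentiable_on (Suc k) S f"
proof -
  have "times_differentiable_on k S (\<lambda>x. frechet_derivative f (at x) v)" for v
    by (rule times_differentiable_on_cong[OF assms(1) _ assms(3)[of v]])
      (simp add: frechet_derivative_eqI[OF d])
  with differentiableI[OF d] show ?thesis by simp
qed

lemma times_differentiable_on_const: "times_differentiable_on k S (\<lambda>_. c)"
  by (induction k arbitrary: c) auto

lemma times_differentiable_on_add:
  assumes "open S"
  shows "times_differentiable_on k S f \<Longrightarrow> times_differentiable_on k S g \<Longrightarrow>
    times_differentiable_on k S (\<lambda>x. f x + g x)"
proof (induction k arbitrary: f g)
  case 0
  then show ?case by (auto intro: continuous_on_add)
next
  case (Suc k)
  show ?case
    by (rule times_differentiable_on_SucI[OF assms
          has_derivative_add[OF has_frechet_derivative has_frechet_derivative]])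
      (use Suc in auto)
qed

lemma times_differentiable_on_sum:
  assumes "open S" "\<And>i. i \<in> I \<Longrightarrow> times_differentiable_on k S (f i)"
  shows "times_differentiable_on k S (\<lambda>x. \<Sum>i\<in>I. f i x)"
  using assms(2)
  by (induction I rule: infinite_finite_induct)
    (auto intro: times_differentiable_on_const times_differentiable_on_add[OF assms(1)])

lemma times_differentiable_on_scaleR:
  assumes "open S"
  shows "times_differentiable_on k S f \<Longrightarrow> times_differentiable_on k S g \<Longrightarrow>
    times_differentiable_on k S (\<lambda>x. f x *\<^sub>R g x)"
proof (induction k arbitrary: f g)
  case 0
  then show ?case by (auto intro: continuous_on_scaleR)
next
  case (Suc k)
  show ?case
    by (rule times_differentiable_on_SucI[OF assms
          has_derivative_scaleR[OF has_frechet_derivative has_frechet_derivative]])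
      (use Suc Suc.prems[THEN times_differentiable_on_Suc_imp] in
        \<open>auto intro!: times_differentiable_on_add[OF assms]\<close>)
qed

lemma times_differentiable_on_inverse:
  fixes f :: "'e::euclidean_space \<Rightarrow> real"
  assumes "open S" "\<And>x. x \<in> S \<Longrightarrow> f x \<noteq> 0"
  shows "times_differentiable_on k S f \<Longrightarrow> times_differentiable_on k S (\<lambda>x. inverse (f x))"
proof (induction k)
  case 0
  then show ?case using assms by (auto intro!: continuous_on_inverse)
next
  case (Suc k)
  have d: "(f has_derivative frechet_derivative f (at x)) (at x)" if "x \<in> S" for x
    using Suc.prems that by (auto intro: has_frechet_derivative)
  \<comment> \<open>Arranged as scalar products so that the product rule applies: the derivative
    again contains \<open>inverse (f x)\<close>, which is k times differentiable by
    induction.\<close>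
  have d2: "((\<lambda>x. inverse (f x)) has_derivative
      (\<lambda>v. ((-1) *\<^sub>R (inverse (f x) *\<^sub>R inverse (f x))) *\<^sub>R frechet_derivative f (at x) v)) (at x)"
    if "x \<in> S" for x
    using Deriv.has_derivative_inverse[OF assms(2)[OF that] d[OF that]] by (simp add: mult_ac)
  show ?case
    using Suc.prems Suc.prems[THEN times_differentiable_on_Suc_imp]
    by (intro times_differentiable_on_SucI[OF assms(1) d2] times_differentiable_on_scaleR[OF assms(1)]
        times_differentiable_on_const Suc.IH) auto
qed

lemma times_differentiable_on_inner:
  fixes f :: "'e::euclidean_space \<Rightarrow> 'f::real_inner"
  assumes "open S"
  shows "times_differentiable_on k S f \<Longrightarrow> times_differentiable_on k S (\<lambda>x. f x \<bullet> b)"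
proof (induction k arbitrary: f)
  case 0
  then show ?case by (auto intro: continuous_on_inner continuous_on_const)
next
  case (Suc k)
  show ?case
    by (rule times_differentiable_on_SucI[OF assms
          has_derivative_inner_left[OF has_frechet_derivative]])
      (use Suc in auto)
qed

lemma linear_euclidean_expand:
  fixes L :: "'e::euclidean_space \<Rightarrow> 'f::real_vector"
  assumes "linear L"
  shows "L v = (\<Sum>b\<in>Basis. (v \<bullet> b) *\<^sub>R L b)"
proof -
  have "L v = L (\<Sum>b\<in>Basis. (v \<bullet> b) *\<^sub>R b)" by (simp add: euclidean_representation)
  also have "\<dots> = (\<Sum>b\<in>Basis. (v \<bullet> b) *\<^sub>R L b)"
    using assms by (simp add: linear_sum linear_scale)
  finally show ?thesis .
qed

text \<open>Iterated derivatives are defined through fixed directions, whereas the chain rule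
  differentiates g in a direction varying with x. Expanding that direction in a basis gives a sum of
  products to which the induction hypothesis applies.\<close>

lemma times_differentiable_on_compose:
  fixes f :: "'e::euclidean_space \<Rightarrow> 'f::euclidean_space" and g :: "'f \<Rightarrow> 'g::real_normed_vector"
  assumes "open S" "f ` S \<subseteq> T"
  shows "times_differentiable_on k S f \<Longrightarrow> times_differentiable_on k T g \<Longrightarrow>
    times_differentiable_on k S (\<lambda>x. g (f x))"
proof (induction k arbitrary: g)
  case 0
  then show ?case using assms by (auto intro: continuous_on_compose2)
next
  case (Suc k)
  have gd: "g differentiable (at (f x))" if "x \<in> S" for x
    using Suc.prems assms that by auto
  have g1: "((\<lambda>x. g (f x)) has_derivative
      (\<lambda>v. frechet_derivative g (at (f x)) (frechet_derivative f (at x) v))) (at x)"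
    if "x \<in> S" for x
    using Suc.prems assms that gd
    by (intro has_derivative_compose[of f _ x UNIV g] has_frechet_derivative) auto
  have g2: "frechet_derivative g (at (f x)) w =
      (\<Sum>b\<in>Basis. (w \<bullet> b) *\<^sub>R frechet_derivative g (at (f x)) b)" if "x \<in> S" for x w
    by (intro linear_euclidean_expand linear_frechet_derivative gd that)
  have d: "((\<lambda>x. g (f x)) has_derivative (\<lambda>v. \<Sum>b\<in>Basis.
      (frechet_derivative f (at x) v \<bullet> b) *\<^sub>R frechet_derivative g (at (f x)) b)) (at x)"
    if "x \<in> S" for x
    using g1[OF that] by (simp only: g2[OF that, of "frechet_derivative f (at x) _"])
  show ?case
    using Suc.prems times_differentiable_on_Suc_imp[OF Suc.prems(1)]
    by (intro times_differentiable_on_SucI[OF assms(1) d] times_differentiable_on_sum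
        times_differentiable_on_scaleR times_differentiable_on_inner assms(1) Suc.IH) auto
qed

lemma smooth_on_differentiable: "smooth_on S f \<Longrightarrow> x \<in> S \<Longrightarrow> f differentiable (at x)"
  unfolding smooth_on_def by (metis times_differentiable_on.simps(2))

lemma smooth_on_frechet_derivative:
  "smooth_on S f \<Longrightarrow> smooth_on S (\<lambda>x. frechet_derivative f (at x) v)"
  unfolding smooth_on_def by (metis times_differentiable_on.simps(2))

lemma smooth_on_imp_continuous_on: "smooth_on S f \<Longrightarrow> continuous_on S f"
  unfolding smooth_on_def by (metis times_differentiable_on.simps(1))

lemma smooth_on_cong:
  "open S \<Longrightarrow> (\<And>x. x \<in> S \<Longrightarrow> f x = g x) \<Longrightarrow> smooth_on S f \<Longrightarrow> smooth_on S g"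
  unfolding smooth_on_def using times_differentiable_on_cong by blast

lemma smooth_on_subset: "smooth_on T f \<Longrightarrow> S \<subseteq> T \<Longrightarrow> smooth_on S f"
  unfolding smooth_on_def using times_differentiable_on_subset by blast

lemma smooth_on_local:
  "(\<And>x. x \<in> S \<Longrightarrow> \<exists>T. open T \<and> x \<in> T \<and> smooth_on T f) \<Longrightarrow> smooth_on S f"
  unfolding smooth_on_def by (meson times_differentiable_on_local)

lemma smooth_on_const: "smooth_on S (\<lambda>_. c)"
  unfolding smooth_on_def by (simp add: times_differentiable_on_const)

lemma smooth_on_add:
  "open S \<Longrightarrow> smooth_on S f \<Longrightarrow> smooth_on S g \<Longrightarrow> smooth_on S (\<lambda>x. f x + g x)"
  unfolding smooth_on_def by (simp add: times_differentiable_on_add)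

lemma smooth_on_sum:
  "open S \<Longrightarrow> (\<And>i. i \<in> I \<Longrightarrow> smooth_on S (f i)) \<Longrightarrow> smooth_on S (\<lambda>x. \<Sum>i\<in>I. f i x)"
  unfolding smooth_on_def by (simp add: times_differentiable_on_sum)

lemma smooth_on_scaleR:
  "open S \<Longrightarrow> smooth_on S f \<Longrightarrow> smooth_on S g \<Longrightarrow> smooth_on S (\<lambda>x. f x *\<^sub>R g x)"
  unfolding smooth_on_def by (simp add: times_differentiable_on_scaleR)

lemma smooth_on_mult:
  fixes f g :: "'e::euclidean_space \<Rightarrow> real"
  shows "open S \<Longrightarrow> smooth_on S f \<Longrightarrow> smooth_on S g \<Longrightarrow> smooth_on S (\<lambda>x. f x * g x)"
  using smooth_on_scaleR[of S f g] by simp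

lemma smooth_on_minus:
  fixes f :: "'e::euclidean_space \<Rightarrow> real"
  shows "open S \<Longrightarrow> smooth_on S f \<Longrightarrow> smooth_on S (\<lambda>x. - f x)"
  using smooth_on_mult[OF _ smooth_on_const[of S "-1"], of f] by simp

lemma smooth_on_diff:
  fixes f g :: "'e::euclidean_space \<Rightarrow> real"
  shows "open S \<Longrightarrow> smooth_on S f \<Longrightarrow> smooth_on S g \<Longrightarrow> smooth_on S (\<lambda>x. f x - g x)"
  using smooth_on_add[OF _ _ smooth_on_minus, of S f g] by simp

lemma smooth_on_divide:
  fixes f g :: "'e::euclidean_space \<Rightarrow> real"
  assumes "open S" "smooth_on S f" "smooth_on S g" "\<And>x. x \<in> S \<Longrightarrow> g x \<noteq> 0"
  shows "smooth_on S (\<lambda>x. f x / g x)"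
proof -
  have "smooth_on S (\<lambda>x. inverse (g x))"
    using assms unfolding smooth_on_def by (simp add: times_differentiable_on_inverse)
  from smooth_on_mult[OF assms(1,2) this] show ?thesis by (simp add: divide_inverse)
qed

lemma smooth_on_inner:
  fixes f :: "'e::euclidean_space \<Rightarrow> 'f::real_inner"
  shows "open S \<Longrightarrow> smooth_on S f \<Longrightarrow> smooth_on S (\<lambda>x. f x \<bullet> b)"
  unfolding smooth_on_def by (simp add: times_differentiable_on_inner)

lemma smooth_on_compose:
  fixes f :: "'e::euclidean_space \<Rightarrow> 'f::euclidean_space" and g :: "'f \<Rightarrow> 'g::real_normed_vector"
  shows "open S \<Longrightarrow> f ` S \<subseteq> T \<Longrightarrow> smooth_on S f \<Longrightarrow> smooth_on T g \<Longrightarrow>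
    smooth_on S (\<lambda>x. g (f x))"
  unfolding smooth_on_def by (simp add: times_differentiable_on_compose)

lemma smooth_on_eval:
  fixes B :: "'d::euclidean_space \<Rightarrow> 'e::euclidean_space \<Rightarrow> real"
  assumes "open S" "\<And>y. y \<in> S \<Longrightarrow> linear (B y)" "\<And>u. smooth_on S (\<lambda>y. B y u)" "smooth_on S w"
  shows "smooth_on S (\<lambda>y. B y (w y))"
proof (rule smooth_on_cong[OF assms(1)])
  show "smooth_on S (\<lambda>y. \<Sum>b\<in>Basis. (w y \<bullet> b) *\<^sub>R B y b)"
    by (intro smooth_on_sum smooth_on_scaleR smooth_on_inner assms)
qed (metis linear_euclidean_expand assms(2))

text \<open>Linearity of \<open>B y\<close> near x turns \<open>B y (w y)\<close> into a finite sum
  of products in a basis; the vector is frozen in the first resulting term, the form in the second.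
  This one product rule serves \<alpha>(X), d\<alpha>(X, v) and changes of chart.\<close>

lemma has_derivative_eval:
  fixes B :: "'d::euclidean_space \<Rightarrow> 'e::euclidean_space \<Rightarrow> real"
  assumes "open S" "x \<in> S" "\<And>y. y \<in> S \<Longrightarrow> linear (B y)"
    and dB: "\<And>u. (\<lambda>y. B y u) differentiable (at x)" and dw: "w differentiable (at x)"
  shows "((\<lambda>y. B y (w y)) has_derivative
    (\<lambda>v. frechet_derivative (\<lambda>y. B y (w x)) (at x) v + B x (frechet_derivative w (at x) v))) (at x)"
proof -
  have *: "((\<lambda>y. \<Sum>b\<in>Basis. (w y \<bullet> b) *\<^sub>R B y b) has_derivative
      (\<lambda>v. \<Sum>b\<in>Basis. (w x \<bullet> b) *\<^sub>R frechet_derivative (\<lambda>y. B y b) (at x) v +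
        (frechet_derivative w (at x) v \<bullet> b) *\<^sub>R B x b)) (at x)"
    by (intro derivative_intros has_frechet_derivative dB dw)
  have e: "B y u = (\<Sum>b\<in>Basis. (u \<bullet> b) *\<^sub>R B y b)" if "y \<in> S" for y u
    by (rule linear_euclidean_expand[OF assms(3)[OF that]])
  have "((\<lambda>y. \<Sum>b\<in>Basis. (w x \<bullet> b) *\<^sub>R B y b) has_derivative
      (\<lambda>v. \<Sum>b\<in>Basis. (w x \<bullet> b) *\<^sub>R frechet_derivative (\<lambda>y. B y b) (at x) v)) (at x)"
    by (auto intro!: derivative_eq_intros has_frechet_derivative dB)
  then have 1: "frechet_derivative (\<lambda>y. B y (w x)) (at x) =
      (\<lambda>v. \<Sum>b\<in>Basis. (w x \<bullet> b) *\<^sub>R frechet_derivative (\<lambda>y. B y b) (at x) v)"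
    by (intro frechet_derivative_eqI, elim has_derivative_transform_within_open[OF _ assms(1,2)])
      (rule e[symmetric])
  have 2: "(\<lambda>v. \<Sum>b\<in>Basis. (w x \<bullet> b) *\<^sub>R frechet_derivative (\<lambda>y. B y b) (at x) v +
        (frechet_derivative w (at x) v \<bullet> b) *\<^sub>R B x b) =
      (\<lambda>v. frechet_derivative (\<lambda>y. B y (w x)) (at x) v + B x (frechet_derivative w (at x) v))"
    by (simp only: 1 e[OF assms(2), of "frechet_derivative w (at x) _"] sum.distrib)
  show ?thesis
    by (rule has_derivative_transform_within_open[OF *[unfolded 2] assms(1,2)]) (rule e[symmetric])
qed

section \<open>Derivatives along lines and symmetry of second derivatives\<close>

lemma has_real_derivative_line:
  fixes F :: "'e::real_normed_vector \<Rightarrow> real"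
  assumes "F differentiable (at (y + s *\<^sub>R w))"
  shows "((\<lambda>s. F (y + s *\<^sub>R w)) has_real_derivative
    frechet_derivative F (at (y + s *\<^sub>R w)) w) (at s)"
proof -
  have "((\<lambda>s. F (y + s *\<^sub>R w)) has_derivative
      (\<lambda>r. frechet_derivative F (at (y + s *\<^sub>R w)) (r *\<^sub>R w))) (at s)"
    using has_frechet_derivative[OF assms]
    by (intro has_derivative_compose[of "\<lambda>s. y + s *\<^sub>R w" _ s UNIV F])
      (auto intro!: derivative_eq_intros)
  then show ?thesis
    by (rule has_derivative_imp_has_field_derivative)
      (simp add: linear_scale[OF linear_frechet_derivative[OF assms]])
qed

text \<open>The second difference is symmetric in u and v, so using the result in both orders
  compares the two mixed derivatives at two points near x.\<close>

lemma second_difference_mean_value: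
  fixes f :: "'e::euclidean_space \<Rightarrow> real"
  assumes "open S" "smooth_on S f" "h > 0"
    and sub: "\<And>s t. 0 \<le> s \<Longrightarrow> s \<le> h \<Longrightarrow> 0 \<le> t \<Longrightarrow> t \<le> h \<Longrightarrow> x + s *\<^sub>R u + t *\<^sub>R v \<in> S"
  obtains s t where "0 \<le> s" "s \<le> h" "0 \<le> t" "t \<le> h"
    "f (x + h *\<^sub>R u + h *\<^sub>R v) - f (x + h *\<^sub>R u) - f (x + h *\<^sub>R v) + f x =
      h * h * frechet_derivative (\<lambda>y. frechet_derivative f (at y) u) (at (x + s *\<^sub>R u + t *\<^sub>R v)) v"
proof -
  let ?g = "\<lambda>y. frechet_derivative f (at y) u"
  have fd: "f differentiable (at y)" and gd: "?g differentiable (at y)" if "y \<in> S" for y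
    using assms(2) that smooth_on_differentiable smooth_on_frechet_derivative by blast+
  \<comment> \<open>A difference in direction v as a function of s: the mean value theorem is
    applied first in s, then to the u-derivative of f in direction v.\<close>
  define \<phi> where "\<phi> s = f ((x + h *\<^sub>R v) + s *\<^sub>R u) - f (x + s *\<^sub>R u)" for s
  have "\<exists>s>0. s < h \<and> \<phi> h - \<phi> 0 = (h - 0) * (?g ((x + h *\<^sub>R v) + s *\<^sub>R u) - ?g (x + s *\<^sub>R u))"
    unfolding \<phi>_def
    by (intro MVT2 derivative_intros has_real_derivative_line fd assms(3))
      (use sub[of _ h] sub[of _ 0] assms(3) in \<open>auto simp: algebra_simps\<close>)
  then obtain s where s: "0 < s" "s < h"
    and 1: "\<phi> h - \<phi> 0 = h * (?g ((x + s *\<^sub>R u) + h *\<^sub>R v) - ?g ((x + s *\<^sub>R u) + 0 *\<^sub>R v))"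
    by (auto simp: algebra_simps)
  have "\<exists>t>0. t < h \<and> ?g ((x + s *\<^sub>R u) + h *\<^sub>R v) - ?g ((x + s *\<^sub>R u) + 0 *\<^sub>R v) =
      (h - 0) * frechet_derivative ?g (at ((x + s *\<^sub>R u) + t *\<^sub>R v)) v"
    by (intro MVT2 has_real_derivative_line gd assms(3)) (use sub[of s] s in auto)
  then obtain t where "0 < t" "t < h" "?g ((x + s *\<^sub>R u) + h *\<^sub>R v) - ?g ((x + s *\<^sub>R u) + 0 *\<^sub>R v) =
      h * frechet_derivative ?g (at ((x + s *\<^sub>R u) + t *\<^sub>R v)) v"
    by auto
  with s 1 that[of s t] show thesis
    by (auto simp: \<phi>_def algebra_simps)
qed

lemma second_derivative_symmetric_real:
  fixes f :: "'e::euclidean_space \<Rightarrow> real"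
  assumes "open S" "smooth_on S f" "x \<in> S"
  shows "frechet_derivative (\<lambda>y. frechet_derivative f (at y) u) (at x) v =
    frechet_derivative (\<lambda>y. frechet_derivative f (at y) v) (at x) u"
proof (rule ccontr)
  define P where "P y = frechet_derivative (\<lambda>y. frechet_derivative f (at y) u) (at y) v" for y
  define Q where "Q y = frechet_derivative (\<lambda>y. frechet_derivative f (at y) v) (at y) u" for y
  assume "\<not> ?thesis"
  then have ne: "P x \<noteq> Q x" by (simp add: P_def Q_def)
  \<comment> \<open>Half of the gap, so that values within \<open>e\<close> of \<open>P x\<close>
    and of \<open>Q x\<close> cannot coincide.\<close>
  define e where "e = \<bar>P x - Q x\<bar> / 2"
  have e: "e > 0" using ne by (simp add: e_def)
  have "smooth_on S P" "smooth_on S Q"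
    unfolding P_def Q_def by (intro smooth_on_frechet_derivative assms)+
  then have "isCont P x" "isCont Q x"
    using smooth_on_imp_continuous_on assms continuous_on_eq_continuous_at by blast+
  then have "\<exists>d>0. \<forall>y. dist y x < d \<longrightarrow> dist (P y) (P x) < e"
    and "\<exists>d>0. \<forall>y. dist y x < d \<longrightarrow> dist (Q y) (Q x) < e"
    using e by (auto simp: continuous_at_eps_delta)
  then obtain d1 d2 where d: "d1 > 0" "d2 > 0"
    "\<And>y. dist y x < d1 \<Longrightarrow> dist (P y) (P x) < e" "\<And>y. dist y x < d2 \<Longrightarrow> dist (Q y) (Q x) < e"
    by (elim exE conjE) simp
  obtain d3 where d3: "d3 > 0" "ball x d3 \<subseteq> S"
    using assms(1,3) openE by blast
  define r where "r = min d1 (min d2 d3)"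
  have r: "r > 0" using d d3 by (simp add: r_def)
  \<comment> \<open>The summand 1 keeps \<open>N\<close> positive when u = v = 0.\<close>
  define N where "N = norm u + norm v + 1"
  have pos: "N > 0" unfolding N_def by (smt (verit) norm_ge_zero)
  \<comment> \<open>This makes the whole parallelogram lie within r / 2 of x.\<close>
  define h where "h = r / 2 / N"
  have h: "h > 0" using r pos by (simp add: h_def)
  have small: "dist (x + s *\<^sub>R a + t *\<^sub>R b) x < r"
    if "0 \<le> s" "s \<le> h" "0 \<le> t" "t \<le> h" "norm a + norm b = norm u + norm v" for s t a b
  proof -
    have "dist (x + s *\<^sub>R a + t *\<^sub>R b) x \<le> s * norm a + t * norm b"
      using norm_triangle_ineq[of "s *\<^sub>R a" "t *\<^sub>R b"] that by (simp add: dist_norm add.assoc)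
    also have "\<dots> \<le> h * norm a + h * norm b"
      using that by (intro add_mono mult_right_mono) auto
    also have "\<dots> \<le> h * N"
      using that h by (simp add: N_def flip: distrib_left)
    also have "\<dots> = r / 2" using pos by (simp add: h_def)
    finally show ?thesis using r by simp
  qed
  have inS: "x + s *\<^sub>R a + t *\<^sub>R b \<in> S"
    if "0 \<le> s" "s \<le> h" "0 \<le> t" "t \<le> h" "norm a + norm b = norm u + norm v" for s t a b
    using small[OF that] d3 by (auto simp: r_def dist_commute)
  obtain s t where st: "0 \<le> s" "s \<le> h" "0 \<le> t" "t \<le> h"
    "f (x + h *\<^sub>R u + h *\<^sub>R v) - f (x + h *\<^sub>R u) - f (x + h *\<^sub>R v) + f x =
      h * h * P (x + s *\<^sub>R u + t *\<^sub>R v)"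
    using second_difference_mean_value[OF assms(1,2) h, of x u v] inS[of _ _ u v]
    unfolding P_def by metis
  obtain s' t' where st': "0 \<le> s'" "s' \<le> h" "0 \<le> t'" "t' \<le> h"
    "f (x + h *\<^sub>R v + h *\<^sub>R u) - f (x + h *\<^sub>R v) - f (x + h *\<^sub>R u) + f x =
      h * h * Q (x + s' *\<^sub>R v + t' *\<^sub>R u)"
    using second_difference_mean_value[OF assms(1,2) h, of x v u] inS[of _ _ v u]
    unfolding Q_def by (metis add.commute)
  \<comment> \<open>Both sides are the same second difference.\<close>
  have "h * h * P (x + s *\<^sub>R u + t *\<^sub>R v) = h * h * Q (x + s' *\<^sub>R v + t' *\<^sub>R u)"
    using st(5) st'(5) by (simp add: algebra_simps)
  then have "P (x + s *\<^sub>R u + t *\<^sub>R v) = Q (x + s' *\<^sub>R v + t' *\<^sub>R u)" using h by simp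
  moreover have "dist (P (x + s *\<^sub>R u + t *\<^sub>R v)) (P x) < e"
    using small[OF st(1-4), of u v] by (intro d(3)) (simp add: r_def)
  moreover have "dist (Q (x + s' *\<^sub>R v + t' *\<^sub>R u)) (Q x) < e"
    using small[OF st'(1-4), of v u] by (intro d(4)) (simp add: r_def)
  ultimately show False
    unfolding e_def dist_real_def by (smt (verit) field_sum_of_halves)
qed

lemma frechet_derivative_inner:
  fixes f :: "'e::real_normed_vector \<Rightarrow> 'f::real_inner"
  assumes "f differentiable (at x)"
  shows "frechet_derivative (\<lambda>x. f x \<bullet> b) (at x) v = frechet_derivative f (at x) v \<bullet> b"
  using frechet_derivative_eqI[OF has_derivative_inner_left[OF has_frechet_derivative[OF assms]]] by simp

lemma second_derivative_symmetric:
  fixes f :: "'e::euclidean_space \<Rightarrow> 'f::euclidean_space"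
  assumes "open S" "smooth_on S f" "x \<in> S"
  shows "frechet_derivative (\<lambda>y. frechet_derivative f (at y) u) (at x) v =
    frechet_derivative (\<lambda>y. frechet_derivative f (at y) v) (at x) u"
proof (rule euclidean_eqI)
  fix b :: 'f assume "b \<in> Basis"
  have *: "frechet_derivative (\<lambda>y. frechet_derivative f (at y) u) (at x) v \<bullet> b =
      frechet_derivative (\<lambda>y. frechet_derivative (\<lambda>y. f y \<bullet> b) (at y) u) (at x) v" for u v
  proof -
    have "frechet_derivative (\<lambda>y. frechet_derivative f (at y) u) (at x) v \<bullet> b =
        frechet_derivative (\<lambda>y. frechet_derivative f (at y) u \<bullet> b) (at x) v"
      using assms
      by (intro frechet_derivative_inner[symmetric] smooth_on_differentiable[of S]
          smooth_on_frechet_derivative)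
    also have "\<dots> = frechet_derivative (\<lambda>y. frechet_derivative (\<lambda>y. f y \<bullet> b) (at y) u) (at x) v"
      using assms smooth_on_differentiable[OF assms(2)]
      by (subst frechet_derivative_cong_open[of S]) (auto simp: frechet_derivative_inner)
    finally show ?thesis .
  qed
  show "frechet_derivative (\<lambda>y. frechet_derivative f (at y) u) (at x) v \<bullet> b =
      frechet_derivative (\<lambda>y. frechet_derivative f (at y) v) (at x) u \<bullet> b"
    unfolding * using assms by (intro second_derivative_symmetric_real[of S] smooth_on_inner)
qed

section \<open>Charts\<close>

lemma frechet_derivative_chain:
  assumes "open S" "x \<in> S" "\<And>y. y \<in> S \<Longrightarrow> h y = g (f y)"
    and "f differentiable (at x)" "g differentiable (at (f x))"
  shows "frechet_derivative h (at x) v =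
    frechet_derivative g (at (f x)) (frechet_derivative f (at x) v)"
proof -
  have "((\<lambda>y. g (f y)) has_derivative
      (\<lambda>v. frechet_derivative g (at (f x)) (frechet_derivative f (at x) v))) (at x)"
    using assms by (intro has_derivative_compose[of f _ x UNIV g] has_frechet_derivative)
  from frechet_derivative_eqI[OF this] show ?thesis
    using frechet_derivative_cong_open[OF assms(1-3)] by simp
qed

text \<open>\<open>to_chart\<close> and \<open>from_chart\<close> are the cases in which one of the
  charts is the preferred one at p, so a single composition law yields all their rules.\<close>

definition chart_change :: "('m, 'e::euclidean_space) chart \<Rightarrow> ('m, 'e) chart \<Rightarrow> 'm \<Rightarrow> 'e \<Rightarrow> 'e" where
  "chart_change c c' p = frechet_derivative (cmap c' \<circ> cinv c) (at (cmap c p))"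

text \<open>The constant sequence stands for any sequence starting with u, as an alternating 1-form
  sees only entry 0.\<close>

definition covector ::
    "('m, 'e::euclidean_space) chart set \<Rightarrow> ('m, 'e) chart \<Rightarrow> ('m, 'e) form \<Rightarrow> 'e \<Rightarrow> 'e \<Rightarrow> real" where
  "covector A c \<alpha> y u = local_form A c \<alpha> y (\<lambda>_. u)"

text \<open>The exterior derivative of a coordinate one-form on constant fields, in the convention
  without the factor 1/2, to match \<open>ext_deriv\<close>.\<close>

definition curl :: "('e::euclidean_space \<Rightarrow> 'e \<Rightarrow> real) \<Rightarrow> 'e \<Rightarrow> 'e \<Rightarrow> 'e \<Rightarrow> real" where
  "curl B y u v = frechet_derivative (\<lambda>z. B z v) (at y) u - frechet_derivative (\<lambda>z. B z u) (at y) v"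

locale manifold =
  fixes A :: "('m::{t2_space, second_countable_topology}, 'e::euclidean_space) chart set"
  assumes manifold: "smooth_manifold A"
begin

section \<open>Tangent vectors and forms under change of chart\<close>

lemma chart_at: "chart_at A p \<in> A" "p \<in> cdom (chart_at A p)"
proof -
  have "\<exists>c. c \<in> A \<and> p \<in> cdom c"
    using manifold unfolding smooth_manifold_def by blast
  from someI_ex[OF this] show "chart_at A p \<in> A" "p \<in> cdom (chart_at A p)"
    by (simp_all add: chart_at_def)
qed

lemma chart_homeomorphism:
  assumes "c \<in> A"
  shows "open (cdom c)" "open (cmap c ` cdom c)"
    "homeomorphism (cdom c) (cmap c ` cdom c) (cmap c) (cinv c)"
  using manifold assms unfolding smooth_manifold_def by blast+

lemma cinv_cmap: "c \<in> A \<Longrightarrow> p \<in> cdom c \<Longrightarrow> cinv c (cmap c p) = p"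
  using chart_homeomorphism(3) homeomorphism_apply1 by blast

lemma open_chart_image:
  assumes "c \<in> A" "open U"
  shows "open (cmap c ` (cdom c \<inter> U))"
proof -
  have "openin (top_of_set (cdom c)) (cdom c \<inter> U)"
    using assms(2) by (simp add: openin_open_Int)
  then have "openin (top_of_set (cmap c ` cdom c)) (cmap c ` (cdom c \<inter> U))"
    using homeomorphism_imp_open_map[OF chart_homeomorphism(3)[OF assms(1)]] by blast
  then show ?thesis
    using chart_homeomorphism(2)[OF assms(1)] openin_open_trans by blast
qed

lemma transition_smooth:
  "c \<in> A \<Longrightarrow> c' \<in> A \<Longrightarrow> smooth_on (cmap c ` (cdom c \<inter> cdom c')) (cmap c' \<circ> cinv c)"
  using manifold unfolding smooth_manifold_def by blast

lemma transition_differentiable: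
  "c \<in> A \<Longrightarrow> c' \<in> A \<Longrightarrow> p \<in> cdom c \<Longrightarrow> p \<in> cdom c' \<Longrightarrow>
    (cmap c' \<circ> cinv c) differentiable (at (cmap c p))"
  by (rule smooth_on_differentiable[OF transition_smooth]) auto

lemma linear_chart_change:
  "c \<in> A \<Longrightarrow> c' \<in> A \<Longrightarrow> p \<in> cdom c \<Longrightarrow> p \<in> cdom c' \<Longrightarrow> linear (chart_change c c' p)"
  unfolding chart_change_def by (intro linear_frechet_derivative transition_differentiable)

lemma chart_change_self:
  assumes "c \<in> A" "p \<in> cdom c"
  shows "chart_change c c p u = u"
proof -
  have "frechet_derivative (cmap c \<circ> cinv c) (at (cmap c p)) =
      frechet_derivative (\<lambda>y. y) (at (cmap c p))"
    using assms
    by (intro frechet_derivative_cong_open[OF chart_homeomorphism(2)[OF assms(1)]])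
      (auto simp: cinv_cmap[OF assms(1)])
  then show ?thesis by (simp add: chart_change_def)
qed

lemma chart_change_trans:
  assumes "c \<in> A" "c' \<in> A" "c'' \<in> A" "p \<in> cdom c" "p \<in> cdom c'" "p \<in> cdom c''"
  shows "chart_change c' c'' p (chart_change c c' p u) = chart_change c c'' p u"
proof -
  have "frechet_derivative (cmap c'' \<circ> cinv c) (at (cmap c p)) u =
      frechet_derivative (cmap c'' \<circ> cinv c') (at ((cmap c' \<circ> cinv c) (cmap c p)))
        (frechet_derivative (cmap c' \<circ> cinv c) (at (cmap c p)) u)"
    using assms chart_homeomorphism(1)[OF assms(2)] transition_differentiable[of c c' p]
      transition_differentiable[of c' c'' p]
    by (intro frechet_derivative_chain[OF open_chart_image[OF assms(1), of "cdom c'"]])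
      (auto simp: cinv_cmap o_def)
  then show ?thesis
    using assms by (simp add: chart_change_def cinv_cmap)
qed

lemma to_chart_eq: "to_chart A c p = chart_change (chart_at A p) c p"
  by (simp add: to_chart_def chart_change_def)

lemma from_chart_eq: "from_chart A c p = chart_change c (chart_at A p) p"
  by (simp add: from_chart_def chart_change_def)

lemma from_to_chart: "c \<in> A \<Longrightarrow> p \<in> cdom c \<Longrightarrow> from_chart A c p (to_chart A c p u) = u"
  by (simp add: to_chart_eq from_chart_eq chart_change_trans chart_change_self chart_at)

lemma to_from_chart: "c \<in> A \<Longrightarrow> p \<in> cdom c \<Longrightarrow> to_chart A c p (from_chart A c p u) = u"
  by (simp add: to_chart_eq from_chart_eq chart_change_trans chart_change_self chart_at)

lemma from_chart_change:
  "c \<in> A \<Longrightarrow> c' \<in> A \<Longrightarrow> p \<in> cdom c \<Longrightarrow> p \<in> cdom c' \<Longrightarrow>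
    from_chart A c' p (chart_change c c' p u) = from_chart A c p u"
  by (simp add: from_chart_eq chart_change_trans chart_at)

lemma from_chart_at: "from_chart A (chart_at A p) p u = u"
  by (simp add: from_chart_eq chart_change_self chart_at)

lemma to_chart_at: "to_chart A (chart_at A p) p u = u"
  by (simp add: to_chart_eq chart_change_self chart_at)

lemma linear_from_chart: "c \<in> A \<Longrightarrow> p \<in> cdom c \<Longrightarrow> linear (from_chart A c p)"
  unfolding from_chart_eq by (intro linear_chart_change chart_at)

lemma local_form_change:
  assumes "c \<in> A" "c' \<in> A" "p \<in> cdom c" "p \<in> cdom c'"
  shows "local_form A c \<omega> (cmap c p) v =
    local_form A c' \<omega> (cmap c' p) (\<lambda>i. chart_change c c' p (v i))"
  using assms by (simp add: local_form_def cinv_cmap from_chart_change)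

lemma local_form_chart_at: "local_form A (chart_at A p) \<omega> (cmap (chart_at A p) p) v = \<omega> p v"
  by (simp add: local_form_def cinv_cmap from_chart_at chart_at)

lemma local_form_to_chart:
  "c \<in> A \<Longrightarrow> p \<in> cdom c \<Longrightarrow> local_form A c \<omega> (cmap c p) (\<lambda>i. to_chart A c p (v i)) = \<omega> p v"
  by (simp add: local_form_def cinv_cmap from_to_chart)

lemma local_field_cmap: "c \<in> A \<Longrightarrow> p \<in> cdom c \<Longrightarrow> local_field A c X (cmap c p) = to_chart A c p (X p)"
  by (simp add: local_field_def cinv_cmap)

lemma covector_local_field:
  "c \<in> A \<Longrightarrow> p \<in> cdom c \<Longrightarrow>
    covector A c \<alpha> (cmap c p) (local_field A c X (cmap c p)) = \<alpha> p (\<lambda>_. X p)"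
  by (simp add: covector_def local_field_cmap local_form_to_chart)

lemma alternating_form_local_form:
  assumes "c \<in> A" "p \<in> cdom c" and \<omega>: "alternating_form k (\<omega> p)"
  shows "alternating_form k (local_form A c \<omega> (cmap c p))"
proof -
  let ?g = "from_chart A c p"
  have eq: "local_form A c \<omega> (cmap c p) v = \<omega> p (\<lambda>i. ?g (v i))" for v
    using assms by (simp add: local_form_def cinv_cmap)
  have upd: "(\<lambda>j. ?g ((v(i := x)) j)) = (\<lambda>j. ?g (v j))(i := ?g x)" for v i x
    by auto
  show ?thesis
    unfolding alternating_form_def eq
  proof (intro conjI allI impI)
    show "\<omega> p (\<lambda>i. ?g (v i)) = \<omega> p (\<lambda>i. ?g (w i))" if "\<forall>i<k. v i = w i" for v w
      using that by (intro alternating_form_cong[OF \<omega>]) simp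
    show "linear (\<lambda>x. \<omega> p (\<lambda>j. ?g ((v(i := x)) j)))" if "i < k" for v i
    proof -
      have "linear (\<lambda>x. \<omega> p ((\<lambda>j. ?g (v j))(i := x)))"
        by (rule alternating_form_linear[OF \<omega> that])
      from linear_compose[OF linear_from_chart[OF assms(1,2)] this] show ?thesis
        unfolding upd by (simp add: o_def)
    qed
    show "\<omega> p (\<lambda>i. ?g (v i)) = 0" if "i < k" "j < k" "i \<noteq> j" "v i = v j" for v i j
      using that(4) by (intro alternating_form_eq_0[OF \<omega> that(1-3)]) simp
  qed
qed

lemma smooth_form_local_form:
  "smooth_form A k U \<omega> \<Longrightarrow> c \<in> A \<Longrightarrow> smooth_on (cmap c ` (cdom c \<inter> U)) (\<lambda>y. local_form A c \<omega> y v)"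
  unfolding smooth_form_def by blast

lemma smooth_form_alternating: "smooth_form A k U \<omega> \<Longrightarrow> p \<in> U \<Longrightarrow> alternating_form k (\<omega> p)"
  unfolding smooth_form_def by blast

lemma smooth_form_subset: "smooth_form A k U \<omega> \<Longrightarrow> V \<subseteq> U \<Longrightarrow> smooth_form A k V \<omega>"
  unfolding smooth_form_def by (blast intro: smooth_on_subset)

lemma smooth_fun_subset: "smooth_fun A U f \<Longrightarrow> V \<subseteq> U \<Longrightarrow> smooth_fun A V f"
  unfolding smooth_fun_def by (blast intro: smooth_on_subset)

lemma one_form_eval:
  assumes "alternating_form 1 (\<alpha> p)" "u = v 0"
  shows "\<alpha> p (\<lambda>_. u) = \<alpha> p v"
proof -
  show ?thesis
    by (rule alternating_form_cong[OF assms(1)]) (simp add: assms(2))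
qed

lemma one_form_linear:
  assumes "alternating_form 1 (\<alpha> p)"
  shows "linear (\<lambda>u. \<alpha> p (\<lambda>_. u))"
proof -
  have "linear (\<lambda>u. \<alpha> p ((\<lambda>_. 0)(0 := u)))"
    by (rule alternating_form_linear[OF assms]) simp
  moreover have "\<alpha> p ((\<lambda>_. 0)(0 := u)) = \<alpha> p (\<lambda>_. u)" for u
    using one_form_eval[of \<alpha> p u "(\<lambda>_. 0)(0 := u)", OF assms] by simp
  ultimately show ?thesis by simp
qed

section \<open>One-forms, functions and their derivatives in a fixed chart\<close>

lemma local_form_covector:
  assumes "smooth_form A 1 U \<alpha>" "c \<in> A" "y \<in> cmap c ` (cdom c \<inter> U)"
  shows "local_form A c \<alpha> y v = covector A c \<alpha> y (v 0)"
proof -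
  obtain p where p: "p \<in> cdom c" "p \<in> U" "y = cmap c p" using assms(3) by blast
  have "alternating_form 1 (local_form A c \<alpha> y)"
    unfolding p(3)
    by (rule alternating_form_local_form[of c p 1 \<alpha>, OF assms(2) p(1) smooth_form_alternating[OF assms(1) p(2)]])
  then show ?thesis
    unfolding covector_def using one_form_eval[of "local_form A c \<alpha>" y "v 0" v] by simp
qed

lemma covector_linear:
  assumes "smooth_form A 1 U \<alpha>" "c \<in> A" "y \<in> cmap c ` (cdom c \<inter> U)"
  shows "linear (covector A c \<alpha> y)"
proof -
  obtain p where p: "p \<in> cdom c" "p \<in> U" "y = cmap c p" using assms(3) by blast
  have "alternating_form 1 (local_form A c \<alpha> y)"
    unfolding p(3)
    by (rule alternating_form_local_form[of c p 1 \<alpha>, OF assms(2) p(1) smooth_form_alternating[OF assms(1) p(2)]])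
  then show ?thesis
    unfolding covector_def by (rule one_form_linear)
qed

lemma covector_smooth:
  "smooth_form A 1 U \<alpha> \<Longrightarrow> c \<in> A \<Longrightarrow> smooth_on (cmap c ` (cdom c \<inter> U)) (\<lambda>y. covector A c \<alpha> y u)"
  unfolding covector_def by (rule smooth_form_local_form)

lemma covector_change:
  "c \<in> A \<Longrightarrow> c' \<in> A \<Longrightarrow> p \<in> cdom c \<Longrightarrow> p \<in> cdom c' \<Longrightarrow>
    covector A c \<alpha> (cmap c p) u = covector A c' \<alpha> (cmap c' p) (chart_change c c' p u)"
  unfolding covector_def by (rule local_form_change)

text \<open>Differentiating the transformation law of a one-form adds a term with the second
  derivative of the transition map. That term is symmetric in u and v and cancels in the
  curl.\<close>

lemma curl_covector_change:
  assumes U: "open U" and \<alpha>: "smooth_form A 1 U \<alpha>"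
    and c: "c \<in> A" "p \<in> cdom c" and c': "c' \<in> A" "p \<in> cdom c'" and p: "p \<in> U"
  shows "curl (covector A c \<alpha>) (cmap c p) u v =
    curl (covector A c' \<alpha>) (cmap c' p) (chart_change c c' p u) (chart_change c c' p v)"
proof -
  define S where "S = cmap c ` (cdom c \<inter> (cdom c' \<inter> U))"
  define \<psi> where "\<psi> = cmap c' \<circ> cinv c"
  define y where "y = cmap c p"
  define B where "B = covector A c' \<alpha>"
  define D where "D z = frechet_derivative \<psi> (at z)" for z
  have S: "open S"
    unfolding S_def using U c c' by (intro open_chart_image) (auto intro: chart_homeomorphism(1))
  have yS: "y \<in> S" using c c' p by (auto simp: S_def y_def)
  have \<psi>: "smooth_on S \<psi>"
    unfolding \<psi>_def by (rule smooth_on_subset[OF transition_smooth[OF c(1) c'(1)]]) (auto simp: S_def)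
  have \<psi>y: "\<psi> y = cmap c' p" "\<psi> ` S \<subseteq> cmap c' ` (cdom c' \<inter> U)"
    using c by (auto simp: \<psi>_def y_def S_def cinv_cmap)
  have D: "D (cmap c q) = chart_change c c' q" for q
    by (simp add: D_def \<psi>_def chart_change_def)
  have eq: "covector A c \<alpha> z u = B (\<psi> z) (D z u)" if "z \<in> S" for z u
    using that c c' by (auto simp: S_def B_def D \<psi>_def cinv_cmap covector_change[of c c'])
  have lin: "linear (B (\<psi> z))" if "z \<in> S" for z
    using that \<psi>y(2) unfolding B_def by (intro covector_linear[OF \<alpha> c'(1)]) auto
  have Bs: "smooth_on S (\<lambda>z. B (\<psi> z) u)" for u
    unfolding B_def by (rule smooth_on_compose[OF S \<psi>y(2) \<psi> covector_smooth[OF \<alpha> c'(1)]])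
  have Ds: "smooth_on S (\<lambda>z. D z u)" for u
    unfolding D_def by (rule smooth_on_frechet_derivative[OF \<psi>])
  have key: "frechet_derivative (\<lambda>z. covector A c \<alpha> z u) (at y) v =
      frechet_derivative (\<lambda>z. B z (D y u)) (at (\<psi> y)) (D y v) +
      B (\<psi> y) (frechet_derivative (\<lambda>z. D z u) (at y) v)" for u v
  proof -
    have "frechet_derivative (\<lambda>z. covector A c \<alpha> z u) (at y) v =
        frechet_derivative (\<lambda>z. B (\<psi> z) (D z u)) (at y) v"
      using eq by (subst frechet_derivative_cong_open[OF S yS]) auto
    also have "\<dots> = frechet_derivative (\<lambda>z. B (\<psi> z) (D y u)) (at y) v +
        B (\<psi> y) (frechet_derivative (\<lambda>z. D z u) (at y) v)"
      using frechet_derivative_eqI[OF has_derivative_eval[OF S yS lin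
            smooth_on_differentiable[OF Bs yS] smooth_on_differentiable[OF Ds yS]]]
      by simp
    also have "frechet_derivative (\<lambda>z. B (\<psi> z) (D y u)) (at y) v =
        frechet_derivative (\<lambda>z. B z (D y u)) (at (\<psi> y)) (D y v)"
      unfolding D_def B_def using \<psi>y(2) yS
      by (intro frechet_derivative_chain[OF S yS] smooth_on_differentiable[OF \<psi>]
          smooth_on_differentiable[OF covector_smooth[OF \<alpha> c'(1)]]) auto
    finally show ?thesis .
  qed
  have "frechet_derivative (\<lambda>z. D z u) (at y) v = frechet_derivative (\<lambda>z. D z v) (at y) u"
    unfolding D_def by (rule second_derivative_symmetric[OF S \<psi> yS])
  then show ?thesis
    unfolding curl_def y_def[symmetric] \<psi>y(1)[symmetric] D[symmetric] key B_def[symmetric] by simp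
qed

text \<open>\<open>ext_deriv\<close> is computed at each point in the preferred chart there, and
  these charts are unrelated. A formula valid throughout one chart is what allows d\<alpha> to be
  differentiated.\<close>

lemma local_form_ext_deriv:
  assumes U: "open U" and \<alpha>: "smooth_form A 1 U \<alpha>" and c: "c \<in> A" and y: "y \<in> cmap c ` (cdom c \<inter> U)"
  shows "local_form A c (ext_deriv A 1 \<alpha>) y v = curl (covector A c \<alpha>) y (v 0) (v 1)"
proof -
  obtain p where p: "p \<in> cdom c" "p \<in> U" "y = cmap c p" using y by blast
  let ?c = "chart_at A p"
  have S: "open (cmap ?c ` (cdom ?c \<inter> U))" "cmap ?c p \<in> cmap ?c ` (cdom ?c \<inter> U)"
    using p(2) by (auto intro: open_chart_image U chart_at)
  have "frechet_derivative (\<lambda>y. local_form A ?c \<alpha> y w) (at (cmap ?c p)) =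
      frechet_derivative (\<lambda>y. covector A ?c \<alpha> y (w 0)) (at (cmap ?c p))" for w
    by (rule frechet_derivative_cong_open[OF S]) (rule local_form_covector[OF \<alpha> chart_at(1)])
  then have *: "ext_deriv A 1 \<alpha> p w = curl (covector A ?c \<alpha>) (cmap ?c p) (w 0) (w 1)" for w
    by (simp add: ext_deriv_def Let_def curl_def)
  show ?thesis
    unfolding p(3) local_form_change[OF c chart_at(1) p(1) chart_at(2)] local_form_chart_at *
    by (rule curl_covector_change[OF U \<alpha> c p(1) chart_at p(2), symmetric])
qed

lemma ext_deriv_fun:
  assumes "open U" "smooth_fun A U f" "c \<in> A" "p \<in> cdom c" "p \<in> U"
  shows "ext_deriv A 0 (fun_form f) p v =
    frechet_derivative (f \<circ> cinv c) (at (cmap c p)) (to_chart A c p (v 0))"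
proof -
  let ?c = "chart_at A p"
  have "ext_deriv A 0 (fun_form f) p v = frechet_derivative (f \<circ> cinv ?c) (at (cmap ?c p)) (v 0)"
    by (simp add: ext_deriv_def Let_def local_form_def fun_form_def o_def)
  also have "\<dots> = frechet_derivative (f \<circ> cinv c) (at ((cmap c \<circ> cinv ?c) (cmap ?c p)))
      (frechet_derivative (cmap c \<circ> cinv ?c) (at (cmap ?c p)) (v 0))"
  proof (rule frechet_derivative_chain[OF open_chart_image[OF chart_at(1) chart_homeomorphism(1)[OF assms(3)]]])
    have "(f \<circ> cinv c) differentiable (at (cmap c p))"
      using assms unfolding smooth_fun_def by (intro smooth_on_differentiable) auto
    then show "(f \<circ> cinv c) differentiable (at ((cmap c \<circ> cinv ?c) (cmap ?c p)))"
      by (simp add: cinv_cmap chart_at)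
    show "(cmap c \<circ> cinv ?c) differentiable (at (cmap ?c p))"
      by (intro transition_differentiable chart_at assms)
  qed (use assms chart_at in \<open>auto simp: cinv_cmap\<close>)
  finally show ?thesis
    by (simp add: cinv_cmap chart_at to_chart_def)
qed

lemma field_apply_eq: "field_apply A X f p = ext_deriv A 0 (fun_form f) p (\<lambda>_. X p)"
  by (simp add: field_apply_def ext_deriv_def Let_def local_form_def fun_form_def o_def)

lemma field_apply_chart:
  assumes "open U" "smooth_fun A U f" "c \<in> A" "p \<in> cdom c" "p \<in> U"
  shows "field_apply A X f p =
    frechet_derivative (f \<circ> cinv c) (at (cmap c p)) (local_field A c X (cmap c p))"
  using assms by (simp add: field_apply_eq ext_deriv_fun local_field_cmap)

lemma smooth_fun_field_apply:
  assumes "open U" "smooth_fun A U f" "smooth_field A X"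
  shows "smooth_fun A U (field_apply A X f)"
  unfolding smooth_fun_def
proof
  fix c assume c: "c \<in> A"
  let ?S = "cmap c ` (cdom c \<inter> U)"
  have S: "open ?S" by (rule open_chart_image[OF c assms(1)])
  have f: "smooth_on ?S (f \<circ> cinv c)" using assms(2) c by (simp add: smooth_fun_def)
  have X: "smooth_on ?S (local_field A c X)"
    using assms(3) c by (auto simp: smooth_field_def intro: smooth_on_subset)
  have "smooth_on ?S (\<lambda>y. frechet_derivative (f \<circ> cinv c) (at y) (local_field A c X y))"
    by (rule smooth_on_eval[OF S _ _ X])
      (assumption | intro smooth_on_frechet_derivative[OF f] linear_frechet_derivative smooth_on_differentiable[OF f])+
  then show "smooth_on ?S (field_apply A X f \<circ> cinv c)"
    by (rule smooth_on_cong[OF S, rotated]) (auto simp: cinv_cmap c field_apply_chart[OF assms(1,2) c])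
qed

lemma smooth_fun_one_form_field:
  assumes "open U" "smooth_form A 1 U \<alpha>" "smooth_field A X"
  shows "smooth_fun A U (\<lambda>p. \<alpha> p (\<lambda>_. X p))"
  unfolding smooth_fun_def
proof
  fix c assume c: "c \<in> A"
  let ?S = "cmap c ` (cdom c \<inter> U)"
  have S: "open ?S" by (rule open_chart_image[OF c assms(1)])
  have X: "smooth_on ?S (local_field A c X)"
    using assms(3) c by (auto simp: smooth_field_def intro: smooth_on_subset)
  have "smooth_on ?S (\<lambda>y. covector A c \<alpha> y (local_field A c X y))"
    by (rule smooth_on_eval[OF S _ _ X])
      (auto intro: covector_smooth[OF assms(2) c] covector_linear[OF assms(2) c])
  then show "smooth_on ?S ((\<lambda>p. \<alpha> p (\<lambda>_. X p)) \<circ> cinv c)"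
    by (rule smooth_on_cong[OF S, rotated]) (auto simp: cinv_cmap c covector_local_field)
qed

lemma smooth_fun_divide:
  assumes "open U" "smooth_fun A U f" "smooth_fun A U g" "\<And>p. p \<in> U \<Longrightarrow> g p \<noteq> 0"
  shows "smooth_fun A U (\<lambda>p. f p / g p)"
  unfolding smooth_fun_def
proof
  fix c assume c: "c \<in> A"
  have "smooth_on (cmap c ` (cdom c \<inter> U)) (\<lambda>y. (f \<circ> cinv c) y / (g \<circ> cinv c) y)"
    using assms c
    by (intro smooth_on_divide open_chart_image) (auto simp: smooth_fun_def cinv_cmap o_def)
  then show "smooth_on (cmap c ` (cdom c \<inter> U)) ((\<lambda>p. f p / g p) \<circ> cinv c)"
    by (simp add: o_def)
qed

text \<open>This makes the set where \<open>K\<close> is nonzero open.\<close>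

lemma smooth_fun_continuous:
  assumes "smooth_fun A UNIV f"
  shows "continuous_on UNIV f"
proof (rule continuous_at_imp_continuous_on, rule ballI)
  fix p
  let ?c = "chart_at A p"
  have "continuous_on (cmap ?c ` cdom ?c) (f \<circ> cinv ?c)"
    using assms chart_at(1) smooth_on_imp_continuous_on unfolding smooth_fun_def
    by (metis Int_UNIV_right)
  moreover have "continuous_on (cdom ?c) (cmap ?c)"
    using chart_homeomorphism(3)[OF chart_at(1)] by (rule homeomorphism_cont1)
  ultimately have "continuous_on (cdom ?c) ((f \<circ> cinv ?c) \<circ> cmap ?c)"
    by (rule continuous_on_compose[rotated])
  then have "continuous_on (cdom ?c) f"
    by (rule continuous_on_eq) (simp add: cinv_cmap chart_at(1))
  then show "isCont f p"
    using chart_at chart_homeomorphism(1) continuous_on_eq_continuous_at by blast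
qed

lemma smooth_form_scale:
  assumes "open U" "smooth_fun A U f" "smooth_form A 1 U \<alpha>"
  shows "smooth_form A 1 U (\<lambda>p v. f p * \<alpha> p v)"
  unfolding smooth_form_def
proof (intro conjI ballI allI)
  show "alternating_form 1 (\<lambda>v. f p * \<alpha> p v)" if "p \<in> U" for p
    using alternating_form_combination[OF smooth_form_alternating[OF assms(3) that]
        smooth_form_alternating[OF assms(3) that], of "f p" 0] by simp
  fix c and v :: "nat \<Rightarrow> 'e" assume c: "c \<in> A"
  have "smooth_on (cmap c ` (cdom c \<inter> U)) (\<lambda>y. (f \<circ> cinv c) y * local_form A c \<alpha> y v)"
    using assms c
    by (intro smooth_on_mult open_chart_image smooth_form_local_form) (auto simp: smooth_fun_def o_def)
  then show "smooth_on (cmap c ` (cdom c \<inter> U)) (\<lambda>y. local_form A c (\<lambda>p v. f p * \<alpha> p v) y v)"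
    by (simp add: local_form_def o_def)
qed

section \<open>Tangent maps and pullbacks\<close>

lemma tangent_map_differentiable:
  assumes "smooth_self_map A \<Phi>" "c \<in> A" "c' \<in> A" "p \<in> cdom c" "\<Phi> p \<in> cdom c'"
  shows "(cmap c' \<circ> \<Phi> \<circ> cinv c) differentiable (at (cmap c p))"
proof (rule smooth_on_differentiable)
  show "smooth_on (cmap c ` (cdom c \<inter> \<Phi> -` cdom c')) (cmap c' \<circ> \<Phi> \<circ> cinv c)"
    using assms(1-3) unfolding smooth_self_map_def by blast
qed (use assms in auto)

lemma tangent_map_chart:
  assumes \<Phi>: "smooth_self_map A \<Phi>" and c: "c \<in> A" "p \<in> cdom c" and c': "c' \<in> A" "\<Phi> p \<in> cdom c'"
  shows "tangent_map A \<Phi> p (from_chart A c p u) =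
    from_chart A c' (\<Phi> p) (frechet_derivative (cmap c' \<circ> \<Phi> \<circ> cinv c) (at (cmap c p)) u)"
proof -
  let ?p = "chart_at A p" and ?q = "chart_at A (\<Phi> p)"
  have cont: "open (\<Phi> -` V)" if "open V" for V
    using \<Phi> that unfolding smooth_self_map_def by (auto simp: continuous_on_open_vimage)
  \<comment> \<open>\<Phi>, read in \<open>c\<close> and in the preferred chart at
    \<open>\<Phi> p\<close>, factors in two ways: through the preferred chart at p and through
    \<open>c'\<close>. Equating the two chain rules gives the claim.\<close>
  have 1: "frechet_derivative (cmap ?q \<circ> \<Phi> \<circ> cinv c) (at (cmap c p)) u =
      frechet_derivative (cmap ?q \<circ> \<Phi> \<circ> cinv ?p) (at ((cmap ?p \<circ> cinv c) (cmap c p)))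
        (frechet_derivative (cmap ?p \<circ> cinv c) (at (cmap c p)) u)"
  proof (rule frechet_derivative_chain[OF open_chart_image[OF c(1) chart_homeomorphism(1)[OF chart_at(1)[of p]]]])
    show "cmap c p \<in> cmap c ` (cdom c \<inter> cdom ?p)" using c chart_at by blast
    show "(cmap ?q \<circ> \<Phi> \<circ> cinv ?p) differentiable (at ((cmap ?p \<circ> cinv c) (cmap c p)))"
      using tangent_map_differentiable[OF \<Phi> chart_at(1) chart_at(1) chart_at(2) chart_at(2)] c
      by (simp add: cinv_cmap)
    show "(cmap ?p \<circ> cinv c) differentiable (at (cmap c p))"
      by (intro transition_differentiable chart_at c)
  qed (use c chart_at in \<open>auto simp: cinv_cmap\<close>)
  have 2: "frechet_derivative (cmap ?q \<circ> \<Phi> \<circ> cinv c) (at (cmap c p)) u =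
      frechet_derivative (cmap ?q \<circ> cinv c') (at ((cmap c' \<circ> \<Phi> \<circ> cinv c) (cmap c p)))
        (frechet_derivative (cmap c' \<circ> \<Phi> \<circ> cinv c) (at (cmap c p)) u)"
  proof (rule frechet_derivative_chain[OF open_chart_image[OF c(1) cont[OF chart_homeomorphism(1)[OF c'(1)]]]])
    show "(cmap ?q \<circ> cinv c') differentiable (at ((cmap c' \<circ> \<Phi> \<circ> cinv c) (cmap c p)))"
      using transition_differentiable[OF c'(1) chart_at(1) c'(2) chart_at(2)] c
      by (simp add: cinv_cmap)
    show "(cmap c' \<circ> \<Phi> \<circ> cinv c) differentiable (at (cmap c p))"
      by (intro tangent_map_differentiable \<Phi> c c')
  qed (use c c' in \<open>auto simp: cinv_cmap\<close>)
  show ?thesis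
    using 1 2 c by (simp add: tangent_map_def from_chart_def cinv_cmap)
qed

lemma linear_tangent_map: "smooth_self_map A \<Phi> \<Longrightarrow> linear (tangent_map A \<Phi> p)"
  unfolding tangent_map_def
  by (intro linear_frechet_derivative tangent_map_differentiable chart_at)

text \<open>Near each point, one chart \<open>c'\<close> at the image suffices: there the pullback
  is a smooth coordinate one-form along the coordinate map F, evaluated on the derivative of F. This
  works for any rank of that derivative.\<close>

lemma smooth_form_pullback:
  assumes \<Phi>: "smooth_self_map A \<Phi>" and \<eta>: "smooth_form A 1 UNIV \<eta>"
  shows "smooth_form A 1 UNIV (pullback A \<Phi> \<eta>)"
proof -
  have alt: "alternating_form 1 (\<eta> q)" for q
    using smooth_form_alternating[OF \<eta>] by simp
  have ev: "pullback A \<Phi> \<eta> p v = \<eta> (\<Phi> p) (\<lambda>_. tangent_map A \<Phi> p (v 0))" for p v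
    unfolding pullback_def by (rule one_form_eval[symmetric, OF alt refl])
  show ?thesis
    unfolding smooth_form_def
  proof (intro conjI ballI allI)
    fix p
    have "linear (\<lambda>u. \<eta> (\<Phi> p) (\<lambda>_. tangent_map A \<Phi> p u))"
      using linear_compose[OF linear_tangent_map[OF \<Phi>] one_form_linear[of \<eta>, OF alt]]
      by (simp add: o_def)
    then show "alternating_form 1 (pullback A \<Phi> \<eta> p)"
      unfolding alternating_form_def ev by auto
  next
    fix c and v :: "nat \<Rightarrow> 'e" assume c: "c \<in> A"
    show "smooth_on (cmap c ` (cdom c \<inter> UNIV)) (\<lambda>y. local_form A c (pullback A \<Phi> \<eta>) y v)"
    proof (rule smooth_on_local)
      fix y assume "y \<in> cmap c ` (cdom c \<inter> UNIV)"
      then obtain p where p: "p \<in> cdom c" "y = cmap c p" by blast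
      define c' where "c' = chart_at A (\<Phi> p)"
      have c': "c' \<in> A" "\<Phi> p \<in> cdom c'" by (simp_all add: c'_def chart_at)
      define S where "S = cmap c ` (cdom c \<inter> \<Phi> -` cdom c')"
      define F where "F = cmap c' \<circ> \<Phi> \<circ> cinv c"
      have "open (\<Phi> -` cdom c')"
        using \<Phi> chart_homeomorphism(1)[OF c'(1)] unfolding smooth_self_map_def
        by (auto simp: continuous_on_open_vimage)
      then have S: "open S" unfolding S_def by (rule open_chart_image[OF c])
      have F: "smooth_on S F" "F ` S \<subseteq> cmap c' ` (cdom c' \<inter> UNIV)"
        using \<Phi> c c' unfolding smooth_self_map_def S_def F_def by (auto simp: cinv_cmap)
      have "smooth_on S (\<lambda>y. covector A c' \<eta> (F y) (frechet_derivative F (at y) (v 0)))"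
      proof (rule smooth_on_eval[OF S, where B = "\<lambda>y. covector A c' \<eta> (F y)"])
        show "linear (covector A c' \<eta> (F y))" if "y \<in> S" for y
          using F(2) that by (intro covector_linear[OF \<eta> c'(1)]) auto
        show "smooth_on S (\<lambda>y. covector A c' \<eta> (F y) u)" for u
          by (rule smooth_on_compose[OF S F(2) F(1) covector_smooth[OF \<eta> c'(1)]])
      qed (rule smooth_on_frechet_derivative[OF F(1)])
      then have "smooth_on S (\<lambda>y. local_form A c (pullback A \<Phi> \<eta>) y v)"
      proof (rule smooth_on_cong[OF S, rotated])
        fix y assume "y \<in> S"
        then obtain q where q: "q \<in> cdom c" "\<Phi> q \<in> cdom c'" "y = cmap c q" by (auto simp: S_def)
        then show "covector A c' \<eta> (F y) (frechet_derivative F (at y) (v 0)) =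
            local_form A c (pullback A \<Phi> \<eta>) y v"
          using c c' by (simp add: covector_def local_form_def ev cinv_cmap F_def
              tangent_map_chart[OF \<Phi> c q(1) c'(1) q(2)])
      qed
      moreover have "y \<in> S" using p c' by (auto simp: S_def)
      ultimately show "\<exists>T. open T \<and> y \<in> T \<and> smooth_on T (\<lambda>y. local_form A c (pullback A \<Phi> \<eta>) y v)"
        using S by blast
    qed
  qed
qed

end

section \<open>One-forms on open subsets of Euclidean space\<close>

lemma frechet_derivative_add:
  "f differentiable (at x) \<Longrightarrow> g differentiable (at x) \<Longrightarrow>
    frechet_derivative (\<lambda>y. f y + g y) (at x) v = frechet_derivative f (at x) v + frechet_derivative g (at x) v"
  by (subst frechet_derivative_eqI[OF has_derivative_add[OF has_frechet_derivative has_frechet_derivative]]) auto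

lemma frechet_derivative_mult:
  fixes f g :: "'e::real_normed_vector \<Rightarrow> real"
  shows "f differentiable (at x) \<Longrightarrow> g differentiable (at x) \<Longrightarrow>
    frechet_derivative (\<lambda>y. f y * g y) (at x) v =
      f x * frechet_derivative g (at x) v + frechet_derivative f (at x) v * g x"
  by (subst frechet_derivative_eqI[OF has_derivative_mult[OF has_frechet_derivative has_frechet_derivative]]) auto

lemma frechet_derivative_cmult:
  fixes f :: "'e::real_normed_vector \<Rightarrow> real"
  shows "f differentiable (at x) \<Longrightarrow>
    frechet_derivative (\<lambda>y. k * f y) (at x) v = k * frechet_derivative f (at x) v"
  by (subst frechet_derivative_eqI[OF has_derivative_mult_right[OF has_frechet_derivative]]) auto

locale smooth_covector =
  fixes W :: "'e::euclidean_space set" and B :: "'e \<Rightarrow> 'e \<Rightarrow> real"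
  assumes open_W: "open W"
    and B_linear: "\<And>y. y \<in> W \<Longrightarrow> linear (B y)"
    and B_smooth: "\<And>u. smooth_on W (\<lambda>y. B y u)"
begin

lemma B_differentiable: "y \<in> W \<Longrightarrow> (\<lambda>z. B z u) differentiable (at y)"
  by (rule smooth_on_differentiable[OF B_smooth])

lemma linear_derivative_B:
  assumes "y \<in> W"
  shows "linear (\<lambda>u. frechet_derivative (\<lambda>z. B z u) (at y) v)"
proof (rule linearI)
  note d = B_differentiable[OF assms]
  show "frechet_derivative (\<lambda>z. B z (u + u')) (at y) v =
      frechet_derivative (\<lambda>z. B z u) (at y) v + frechet_derivative (\<lambda>z. B z u') (at y) v" for u u'
    unfolding frechet_derivative_add[OF d d, symmetric]
    by (subst frechet_derivative_cong_open[OF open_W assms, of "\<lambda>z. B z (u + u')" "\<lambda>z. B z u + B z u'"])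
      (auto simp: linear_add[OF B_linear])
  show "frechet_derivative (\<lambda>z. B z (r *\<^sub>R u)) (at y) v =
      r *\<^sub>R frechet_derivative (\<lambda>z. B z u) (at y) v" for r u
    unfolding real_scaleR_def frechet_derivative_cmult[OF d, symmetric]
    by (subst frechet_derivative_cong_open[OF open_W assms, of "\<lambda>z. B z (r *\<^sub>R u)" "\<lambda>z. r * B z u"])
      (auto simp: linear_scale[OF B_linear])
qed

lemma linear_derivative_B_direction:
  "y \<in> W \<Longrightarrow> linear (\<lambda>v. frechet_derivative (\<lambda>z. B z u) (at y) v)"
  by (intro linear_frechet_derivative B_differentiable)

lemma curl_linear_right: "y \<in> W \<Longrightarrow> linear (curl B y u)"
  unfolding curl_def[abs_def]
  by (intro linear_compose_sub linear_derivative_B linear_derivative_B_direction)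

lemma curl_linear_left: "y \<in> W \<Longrightarrow> linear (\<lambda>u. curl B y u v)"
  unfolding curl_def[abs_def]
  by (intro linear_compose_sub linear_derivative_B linear_derivative_B_direction)

lemma curl_smooth: "smooth_on W (\<lambda>y. curl B y u v)"
  unfolding curl_def by (intro smooth_on_diff open_W smooth_on_frechet_derivative B_smooth)

lemma curl_differentiable: "y \<in> W \<Longrightarrow> (\<lambda>z. curl B z u v) differentiable (at y)"
  by (rule smooth_on_differentiable[OF curl_smooth])

lemma alternating_form_curl: "y \<in> W \<Longrightarrow> alternating_form 2 (\<lambda>v. curl B y (v 0) (v 1))"
  by (intro alternating_form_2 curl_linear_left curl_linear_right) (simp_all add: curl_def)

text \<open>This is d(dB) = 0 on the vectors w, u, v, solved for the derivative along w. With X as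
  w, it trades the derivative of dB along X for derivatives of i_X dB, which \<open>curl_X\<close>
  describes.\<close>

lemma closed_curl:
  assumes x: "x \<in> W"
  shows "frechet_derivative (\<lambda>y. curl B y u v) (at x) w =
    frechet_derivative (\<lambda>y. curl B y w v) (at x) u - frechet_derivative (\<lambda>y. curl B y w u) (at x) v"
proof -
  define S where "S u v w = frechet_derivative (\<lambda>y. frechet_derivative (\<lambda>z. B z w) (at y) u) (at x) v"
    for u v w
  have S: "frechet_derivative (\<lambda>y. curl B y u v) (at x) w = S u w v - S v w u" for u v w
  proof -
    have "(\<lambda>y. frechet_derivative (\<lambda>z. B z v) (at y) u) differentiable (at x)" for u v
      by (rule smooth_on_differentiable[OF smooth_on_frechet_derivative[OF B_smooth] x])
    from has_derivative_diff[OF has_frechet_derivative[OF this] has_frechet_derivative[OF this]]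
    show ?thesis
      unfolding curl_def S_def by (subst frechet_derivative_eqI) auto
  qed
  have "S u v w = S v u w" for u v w
    unfolding S_def by (rule second_derivative_symmetric[OF open_W B_smooth x])
  then show ?thesis by (simp add: S)
qed

end

text \<open>The equations \<open>\<alpha>(X) = -h\<close> and \<open>\<iota>\<^sub>X d\<alpha> = dh - a\<alpha>\<close>, which imply \<open>L\<^sub>X \<alpha> = -a\<alpha>\<close>.\<close>

locale conformal_covector = smooth_covector W B
  for W :: "'e::euclidean_space set" and B +
  fixes X :: "'e \<Rightarrow> 'e" and h a :: "'e \<Rightarrow> real"
  assumes X_smooth: "smooth_on W X" and h_smooth: "smooth_on W h" and a_smooth: "smooth_on W a"
    and B_X: "\<And>y. y \<in> W \<Longrightarrow> B y (X y) = - h y"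
    and curl_X: "\<And>y u. y \<in> W \<Longrightarrow> curl B y (X y) u = frechet_derivative h (at y) u - a y * B y u"
begin

abbreviation DX :: "'e \<Rightarrow> 'e \<Rightarrow> 'e" where "DX x \<equiv> frechet_derivative X (at x)"
abbreviation Da :: "'e \<Rightarrow> 'e \<Rightarrow> real" where "Da x \<equiv> frechet_derivative a (at x)"

lemma X_differentiable: "x \<in> W \<Longrightarrow> X differentiable (at x)"
  by (rule smooth_on_differentiable[OF X_smooth])

text \<open>The left side is the coordinate expression of L_X B. Differentiating B(X) = -h produces
  -dh, which cancels the dh of \<open>curl_X\<close>.\<close>

lemma lie_covector:
  assumes x: "x \<in> W"
  shows "frechet_derivative (\<lambda>z. B z u) (at x) (X x) + B x (DX x u) = - a x * B x u"
proof -
  have "((\<lambda>y. B y (X y)) has_derivative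
      (\<lambda>v. frechet_derivative (\<lambda>y. B y (X x)) (at x) v + B x (DX x v))) (at x)"
    using x by (intro has_derivative_eval[OF open_W] B_linear B_differentiable X_differentiable)
  from frechet_derivative_eqI[OF this]
  have "frechet_derivative (\<lambda>y. B y (X x)) (at x) u + B x (DX x u) =
      frechet_derivative (\<lambda>y. B y (X y)) (at x) u"
    by simp
  also have "\<dots> = frechet_derivative (\<lambda>y. (-1) * h y) (at x) u"
    by (subst frechet_derivative_cong_open[OF open_W x, of _ "\<lambda>y. (-1) * h y"]) (auto simp: B_X)
  also have "\<dots> = - frechet_derivative h (at x) u"
    by (subst frechet_derivative_cmult) (use x smooth_on_differentiable[OF h_smooth] in auto)
  finally show ?thesis
    using curl_X[OF x, of u] by (simp add: curl_def)
qed

text \<open>By Cartan's formula and d(dB) = 0, L_X dB = d(i_X dB) = d(dh - aB); the Hessian of h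
  drops out by symmetry.\<close>

lemma lie_curl:
  assumes x: "x \<in> W"
  shows "frechet_derivative (\<lambda>y. curl B y u v) (at x) (X x) +
      curl B x (DX x u) v + curl B x u (DX x v) =
    - (Da x u * B x v - Da x v * B x u) - a x * curl B x u v"
proof -
  \<comment> \<open>\<open>curl_X\<close> with second argument v, differentiated along u; the claim
    comes from antisymmetrising this in u and v.\<close>
  have key: "frechet_derivative (\<lambda>y. curl B y (X x) v) (at x) u + curl B x (DX x u) v =
      frechet_derivative (\<lambda>y. frechet_derivative h (at y) v) (at x) u -
        (a x * frechet_derivative (\<lambda>y. B y v) (at x) u + Da x u * B x v)" for u v
  proof -
    have "((\<lambda>y. curl B y (X y) v) has_derivative
        (\<lambda>u. frechet_derivative (\<lambda>y. curl B y (X x) v) (at x) u + curl B x (DX x u) v)) (at x)"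
      using x by (intro has_derivative_eval[OF open_W, where B = "\<lambda>y w. curl B y w v"]
          curl_linear_left curl_differentiable X_differentiable)
    from frechet_derivative_eqI[OF this]
    have "frechet_derivative (\<lambda>y. curl B y (X x) v) (at x) u + curl B x (DX x u) v =
        frechet_derivative (\<lambda>y. curl B y (X y) v) (at x) u"
      by simp
    also have "\<dots> = frechet_derivative (\<lambda>y. frechet_derivative h (at y) v - a y * B y v) (at x) u"
      using frechet_derivative_cong_open[OF open_W x, of "\<lambda>y. curl B y (X y) v"
          "\<lambda>y. frechet_derivative h (at y) v - a y * B y v"] curl_X by simp
    also have "\<dots> = frechet_derivative (\<lambda>y. frechet_derivative h (at y) v) (at x) u -
        (a x * frechet_derivative (\<lambda>y. B y v) (at x) u + Da x u * B x v)"
      using frechet_derivative_eqI[OF has_derivative_diff[OF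
            has_frechet_derivative[OF smooth_on_differentiable[OF smooth_on_frechet_derivative[OF h_smooth] x]]
            has_derivative_mult[OF has_frechet_derivative[OF smooth_on_differentiable[OF a_smooth x]]
              has_frechet_derivative[OF B_differentiable[OF x]]]]]
      by simp
    finally show ?thesis .
  qed
  have sym: "frechet_derivative (\<lambda>y. frechet_derivative h (at y) v) (at x) u =
      frechet_derivative (\<lambda>y. frechet_derivative h (at y) u) (at x) v"
    by (rule second_derivative_symmetric[OF open_W h_smooth x])
  have "curl B x u (DX x v) = - curl B x (DX x v) u" by (simp add: curl_def)
  then show ?thesis
    using key[of v u] key[of u v] sym unfolding closed_curl[OF x, of u v "X x"] curl_def[of B x u v]
    by (simp add: algebra_simps)
qed

text \<open>The coordinate expression of \<open>\<alpha> \<and> (d\<alpha>)\<^sup>n\<close>.\<close>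

abbreviation top_form :: "nat \<Rightarrow> ('e, 'e) form" where
  "top_form n \<equiv> contact_top n (\<lambda>y v. B y (v 0)) (\<lambda>y v. curl B y (v 0) (v 1))"

text \<open>This is \<open>L\<^sub>X (\<alpha> \<and> (d\<alpha>)\<^sup>n) = -(n + 1) a \<alpha> \<and> (d\<alpha>)\<^sup>n\<close>. To first order in \<open>s\<close>, the forms \<open>\<alpha>\<close> and
  \<open>d\<alpha>\<close> carried along \<open>X\<close> for time \<open>s\<close> are \<open>e\<^bsup>-as\<^esup>\<alpha>\<close> and \<open>e\<^bsup>-as\<^esup>(d\<alpha> - s da \<and> \<alpha>)\<close>, and the multiple of
  \<open>\<alpha>\<close> drops out of the top form.\<close>

lemma top_form_derivative:
  assumes x: "x \<in> W"
  shows "((\<lambda>s. top_form n (x + s *\<^sub>R X x) (\<lambda>i. v i + s *\<^sub>R DX x (v i))) has_real_derivative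
    - (real n + 1) * a x * top_form n x v) (at 0)"
proof -
  define y where "y s = x + s *\<^sub>R X x" for s :: real
  define g where "g s w = w + s *\<^sub>R DX x w" for s :: real and w
  \<comment> \<open>These are forms over the base \<open>real\<close>: the parameter s takes the
    place of the point, so families in s fall under the same wedge operations.\<close>
  define \<eta>1 :: "(real, 'e) form" where "\<eta>1 s u = B (y s) (g s (u 0))" for s u
  define \<theta>1 :: "(real, 'e) form" where "\<theta>1 s u = curl B (y s) (g s (u 0)) (g s (u 1))" for s u
  define \<eta>0 :: "(real, 'e) form" where "\<eta>0 s u = B x (u 0)" for s u
  define \<theta>0 :: "(real, 'e) form" where "\<theta>0 s u = curl B x (u 0) (u 1)" for s u
  define \<gamma> where "\<gamma> u = Da x (u 0) * B x (u 1) - Da x (u 1) * B x (u 0)" for u :: "nat \<Rightarrow> 'e"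
  define \<theta>2 :: "(real, 'e) form" where "\<theta>2 s u = 1 * \<theta>0 s u + (- s) * \<gamma> u" for s u
  define e where "e s = exp (- a x * s)" for s
  have y0: "y 0 = x" and g0: "g 0 w = w" for w by (simp_all add: y_def g_def)
  \<comment> \<open>Linearity of B and of its curl is known on W only, so the expansions in s hold
    for s near 0.\<close>
  define N where "N = {s. y s \<in> W}"
  have N: "open N" "0 \<in> N"
  proof -
    have "open (y -` W)"
      unfolding y_def by (intro continuous_open_vimage continuous_intros open_W)
    then show "open N" by (simp add: N_def vimage_def)
  qed (simp add: N_def y0 x)
  have line: "((\<lambda>s. F (y s)) has_real_derivative frechet_derivative F (at x) (X x)) (at 0)"
    if "F differentiable (at x)" for F :: "'e \<Rightarrow> real"
    using has_real_derivative_line[of F x 0 "X x"] that by (simp add: y_def)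
  have e: "(e has_real_derivative - a x) (at 0)" "e 0 = 1"
    unfolding e_def by (auto intro!: derivative_eq_intros)
  have d\<eta>1: "((\<lambda>s. \<eta>1 s u) has_real_derivative - a x * B x (u 0)) (at 0)" for u
  proof (rule has_field_derivative_transform_within_open[OF _ N])
    have "((\<lambda>s. B (y s) (u 0) + s * B (y s) (DX x (u 0))) has_real_derivative
        frechet_derivative (\<lambda>z. B z (u 0)) (at x) (X x) + (1 * B (y 0) (DX x (u 0)) +
          frechet_derivative (\<lambda>z. B z (DX x (u 0))) (at x) (X x) * 0)) (at 0)"
      by (intro DERIV_add DERIV_mult line B_differentiable x DERIV_ident)
    then show "((\<lambda>s. B (y s) (u 0) + s * B (y s) (DX x (u 0))) has_real_derivative
        - a x * B x (u 0)) (at 0)"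
      using lie_covector[OF x] by (simp add: y0)
    show "B (y s) (u 0) + s * B (y s) (DX x (u 0)) = \<eta>1 s u" if "s \<in> N" for s
      using B_linear[of "y s"] that by (simp add: \<eta>1_def g_def N_def linear_add linear_scale)
  qed
  have d\<theta>1: "((\<lambda>s. \<theta>1 s u) has_real_derivative - a x * \<theta>0 0 u - \<gamma> u) (at 0)" for u
  proof (rule has_field_derivative_transform_within_open[OF _ N])
    let ?c = "\<lambda>s. curl B (y s)" and ?u = "u 0" and ?v = "u 1"
    \<comment> \<open>The part quadratic in s contributes nothing to the derivative at 0.\<close>
    have "((\<lambda>s. ?c s ?u ?v + s * (?c s (DX x ?u) ?v + ?c s ?u (DX x ?v) + s * ?c s (DX x ?u) (DX x ?v)))
      has_real_derivative frechet_derivative (\<lambda>y. curl B y ?u ?v) (at x) (X x) +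
        (1 * (?c 0 (DX x ?u) ?v + ?c 0 ?u (DX x ?v) + 0 * ?c 0 (DX x ?u) (DX x ?v)) +
         (frechet_derivative (\<lambda>y. curl B y (DX x ?u) ?v) (at x) (X x) +
          frechet_derivative (\<lambda>y. curl B y ?u (DX x ?v)) (at x) (X x) +
          (1 * ?c 0 (DX x ?u) (DX x ?v) +
           frechet_derivative (\<lambda>y. curl B y (DX x ?u) (DX x ?v)) (at x) (X x) * 0)) * 0)) (at 0)"
      by (intro DERIV_add DERIV_mult line curl_differentiable x DERIV_ident)
    then show "((\<lambda>s. ?c s ?u ?v + s * (?c s (DX x ?u) ?v + ?c s ?u (DX x ?v) + s * ?c s (DX x ?u) (DX x ?v)))
        has_real_derivative - a x * \<theta>0 0 u - \<gamma> u) (at 0)"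
      by (rule DERIV_cong) (use lie_curl[OF x, of ?u ?v] in \<open>simp add: y0 \<theta>0_def \<gamma>_def\<close>)
    show "?c s ?u ?v + s * (?c s (DX x ?u) ?v + ?c s ?u (DX x ?v) + s * ?c s (DX x ?u) (DX x ?v)) = \<theta>1 s u"
      if "s \<in> N" for s
    proof -
      have ys: "y s \<in> W" using that by (simp add: N_def)
      show ?thesis
        by (simp add: \<theta>1_def g_def linear_add[OF curl_linear_left[OF ys]] linear_scale[OF curl_linear_left[OF ys]]
            linear_add[OF curl_linear_right[OF ys]] linear_scale[OF curl_linear_right[OF ys]] algebra_simps)
    qed
  qed
  \<comment> \<open>\<open>Q\<close> says that two curves, told apart by the flag, agree at 0 in
    value and first derivative. \<open>True\<close> marks the transported forms,
    \<open>False\<close> the model built from \<open>e\<close>, \<open>\<eta>0\<close> and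
    \<open>\<theta>2\<close>. Closure of \<open>Q\<close> under sums and products gives both top
    forms the same derivative \<open>D\<close>, which is then computed on the model.\<close>
  define Q :: "nat \<Rightarrow> (bool \<times> real \<Rightarrow> real) \<Rightarrow> bool" where
    "Q k f \<longleftrightarrow> f (True, 0) = f (False, 0) \<and>
      (\<exists>D. \<forall>b. ((\<lambda>s. f (b, s)) has_real_derivative D) (at 0))" for k f
  define \<eta> :: "bool \<times> real \<Rightarrow> (real, 'e) form" where "\<eta> = (\<lambda>(b, s). if b then \<eta>1 else (\<lambda>s u. e s * \<eta>0 s u))"
  define \<theta> :: "bool \<times> real \<Rightarrow> (real, 'e) form" where "\<theta> = (\<lambda>(b, s). if b then \<theta>1 else (\<lambda>s u. e s * \<theta>2 s u))"
  have "Q (n + 1) (\<lambda>z. contact_top n (\<eta> z) (\<theta> z) (snd z) v)"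
  proof (rule contact_top_closed[where Q = Q and p = snd])
    show "Q k (\<lambda>z. f z + g z)" if fg: "Q k f" "Q k g" for k f g
    proof -
      obtain D E where D: "\<And>b. ((\<lambda>s. f (b, s)) has_real_derivative D) (at 0)"
        and E: "\<And>b. ((\<lambda>s. g (b, s)) has_real_derivative E) (at 0)"
        using fg unfolding Q_def by auto
      show ?thesis
        using fg DERIV_add[OF D E] unfolding Q_def by (intro conjI exI allI) auto
    qed
    show "Q (k + l) (\<lambda>z. f z * g z)" if fg: "Q k f" "Q l g" for k l f g
    proof -
      obtain D E where D: "\<And>b. ((\<lambda>s. f (b, s)) has_real_derivative D) (at 0)"
        and E: "\<And>b. ((\<lambda>s. g (b, s)) has_real_derivative E) (at 0)"
        using fg unfolding Q_def by auto
      have "((\<lambda>s. f (b, s) * g (b, s)) has_real_derivative D * g (True, 0) + E * f (True, 0)) (at 0)" for b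
      proof -
        have "f (b, 0) = f (True, 0)" "g (b, 0) = g (True, 0)"
          using fg by (cases b; simp add: Q_def)+
        with DERIV_mult[OF D[of b] E[of b]] show ?thesis by simp
      qed
      with fg show ?thesis unfolding Q_def by auto
    qed
    show "Q 1 (\<lambda>z. \<eta> z (snd z) u)" for u
    proof -
      have "((\<lambda>s. e s * B x (u 0)) has_real_derivative - a x * B x (u 0)) (at 0)"
        using DERIV_cmult_right[OF e(1), of "B x (u 0)"] .
      then show ?thesis
        using d\<eta>1[of u] e(2) unfolding Q_def
        by (auto simp: \<eta>_def \<eta>0_def \<eta>1_def g0 y0 split: bool.splits)
    qed
    show "Q 1 (\<lambda>z. \<theta> z (snd z) u)" for u
    proof -
      have "((\<lambda>s. e s * (1 * \<theta>0 0 u + (- s) * \<gamma> u)) has_real_derivative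
          - a x * (1 * \<theta>0 0 u + (- 0) * \<gamma> u) + (0 + (- 1) * \<gamma> u) * e 0) (at 0)"
        by (intro DERIV_mult e DERIV_add DERIV_const DERIV_cmult_right DERIV_minus DERIV_ident)
      then have "((\<lambda>s. e s * \<theta>2 s u) has_real_derivative - a x * \<theta>0 0 u - \<gamma> u) (at 0)"
        by (simp add: \<theta>2_def \<theta>0_def e(2))
      then show ?thesis
        using d\<theta>1[of u] e(2) unfolding Q_def
        by (auto simp: \<theta>_def \<theta>0_def \<theta>1_def \<theta>2_def g0 y0 split: bool.splits)
    qed
  qed (auto simp: Q_def intro!: exI DERIV_const)
  then obtain D where D1: "((\<lambda>s. contact_top n \<eta>1 \<theta>1 s v) has_real_derivative D) (at 0)"
    and D2: "((\<lambda>s. contact_top n (\<lambda>s u. e s * \<eta>0 s u) (\<lambda>s u. e s * \<theta>2 s u) s v) has_real_derivative D) (at 0)"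
    unfolding Q_def by (auto simp: \<eta>_def \<theta>_def all_bool_eq)
  have \<eta>0: "alternating_form 1 (\<eta>0 s)" for s
    unfolding \<eta>0_def[abs_def] by (intro alternating_form_1 B_linear x)
  have \<theta>0: "alternating_form 2 (\<theta>0 s)" for s
    unfolding \<theta>0_def[abs_def] by (rule alternating_form_curl[OF x])
  have \<gamma>: "alternating_form 2 \<gamma>"
  proof -
    have B: "linear (B x)" by (rule B_linear[OF x])
    have A: "linear (Da x)" by (rule linear_frechet_derivative[OF smooth_on_differentiable[OF a_smooth x]])
    show ?thesis
      unfolding \<gamma>_def[abs_def]
      by (rule alternating_form_2[where B = "\<lambda>p q. Da x p * B x q - Da x q * B x p"]; (rule linearI)?)
        (simp_all add: linear_add[OF A] linear_add[OF B] linear_scale[OF A] linear_scale[OF B] algebra_simps)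
  qed
  \<comment> \<open>The two 2-forms differ by a multiple of da \<and> B, which vanishes as soon as B
    kills both arguments.\<close>
  have "contact_top n \<eta>0 \<theta>2 s v = contact_top n \<eta>0 \<theta>0 s v" for s
  proof (rule contact_top_cong_kernel[OF \<eta>0 _ \<theta>0])
    show "alternating_form 2 (\<theta>2 s)"
      unfolding \<theta>2_def[abs_def] by (rule alternating_form_combination[OF \<theta>0 \<gamma>])
    show "\<theta>2 s u = \<theta>0 s u" if "\<And>i. \<eta>0 s (\<lambda>_. u i) = 0" for u
      using that[of 0] that[of 1] by (simp add: \<theta>2_def \<eta>0_def \<gamma>_def)
  qed
  also have "contact_top n \<eta>0 \<theta>0 s v = top_form n x v" for s
    by (rule fun_cong[OF contact_top_cong]) (auto simp: \<eta>0_def \<theta>0_def)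
  finally have "((\<lambda>s. e s ^ (n + 1) * top_form n x v) has_real_derivative D) (at 0)"
    using D2 by (simp add: contact_top_scale)
  moreover have "((\<lambda>s. e s ^ (n + 1) * top_form n x v) has_real_derivative
      - (real n + 1) * a x * top_form n x v) (at 0)"
    using DERIV_cmult_right[OF DERIV_power[OF e(1), of "n + 1"], of "top_form n x v"] e(2)
    by (simp add: algebra_simps)
  ultimately have "D = - (real n + 1) * a x * top_form n x v"
    by (rule DERIV_unique)
  moreover have "contact_top n \<eta>1 \<theta>1 s v = top_form n (y s) (\<lambda>i. g s (v i))" for s
  proof -
    have "contact_top n \<eta>1 \<theta>1 s v = contact_top n (\<lambda>s u. B (y s) (u 0))
        (\<lambda>s u. curl B (y s) (u 0) (u 1)) s (\<lambda>i. g s (v i))"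
      unfolding \<eta>1_def[abs_def] \<theta>1_def[abs_def]
      by (rule contact_top_comp[where g = g and \<eta> = "\<lambda>s u. B (y s) (u 0)"
            and \<theta> = "\<lambda>s u. curl B (y s) (u 0) (u 1)"])
    also have "\<dots> = top_form n (y s) (\<lambda>i. g s (v i))"
      by (rule fun_cong[OF contact_top_cong]) auto
    finally show ?thesis .
  qed
  ultimately show ?thesis
    using D1 by (simp add: y_def g_def)
qed

end

text \<open>Taking L_X of \<mu>' = f \<mu> gives X(f) \<mu> plus terms that cancel, because the
  factor -(n + 1) a is common to both forms; h and h' may differ.\<close>

lemma conformal_ratio_conserved:
  assumes "conformal_covector W B X h a" "conformal_covector W B' X h' a" and x: "x \<in> W"
    and f: "f differentiable (at x)"
    and eq: "\<And>y v. y \<in> W \<Longrightarrow>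
      contact_top n (\<lambda>y v. B' y (v 0)) (\<lambda>y v. curl B' y (v 0) (v 1)) y v =
      f y * contact_top n (\<lambda>y v. B y (v 0)) (\<lambda>y v. curl B y (v 0) (v 1)) y v"
    and ne: "contact_top n (\<lambda>y v. B y (v 0)) (\<lambda>y v. curl B y (v 0) (v 1)) x v \<noteq> 0"
  shows "frechet_derivative f (at x) (X x) = 0"
proof -
  interpret b: conformal_covector W B X h a by fact
  interpret b': conformal_covector W B' X h' a by fact
  define y where "y s = x + s *\<^sub>R X x" for s :: real
  define w where "w s i = v i + s *\<^sub>R frechet_derivative X (at x) (v i)" for s :: real and i
  have y0: "y 0 = x" "w 0 = v" by (simp_all add: y_def w_def fun_eq_iff)
  have f': "((\<lambda>s. f (y s)) has_real_derivative frechet_derivative f (at x) (X x)) (at 0)"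
    using has_real_derivative_line[of f x 0 "X x"] f by (simp add: y_def)
  have "((\<lambda>s. f (y s) * b.top_form n (y s) (w s)) has_real_derivative
      frechet_derivative f (at x) (X x) * b.top_form n (y 0) (w 0) +
        (- (real n + 1) * a x * b.top_form n x v) * f (y 0)) (at 0)"
    using DERIV_mult[OF f' b.top_form_derivative[OF x, of n v, folded y_def w_def]] .
  moreover have "((\<lambda>s. f (y s) * b.top_form n (y s) (w s)) has_real_derivative
      - (real n + 1) * a x * b'.top_form n x v) (at 0)"
  proof (rule has_field_derivative_transform_within_open)
    show "((\<lambda>s. b'.top_form n (y s) (w s)) has_real_derivative
        - (real n + 1) * a x * b'.top_form n x v) (at 0)"
      by (rule b'.top_form_derivative[OF x, of n v, folded y_def w_def])
    show "open (y -` W)"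
      unfolding y_def by (intro continuous_open_vimage continuous_intros b.open_W)
  qed (use x y0 eq in auto)
  ultimately have "frechet_derivative f (at x) (X x) * b.top_form n x v +
      (- (real n + 1) * a x * b.top_form n x v) * f x = - (real n + 1) * a x * b'.top_form n x v"
    unfolding y0 by (rule DERIV_unique)
  then show ?thesis
    using ne eq[OF x, of v] by simp
qed

text \<open>Replacing \<open>p(t)\<close> by \<open>p(2t) - 2\<^sup>N p(t)\<close> removes the coefficient of degree \<open>N\<close>.\<close>

lemma polynomial_coefficients_closed:
  fixes Q :: "('x \<Rightarrow> real) \<Rightarrow> bool"
  assumes add: "\<And>f g. Q f \<Longrightarrow> Q g \<Longrightarrow> Q (\<lambda>x. f x + g x)"
    and scale: "\<And>k f. Q f \<Longrightarrow> Q (\<lambda>x. k * f x)"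
  shows "(\<And>t. Q (\<lambda>x. \<Sum>j=1..N. C j x * t ^ j)) \<Longrightarrow> j \<in> {1..N} \<Longrightarrow> Q (C j)"
proof (induction N arbitrary: C j)
  case 0
  then show ?case by simp
next
  case (Suc N)
  let ?p = "\<lambda>t x. \<Sum>j=1..Suc N. C j x * t ^ j"
  have lower: "Q (C i)" if i: "i \<in> {1..N}" for i
  proof -
    have "Q (\<lambda>x. \<Sum>j=1..N. ((2 ^ j - 2 ^ Suc N) * C j x) * t ^ j)" for t
    proof -
      have "Q (\<lambda>x. ?p (2 * t) x + (- (2 ^ Suc N)) * ?p t x)"
        by (intro add scale Suc.prems(1))
      also have "(\<lambda>x. ?p (2 * t) x + (- (2 ^ Suc N)) * ?p t x) =
          (\<lambda>x. \<Sum>j=1..N. ((2 ^ j - 2 ^ Suc N) * C j x) * t ^ j)"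
        by (simp add: fun_eq_iff sum_distrib_left power_mult_distrib algebra_simps sum.distrib
            sum_negf sum_subtractf)
      finally show ?thesis .
    qed
    from Suc.IH[OF this i] have "Q (\<lambda>x. (2 ^ i - 2 ^ Suc N) * C i x)" .
    from scale[OF this, of "1 / (2 ^ i - 2 ^ Suc N)"] have
      "Q (\<lambda>x. 1 / (2 ^ i - 2 ^ Suc N) * ((2 ^ i - 2 ^ Suc N) * C i x))" .
    moreover have "(2::real) ^ i \<noteq> 2 ^ Suc N"
      using i power_inject_exp[of "2::real" i "Suc N"] by auto
    ultimately show ?thesis by simp
  qed
  have zero: "Q (\<lambda>x. 0)"
    using scale[OF Suc.prems(1)[of 0], of 0] by simp
  have sum: "Q (\<lambda>x. \<Sum>j\<in>J. C j x)" if "J \<subseteq> {1..N}" for J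
    using finite_subset[OF that finite_atLeastAtMost] that
    by (induction J rule: finite_induct) (auto intro!: add zero lower)
  show ?case
  proof (cases "j = Suc N")
    case True
    \<comment> \<open>The top coefficient is the value at t = 1 minus all lower
      coefficients.\<close>
    have "Q (\<lambda>x. ?p 1 x + (-1) * (\<Sum>j=1..N. C j x))"
      by (intro add scale Suc.prems(1) sum) simp
    with True show ?thesis by simp
  next
    case False
    with Suc.prems(2) lower show ?thesis by simp
  qed
qed

section \<open>Conserved quantities of a pencil of one-forms\<close>

context manifold
begin

section \<open>Exterior derivative, top form and Lie derivative on the manifold\<close>

lemma smooth_covector_chart:
  assumes "open U" "smooth_form A 1 U \<alpha>" "c \<in> A"
  shows "smooth_covector (cmap c ` (cdom c \<inter> U)) (covector A c \<alpha>)"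
  by (rule smooth_covector.intro)
    (intro open_chart_image covector_linear[OF assms(2,3)] covector_smooth[OF assms(2,3)] assms | assumption)+

lemma ext_deriv_chart_at:
  assumes "open U" "smooth_form A 1 U \<alpha>" "p \<in> U"
  shows "ext_deriv A 1 \<alpha> p v = curl (covector A (chart_at A p) \<alpha>) (cmap (chart_at A p) p) (v 0) (v 1)"
  using local_form_ext_deriv[OF assms(1,2) chart_at(1), of "cmap (chart_at A p) p" p v]
    chart_at assms(3) local_form_chart_at[of p] by auto

lemma alternating_form_ext_deriv:
  assumes "open U" "smooth_form A 1 U \<alpha>" "p \<in> U"
  shows "alternating_form 2 (ext_deriv A 1 \<alpha> p)"
  unfolding ext_deriv_chart_at[OF assms, abs_def]
  using smooth_covector.alternating_form_curl[OF smooth_covector_chart[OF assms(1,2) chart_at(1)]]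
    chart_at assms(3) by blast

lemma smooth_form_pencil:
  assumes "open U" "smooth_form A 1 U \<alpha>" "smooth_form A 1 U \<beta>"
  shows "smooth_form A 1 U (\<lambda>q u. \<alpha> q u + t * \<beta> q u)"
  unfolding smooth_form_def
proof (intro conjI ballI allI)
  show "alternating_form 1 (\<lambda>u. \<alpha> p u + t * \<beta> p u)" if "p \<in> U" for p
    using alternating_form_combination[OF smooth_form_alternating[OF assms(2) that]
        smooth_form_alternating[OF assms(3) that], of 1 t] by simp
  fix c and v :: "nat \<Rightarrow> 'e" assume c: "c \<in> A"
  have "smooth_on (cmap c ` (cdom c \<inter> U)) (\<lambda>y. local_form A c \<alpha> y v + t * local_form A c \<beta> y v)"
    by (intro smooth_on_add smooth_on_mult smooth_on_const open_chart_image assms(1) c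
        smooth_form_local_form[OF assms(2) c] smooth_form_local_form[OF assms(3) c])
  then show "smooth_on (cmap c ` (cdom c \<inter> U)) (\<lambda>y. local_form A c (\<lambda>q u. \<alpha> q u + t * \<beta> q u) y v)"
    by (simp add: local_form_def)
qed

lemma ext_deriv_pencil:
  assumes "open U" "smooth_form A 1 U \<alpha>" "smooth_form A 1 U \<beta>" "p \<in> U"
  shows "ext_deriv A 1 (\<lambda>q u. \<alpha> q u + t * \<beta> q u) p v = ext_deriv A 1 \<alpha> p v + t * ext_deriv A 1 \<beta> p v"
proof -
  let ?c = "chart_at A p"
  have y: "cmap ?c p \<in> cmap ?c ` (cdom ?c \<inter> U)" using chart_at assms(4) by blast
  note d = smooth_covector.B_differentiable[OF smooth_covector_chart[OF assms(1) _ chart_at(1)] y]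
  have sum: "covector A ?c (\<lambda>q u. \<alpha> q u + t * \<beta> q u) = (\<lambda>y u. covector A ?c \<alpha> y u + t * covector A ?c \<beta> y u)"
    by (simp add: covector_def local_form_def fun_eq_iff)
  have "frechet_derivative (\<lambda>z. covector A ?c \<alpha> z u + t * covector A ?c \<beta> z u) (at (cmap ?c p)) w =
      frechet_derivative (\<lambda>z. covector A ?c \<alpha> z u) (at (cmap ?c p)) w +
      t * frechet_derivative (\<lambda>z. covector A ?c \<beta> z u) (at (cmap ?c p)) w" for u w
    using frechet_derivative_eqI[OF has_derivative_add[OF has_frechet_derivative[OF d[OF assms(2)]]
          has_derivative_mult_right[OF has_frechet_derivative[OF d[OF assms(3)]]]]] by simp
  then show ?thesis
    unfolding ext_deriv_chart_at[OF assms(1) smooth_form_pencil[OF assms(1-3)] assms(4)]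
      ext_deriv_chart_at[OF assms(1) assms(2) assms(4)] ext_deriv_chart_at[OF assms(1) assms(3) assms(4)] sum
    by (simp add: curl_def algebra_simps)
qed

text \<open>The wedge commutes with the change of tangent coordinates. In a chart the top form is
  therefore the one treated in \<open>conformal_covector\<close>, so the Euclidean results
  apply.\<close>

lemma local_form_contact_top:
  assumes "open U" "smooth_form A 1 U \<alpha>" "c \<in> A" "y \<in> cmap c ` (cdom c \<inter> U)"
  shows "local_form A c (contact_top n \<alpha> (ext_deriv A 1 \<alpha>)) y v =
    contact_top n (\<lambda>y v. covector A c \<alpha> y (v 0)) (\<lambda>y v. curl (covector A c \<alpha>) y (v 0) (v 1)) y v"
proof -
  define g where "g = from_chart A c (cinv c y)"
  have "local_form A c (contact_top n \<alpha> (ext_deriv A 1 \<alpha>)) y v =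
      contact_top n \<alpha> (ext_deriv A 1 \<alpha>) (cinv c y) (\<lambda>i. g (v i))"
    by (simp add: local_form_def g_def)
  also have "\<dots> = contact_top n (\<lambda>q u. \<alpha> q (\<lambda>i. g (u i))) (\<lambda>q u. ext_deriv A 1 \<alpha> q (\<lambda>i. g (u i))) (cinv c y) v"
    by (rule contact_top_comp[where g = "\<lambda>_. g", symmetric])
  also have "\<dots> = contact_top n (\<lambda>y v. covector A c \<alpha> y (v 0)) (\<lambda>y v. curl (covector A c \<alpha>) y (v 0) (v 1)) y v"
  proof (rule fun_cong[OF contact_top_cong]; rule ext)
    show "\<alpha> (cinv c y) (\<lambda>i. g (u i)) = covector A c \<alpha> y (u 0)" for u
      unfolding local_form_covector[OF assms(2-4), symmetric] by (simp add: local_form_def g_def)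
    show "ext_deriv A 1 \<alpha> (cinv c y) (\<lambda>i. g (u i)) = curl (covector A c \<alpha>) y (u 0) (u 1)" for u
      unfolding local_form_ext_deriv[OF assms, symmetric] by (simp add: local_form_def g_def)
  qed
  finally show ?thesis .
qed

lemma smooth_contact_top:
  assumes "open U" "smooth_form A 1 U \<alpha>" "c \<in> A"
  shows "smooth_on (cmap c ` (cdom c \<inter> U)) (\<lambda>y. local_form A c (contact_top n \<alpha> (ext_deriv A 1 \<alpha>)) y v)"
proof -
  let ?W = "cmap c ` (cdom c \<inter> U)"
  interpret smooth_covector ?W "covector A c \<alpha>" by (rule smooth_covector_chart[OF assms])
  have "smooth_on ?W (\<lambda>y. contact_top n (\<lambda>y v. covector A c \<alpha> y (v 0))
      (\<lambda>y v. curl (covector A c \<alpha>) y (v 0) (v 1)) y v)"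
    by (rule contact_top_closed[where Q = "\<lambda>_. smooth_on ?W" and p = "\<lambda>y. y"])
      (intro smooth_on_const smooth_on_add smooth_on_mult open_W B_smooth curl_smooth | assumption)+
  then show ?thesis
    by (rule smooth_on_cong[OF open_W, rotated]) (simp add: local_form_contact_top[OF assms] del: One_nat_def)
qed

lemma alternating_form_contact_top_ext_deriv:
  assumes "open U" "smooth_form A 1 U \<alpha>" "p \<in> U"
  shows "alternating_form (2 * n + 1) (contact_top n \<alpha> (ext_deriv A 1 \<alpha>) p)"
  by (intro alternating_form_contact_top smooth_form_alternating[OF assms(2,3)]
      alternating_form_ext_deriv[OF assms])

text \<open>The product rule splits the derivative of \<alpha>(X) along v: one part is the DX term
  of the Lie derivative, the other cancels the second half of the curl. It is used in both
  directions, to get X(K) from L_X \<zeta> and d\<beta>(X, v) from L_X \<beta>.\<close>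

lemma cartan_formula:
  assumes U: "open U" and \<alpha>: "smooth_form A 1 U \<alpha>" and X: "smooth_field A X" and p: "p \<in> U"
  shows "lie_deriv A 1 X \<alpha> p v =
    ext_deriv A 1 \<alpha> p (case_nat (X p) v) + ext_deriv A 0 (fun_form (\<lambda>q. \<alpha> q (\<lambda>_. X q))) p v"
proof -
  define c where "c = chart_at A p"
  have c: "c \<in> A" "p \<in> cdom c" by (simp_all add: c_def chart_at)
  define W where "W = cmap c ` (cdom c \<inter> U)"
  define y where "y = cmap c p"
  define B where "B = covector A c \<alpha>"
  define Y where "Y = local_field A c X"
  interpret smooth_covector W B
    unfolding W_def B_def by (rule smooth_covector_chart[OF U \<alpha> c(1)])
  have y: "y \<in> W" using c p by (auto simp: W_def y_def)
  have Y: "smooth_on W Y"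
    using X c(1) by (auto simp: smooth_field_def W_def Y_def intro: smooth_on_subset)
  have Yy: "Y y = X p"
    using c by (simp add: Y_def y_def local_field_cmap) (simp add: c_def to_chart_at)
  have \<alpha>p: "\<alpha> p w = B y (w 0)" for w
    using local_form_covector[OF \<alpha> c(1), of y w] y local_form_chart_at[of p \<alpha> w]
    by (simp add: W_def B_def y_def c_def)
  have "((\<lambda>z. B z (Y z)) has_derivative
      (\<lambda>v. frechet_derivative (\<lambda>z. B z (Y y)) (at y) v + B y (frechet_derivative Y (at y) v))) (at y)"
    by (intro has_derivative_eval[OF open_W y] B_linear B_differentiable y smooth_on_differentiable[OF Y])
  from frechet_derivative_eqI[OF this]
  have 1: "frechet_derivative (\<lambda>z. B z (Y z)) (at y) (v 0) =
      frechet_derivative (\<lambda>z. B z (X p)) (at y) (v 0) + B y (frechet_derivative Y (at y) (v 0))"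
    by (simp add: Yy)
  have "frechet_derivative (\<lambda>z. \<alpha> (cinv c z) (\<lambda>_. X (cinv c z))) (at y) =
      frechet_derivative (\<lambda>z. B z (Y z)) (at y)"
    using c covector_local_field[OF c(1), of _ \<alpha> X]
    by (intro frechet_derivative_cong_open[OF open_W y]) (auto simp: W_def B_def Y_def cinv_cmap)
  then have 2: "ext_deriv A 0 (fun_form (\<lambda>q. \<alpha> q (\<lambda>_. X q))) p v = frechet_derivative (\<lambda>z. B z (Y z)) (at y) (v 0)"
    by (simp add: ext_deriv_def Let_def local_form_def fun_form_def c_def y_def)
  have 3: "ext_deriv A 1 \<alpha> p (case_nat (X p) v) =
      frechet_derivative (\<lambda>z. B z (v 0)) (at y) (X p) - frechet_derivative (\<lambda>z. B z (X p)) (at y) (v 0)"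
    unfolding ext_deriv_chart_at[OF U \<alpha> p] by (simp add: curl_def B_def c_def y_def)
  have "frechet_derivative (\<lambda>z. local_form A c \<alpha> z v) (at y) = frechet_derivative (\<lambda>z. B z (v 0)) (at y)"
    unfolding B_def W_def
    by (rule frechet_derivative_cong_open[OF open_W y]) (simp add: local_form_covector[OF \<alpha> c(1)] W_def)
  then have 4: "lie_deriv A 1 X \<alpha> p v =
      frechet_derivative (\<lambda>z. B z (v 0)) (at y) (X p) + B y (frechet_derivative Y (at y) (v 0))"
    by (simp add: lie_deriv_def Let_def \<alpha>p flip: c_def y_def Y_def)
  show ?thesis unfolding 1 2 3 4 by simp
qed

lemma lie_deriv_scale:
  assumes U: "open U" and f: "smooth_fun A U f" and \<alpha>: "smooth_form A 1 U \<alpha>" and p: "p \<in> U"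
  shows "lie_deriv A 1 X (\<lambda>q v. f q * \<alpha> q v) p v =
    field_apply A X f p * \<alpha> p v + f p * lie_deriv A 1 X \<alpha> p v"
proof -
  define c where "c = chart_at A p"
  have c: "c \<in> A" "p \<in> cdom c" by (simp_all add: c_def chart_at)
  have y: "cmap c p \<in> cmap c ` (cdom c \<inter> U)" using c p by blast
  have "smooth_on (cmap c ` (cdom c \<inter> U)) (\<lambda>y. f (cinv c y))"
    using f c(1) by (simp add: smooth_fun_def o_def)
  note d = smooth_on_differentiable[OF this y]
    smooth_on_differentiable[OF smooth_form_local_form[OF \<alpha> c(1)] y, of v]
  have eq: "local_form A c \<alpha> (cmap c p) v = \<alpha> p v" for v
    by (simp add: c_def local_form_chart_at)
  have "frechet_derivative (\<lambda>y. local_form A c (\<lambda>q v. f q * \<alpha> q v) y v) (at (cmap c p)) (X p) =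
      frechet_derivative (\<lambda>y. f (cinv c y) * local_form A c \<alpha> y v) (at (cmap c p)) (X p)"
    by (simp add: local_form_def)
  also have "\<dots> = f p * frechet_derivative (\<lambda>y. local_form A c \<alpha> y v) (at (cmap c p)) (X p) +
      field_apply A X f p * \<alpha> p v"
    unfolding frechet_derivative_mult[OF d] using c
    by (simp add: eq cinv_cmap field_apply_def o_def flip: c_def)
  finally show ?thesis
    by (simp add: lie_deriv_def Let_def algebra_simps flip: c_def)
qed

lemma field_apply_divide:
  assumes U: "open U" and f: "smooth_fun A U f" and g: "smooth_fun A U g" and p: "p \<in> U" and "g p \<noteq> 0"
  shows "field_apply A X (\<lambda>q. f q / g q) p =
    (field_apply A X f p * g p - f p * field_apply A X g p) / (g p * g p)"
proof -
  define c where "c = chart_at A p"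
  have c: "c \<in> A" "p \<in> cdom c" by (simp_all add: c_def chart_at)
  have y: "cmap c p \<in> cmap c ` (cdom c \<inter> U)" using c p by blast
  have s: "smooth_on (cmap c ` (cdom c \<inter> U)) (\<lambda>y. f (cinv c y))"
    "smooth_on (cmap c ` (cdom c \<inter> U)) (\<lambda>y. g (cinv c y))"
    using f g c(1) by (simp_all add: smooth_fun_def o_def)
  have "((\<lambda>y. f (cinv c y) / g (cinv c y)) has_derivative
      (\<lambda>v. (frechet_derivative (\<lambda>y. f (cinv c y)) (at (cmap c p)) v * g (cinv c (cmap c p)) -
        f (cinv c (cmap c p)) * frechet_derivative (\<lambda>y. g (cinv c y)) (at (cmap c p)) v) /
        (g (cinv c (cmap c p)) * g (cinv c (cmap c p))))) (at (cmap c p))"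
    using assms(5) c
    by (intro has_derivative_divide' has_frechet_derivative smooth_on_differentiable[OF s(1) y]
        smooth_on_differentiable[OF s(2) y]) (simp add: cinv_cmap)
  from frechet_derivative_eqI[OF this] show ?thesis
    using c by (simp add: field_apply_def o_def cinv_cmap flip: c_def)
qed

lemma ext_deriv_fun_cong:
  assumes "open U" "p \<in> U" "\<And>q. q \<in> U \<Longrightarrow> f q = g q"
  shows "ext_deriv A 0 (fun_form f) p v = ext_deriv A 0 (fun_form g) p v"
proof -
  let ?c = "chart_at A p"
  have "frechet_derivative (f \<circ> cinv ?c) (at (cmap ?c p)) = frechet_derivative (g \<circ> cinv ?c) (at (cmap ?c p))"
    using assms chart_at
    by (intro frechet_derivative_cong_open[OF open_chart_image[OF chart_at(1) assms(1)]])
      (auto simp: cinv_cmap)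
  then show ?thesis
    by (simp add: ext_deriv_def Let_def local_form_def fun_form_def o_def)
qed

lemma ext_deriv_fun_cmult:
  assumes "open U" "smooth_fun A U f" "p \<in> U"
  shows "ext_deriv A 0 (fun_form (\<lambda>q. k * f q)) p v = k * ext_deriv A 0 (fun_form f) p v"
proof -
  let ?c = "chart_at A p"
  have "smooth_on (cmap ?c ` (cdom ?c \<inter> U)) (\<lambda>y. f (cinv ?c y))"
    using assms(2) chart_at(1)[of p] by (simp add: smooth_fun_def o_def)
  then have "(\<lambda>y. f (cinv ?c y)) differentiable (at (cmap ?c p))"
    by (rule smooth_on_differentiable) (use assms(3) chart_at in blast)
  then show ?thesis
    by (simp add: ext_deriv_def Let_def local_form_def fun_form_def frechet_derivative_cmult)
qed

lemma smooth_fun_cmult: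
  assumes "open U" "smooth_fun A U f"
  shows "smooth_fun A U (\<lambda>p. k * f p)"
  unfolding smooth_fun_def
proof
  fix c assume c: "c \<in> A"
  have "smooth_on (cmap c ` (cdom c \<inter> U)) (\<lambda>y. k * (f \<circ> cinv c) y)"
    using assms c by (intro smooth_on_mult smooth_on_const open_chart_image) (auto simp: smooth_fun_def o_def)
  then show "smooth_on (cmap c ` (cdom c \<inter> U)) ((\<lambda>p. k * f p) \<circ> cinv c)"
    by (simp add: o_def)
qed

text \<open>Turns pointwise equations between forms on U into identities of functions on an open set
  of \<open>'e\<close>, which can then be differentiated.\<close>

lemma conformal_covector_chart:
  assumes U: "open U" and \<alpha>: "smooth_form A 1 U \<alpha>" and X: "smooth_field A X"
    and h: "smooth_fun A U h" and a: "smooth_fun A U a" and c: "c \<in> A"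
    and \<alpha>X: "\<And>q. q \<in> U \<Longrightarrow> \<alpha> q (\<lambda>_. X q) = - h q"
    and d\<alpha>X: "\<And>q v. q \<in> U \<Longrightarrow>
      ext_deriv A 1 \<alpha> q (case_nat (X q) v) = ext_deriv A 0 (fun_form h) q v - a q * \<alpha> q v"
  shows "conformal_covector (cmap c ` (cdom c \<inter> U)) (covector A c \<alpha>) (local_field A c X)
    (h \<circ> cinv c) (a \<circ> cinv c)"
proof -
  let ?W = "cmap c ` (cdom c \<inter> U)"
  interpret smooth_covector ?W "covector A c \<alpha>" by (rule smooth_covector_chart[OF U \<alpha> c])
  show ?thesis
  proof unfold_locales
    show "smooth_on ?W (local_field A c X)"
      using X c by (auto simp: smooth_field_def intro: smooth_on_subset)
    show "smooth_on ?W (h \<circ> cinv c)" "smooth_on ?W (a \<circ> cinv c)"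
      using h a c by (simp_all add: smooth_fun_def)
    fix y assume y: "y \<in> ?W"
    then obtain p where p: "p \<in> cdom c" "p \<in> U" "y = cmap c p" by blast
    show "covector A c \<alpha> y (local_field A c X y) = - (h \<circ> cinv c) y"
      using p \<alpha>X by (simp add: covector_local_field c cinv_cmap)
    show "curl (covector A c \<alpha>) y (local_field A c X y) u =
        frechet_derivative (h \<circ> cinv c) (at y) u - (a \<circ> cinv c) y * covector A c \<alpha> y u" for u
    proof -
      \<comment> \<open>The tangent vector at p whose coordinates in c are u.\<close>
      let ?v = "\<lambda>_::nat. from_chart A c p u"
      have v: "(\<lambda>i. to_chart A c p (case_nat (X p) ?v i)) = case_nat (local_field A c X y) (\<lambda>_. u)"
        using p c by (auto simp: fun_eq_iff local_field_cmap to_from_chart split: nat.splits)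
      have "curl (covector A c \<alpha>) y (local_field A c X y) u =
          local_form A c (ext_deriv A 1 \<alpha>) y (case_nat (local_field A c X y) (\<lambda>_. u))"
        using local_form_ext_deriv[OF U \<alpha> c y, of "case_nat (local_field A c X y) (\<lambda>_. u)"] by simp
      also have "\<dots> = ext_deriv A 1 \<alpha> p (case_nat (X p) ?v)"
        using local_form_to_chart[OF c p(1), of "ext_deriv A 1 \<alpha>" "case_nat (X p) ?v"]
        unfolding v p(3)[symmetric] .
      also have "\<dots> = ext_deriv A 0 (fun_form h) p ?v - a p * \<alpha> p ?v"
        by (rule d\<alpha>X[OF p(2)])
      also have "ext_deriv A 0 (fun_form h) p ?v = frechet_derivative (h \<circ> cinv c) (at y) u"
        using ext_deriv_fun[OF U h c p(1,2), of ?v] p c by (simp add: to_from_chart)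
      also have "\<alpha> p ?v = covector A c \<alpha> y u"
        using p c by (simp add: covector_def local_form_def cinv_cmap)
      finally show ?thesis using p c by (simp add: cinv_cmap o_def)
    qed
  qed
qed

end

text \<open>\<eta> and \<beta> satisfy the same two equations with the same H and a. The asymmetry
  lies in nondegeneracy: the top form of \<eta> is the denominator of the coefficients.\<close>

locale conformal_pencil = manifold A
  for A :: "('m::{t2_space, second_countable_topology}, 'e::euclidean_space) chart set" +
  fixes n :: nat and U :: "'m set" and \<eta> \<beta> :: "('m, 'e) form" and X :: "'m \<Rightarrow> 'e" and H a :: "'m \<Rightarrow> real"
  assumes dim: "DIM('e) = 2 * n + 1" and U: "open U"
    and \<eta>: "smooth_form A 1 U \<eta>" and \<beta>: "smooth_form A 1 U \<beta>"
    and X: "smooth_field A X" and H: "smooth_fun A U H" and a: "smooth_fun A U a"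
    and nondegenerate: "\<And>p. p \<in> U \<Longrightarrow> \<exists>v. contact_top n \<eta> (ext_deriv A 1 \<eta>) p v \<noteq> 0"
    and \<eta>X: "\<And>p. p \<in> U \<Longrightarrow> \<eta> p (\<lambda>_. X p) = - H p"
    and \<beta>X: "\<And>p. p \<in> U \<Longrightarrow> \<beta> p (\<lambda>_. X p) = - H p"
    and d\<eta>X: "\<And>p v. p \<in> U \<Longrightarrow>
      ext_deriv A 1 \<eta> p (case_nat (X p) v) = ext_deriv A 0 (fun_form H) p v - a p * \<eta> p v"
    and d\<beta>X: "\<And>p v. p \<in> U \<Longrightarrow>
      ext_deriv A 1 \<beta> p (case_nat (X p) v) = ext_deriv A 0 (fun_form H) p v - a p * \<beta> p v"
begin

abbreviation pencil :: "real \<Rightarrow> ('m, 'e) form" where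
  "pencil t \<equiv> \<lambda>q u. \<eta> q u + t * \<beta> q u"

abbreviation volume :: "('m, 'e) form \<Rightarrow> ('m, 'e) form" where
  "volume \<alpha> \<equiv> contact_top n \<alpha> (ext_deriv A 1 \<alpha>)"

lemma smooth_pencil: "smooth_form A 1 U (pencil t)"
  by (rule smooth_form_pencil[OF U \<eta> \<beta>])

text \<open>\<open>pencil_coeffs\<close> adds two exterior derivatives, while the transport result
  concerns the exterior derivative of a single form; linearity of d reconciles them on U.\<close>

lemma volume_pencil:
  assumes "p \<in> U"
  shows "contact_top n (pencil t) (\<lambda>q u. ext_deriv A 1 \<eta> q u + t * ext_deriv A 1 \<beta> q u) p v =
    volume (pencil t) p v"
  by (rule fun_cong[OF contact_top_cong]) (simp_all add: fun_eq_iff ext_deriv_pencil[OF U \<eta> \<beta> assms] del: One_nat_def)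

lemma pencil_coeffs_iff:
  "pencil_coeffs A n \<eta> \<beta> U C \<longleftrightarrow>
    (\<forall>p\<in>U. \<forall>t v. volume (pencil t) p v = (1 + (\<Sum>j=1..n+1. C j p * t ^ j)) * volume \<eta> p v)"
  unfolding pencil_coeffs_def by (simp add: volume_pencil del: One_nat_def)

text \<open>The coefficients are read off the polynomial in t obtained on one frame \<open>w\<close>
  with nonzero volume; proportionality of top forms extends the identity to all arguments.\<close>

lemma pencil_coeffs_exist: "\<exists>C. pencil_coeffs A n \<eta> \<beta> U C"
proof -
  define G where "G p C \<longleftrightarrow> (\<forall>t v. volume (pencil t) p v = (1 + (\<Sum>j=1..n+1. C j * t ^ j)) * volume \<eta> p v)"
    for p C
  have "\<exists>C. G p C" if p: "p \<in> U" for p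
  proof -
    obtain w where w: "volume \<eta> p w \<noteq> 0" using nondegenerate[OF p] by blast
    obtain P where P: "degree P \<le> n + 1" and
      "\<forall>t. contact_top n (pencil t) (\<lambda>q u. ext_deriv A 1 \<eta> q u + t * ext_deriv A 1 \<beta> q u) p w = poly P t"
      using contact_top_polynomial[of n \<eta> \<beta> "ext_deriv A 1 \<eta>" "ext_deriv A 1 \<beta>" p w] by (elim exE conjE)
    then have P': "volume (pencil t) p w = poly P t" for t
      by (simp add: volume_pencil[OF p] del: One_nat_def)
    have "poly P t = (\<Sum>j\<le>n+1. coeff P j * t ^ j)" for t
      unfolding poly_altdef using P
      by (intro sum.mono_neutral_left) (auto simp: coeff_eq_0)
    also have "(\<Sum>j\<le>n+1. coeff P j * t ^ j) = coeff P 0 + (\<Sum>j=1..n+1. coeff P j * t ^ j)" for t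
      by (simp only: atMost_atLeast0 sum.atLeast_Suc_atMost[OF le0] One_nat_def) simp
    finally have poly: "poly P t = coeff P 0 + (\<Sum>j=1..n+1. coeff P j * t ^ j)" for t .
    \<comment> \<open>At t = 0 the pencil is \<eta> itself; this produces the leading 1.\<close>
    have "coeff P 0 = volume \<eta> p w"
      using P'[of 0] poly[of 0] by (simp add: poly_0_coeff_0)
    with poly have "poly P t = (1 + (\<Sum>j=1..n+1. coeff P j / volume \<eta> p w * t ^ j)) * volume \<eta> p w" for t
      using w by (simp add: distrib_right sum_distrib_right)
    moreover have "volume (pencil t) p v * volume \<eta> p w = volume (pencil t) p w * volume \<eta> p v" for t v
      by (rule alternating_form_top_proportional; unfold dim)
        (intro alternating_form_contact_top_ext_deriv[OF U] smooth_pencil \<eta> p)+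
    ultimately have "volume (pencil t) p v = (1 + (\<Sum>j=1..n+1. coeff P j / volume \<eta> p w * t ^ j)) * volume \<eta> p v" for t v
      using w unfolding P' by (simp add: field_simps)
    then show ?thesis
      unfolding G_def by (intro exI[of _ "\<lambda>j. coeff P j / volume \<eta> p w"] allI)
  qed
  then obtain C where "\<forall>p\<in>U. G p (C p)"
    by metis
  then show ?thesis
    unfolding pencil_coeffs_iff G_def by (intro exI[of _ "\<lambda>j p. C p j"])
qed

lemma conformal_pencil_chart:
  assumes "c \<in> A"
  shows "conformal_covector (cmap c ` (cdom c \<inter> U)) (covector A c (pencil t)) (local_field A c X)
    ((\<lambda>p. (1 + t) * H p) \<circ> cinv c) (a \<circ> cinv c)"
proof (rule conformal_covector_chart[OF U smooth_pencil X smooth_fun_cmult[OF U H] a assms])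
  fix q v assume q: "q \<in> U"
  show "\<eta> q (\<lambda>_. X q) + t * \<beta> q (\<lambda>_. X q) = - ((1 + t) * H q)"
    using \<eta>X[OF q] \<beta>X[OF q] by (simp add: algebra_simps)
  show "ext_deriv A 1 (pencil t) q (case_nat (X q) v) =
      ext_deriv A 0 (fun_form (\<lambda>p. (1 + t) * H p)) q v - a q * (\<eta> q v + t * \<beta> q v)"
    unfolding ext_deriv_pencil[OF U \<eta> \<beta> q] d\<eta>X[OF q] d\<beta>X[OF q] ext_deriv_fun_cmult[OF U H q]
    by (simp add: algebra_simps)
qed

context
  fixes C assumes C: "pencil_coeffs A n \<eta> \<beta> U C"
begin

lemma volume_pencil_C:
  "p \<in> U \<Longrightarrow> volume (pencil t) p v = (1 + (\<Sum>j=1..n+1. C j p * t ^ j)) * volume \<eta> p v"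
  using C unfolding pencil_coeffs_iff by blast

text \<open>\<open>pencil_coeffs\<close> determines the values of \<open>C j\<close> only pointwise.
  Near each point, however, the polynomial in t is a quotient of smooth functions for every fixed t,
  and each coefficient is a linear combination of such values.\<close>

lemma smooth_coeffs:
  assumes "j \<in> {1..n+1}"
  shows "smooth_fun A U (C j)"
  unfolding smooth_fun_def
proof
  fix c assume c: "c \<in> A"
  let ?W = "cmap c ` (cdom c \<inter> U)"
  have W: "open ?W" by (rule open_chart_image[OF c U])
  show "smooth_on ?W (C j \<circ> cinv c)"
  proof (rule smooth_on_local)
    fix y assume "y \<in> ?W"
    then obtain p where p: "p \<in> cdom c" "p \<in> U" "y = cmap c p" by blast
    obtain v where v: "volume \<eta> p v \<noteq> 0" using nondegenerate[OF p(2)] by blast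
    \<comment> \<open>Constant coordinate vectors that restrict to \<open>v\<close> at p: on them
      numerator and denominator are smooth, and the denominator stays nonzero near y.\<close>
    define w where "w = (\<lambda>i. to_chart A c p (v i))"
    define m where "m t y = local_form A c (volume (pencil t)) y w" for t y
    define m0 where "m0 y = local_form A c (volume \<eta>) y w" for y
    have m: "smooth_on ?W (m t)" for t
      unfolding m_def by (rule smooth_contact_top[OF U smooth_pencil c])
    have m0: "smooth_on ?W m0"
      unfolding m0_def by (rule smooth_contact_top[OF U \<eta> c])
    define S where "S = ?W \<inter> m0 -` (- {0})"
    have S: "open S"
      unfolding S_def using continuous_open_preimage[OF smooth_on_imp_continuous_on[OF m0] W] by auto
    have "m0 y \<noteq> 0"
      using v p c by (simp add: m0_def w_def local_form_to_chart del: One_nat_def)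
    with \<open>y \<in> ?W\<close> have y: "y \<in> S" by (simp add: S_def)
    have SW: "S \<subseteq> ?W" by (auto simp: S_def)
    have "smooth_on S (\<lambda>y. \<Sum>j=1..n+1. C j (cinv c y) * t ^ j)" for t
    proof (rule smooth_on_cong[OF S])
      show "smooth_on S (\<lambda>y. m t y / m0 y - 1)"
        by (intro smooth_on_diff smooth_on_divide smooth_on_const S smooth_on_subset[OF m SW]
            smooth_on_subset[OF m0 SW]) (auto simp: S_def)
      show "m t y / m0 y - 1 = (\<Sum>j=1..n+1. C j (cinv c y) * t ^ j)" if "y \<in> S" for y
      proof -
        have "cinv c y \<in> U" using that SW c by (auto simp: cinv_cmap)
        from volume_pencil_C[OF this] have
          "m t y = (1 + (\<Sum>j=1..n+1. C j (cinv c y) * t ^ j)) * m0 y"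
          by (simp only: m_def m0_def local_form_def)
        then show ?thesis using that by (simp add: S_def)
      qed
    qed
    then have "smooth_on S (\<lambda>y. C j (cinv c y))"
      by (rule polynomial_coefficients_closed[where Q = "smooth_on S" and C = "\<lambda>j y. C j (cinv c y)", rotated 2])
        (intro smooth_on_add smooth_on_mult smooth_on_const S assms | assumption)+
    then show "\<exists>T. open T \<and> y \<in> T \<and> smooth_on T (C j \<circ> cinv c)"
      using S y by (auto simp: o_def)
  qed
qed

text \<open>For each t the ratio of top forms has zero derivative along X, so the polynomial in t
  with coefficients X(C j) vanishes identically.\<close>

lemma conserved_coeffs:
  assumes "j \<in> {1..n+1}" and p: "p \<in> U"
  shows "field_apply A X (C j) p = 0"
proof -
  define c where "c = chart_at A p"
  have c: "c \<in> A" "p \<in> cdom c" by (simp_all add: c_def chart_at)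
  let ?W = "cmap c ` (cdom c \<inter> U)" and ?x = "cmap c p"
  have W: "open ?W" by (rule open_chart_image[OF c(1) U])
  have x: "?x \<in> ?W" using c p by blast
  have Xx: "local_field A c X ?x = X p"
    using c by (simp add: local_field_cmap) (simp add: c_def to_chart_at)
  have d: "(C j \<circ> cinv c) differentiable (at ?x)" if "j \<in> {1..n+1}" for j
    using smooth_coeffs[OF that] c(1) x unfolding smooth_fun_def by (blast intro: smooth_on_differentiable)
  obtain v where v: "volume \<eta> p v \<noteq> 0" using nondegenerate[OF p] by blast
  have "(\<Sum>j=1..n+1. field_apply A X (C j) p * t ^ j) = 0" for t
  proof -
    define f where "f y = 1 + (\<Sum>j=1..n+1. (C j \<circ> cinv c) y * t ^ j)" for y
    have f: "(f has_derivative (\<lambda>v. \<Sum>j=1..n+1. frechet_derivative (C j \<circ> cinv c) (at ?x) v * t ^ j)) (at ?x)"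
    proof -
      have "((\<lambda>y. \<Sum>j=1..n+1. (C j \<circ> cinv c) y * t ^ j) has_derivative
          (\<lambda>v. \<Sum>j=1..n+1. frechet_derivative (C j \<circ> cinv c) (at ?x) v * t ^ j)) (at ?x)"
        by (intro has_derivative_sum has_derivative_mult_left has_frechet_derivative[OF d])
      from has_derivative_add[OF has_derivative_const[of 1] this] show ?thesis
        unfolding f_def by (simp only: add_0)
    qed
    have cov: "conformal_covector ?W (covector A c \<eta>) (local_field A c X) (H \<circ> cinv c) (a \<circ> cinv c)"
      by (rule conformal_covector_chart[OF U \<eta> X H a c(1) \<eta>X d\<eta>X])
    have "frechet_derivative f (at ?x) (local_field A c X ?x) = 0"
    proof (rule conformal_ratio_conserved[OF cov conformal_pencil_chart[OF c(1), of t] x differentiableI[OF f],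
          where n = n and v = v])
      show "contact_top n (\<lambda>y v. covector A c \<eta> y (v 0)) (\<lambda>y v. curl (covector A c \<eta>) y (v 0) (v 1)) ?x v \<noteq> 0"
        using v unfolding local_form_contact_top[OF U \<eta> c(1) x, symmetric]
        by (simp add: c_def local_form_chart_at del: One_nat_def)
      fix y v assume y: "y \<in> ?W"
      have "cinv c y \<in> U" using y c by (auto simp: cinv_cmap)
      then show "contact_top n (\<lambda>y v. covector A c (pencil t) y (v 0))
          (\<lambda>y v. curl (covector A c (pencil t)) y (v 0) (v 1)) y v =
        f y * contact_top n (\<lambda>y v. covector A c \<eta> y (v 0)) (\<lambda>y v. curl (covector A c \<eta>) y (v 0) (v 1)) y v"
        unfolding local_form_contact_top[OF U \<eta> c(1) y, symmetric]
          local_form_contact_top[OF U smooth_pencil c(1) y, symmetric]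
        by (simp only: local_form_def volume_pencil_C f_def o_apply)
    qed
    then show ?thesis
      unfolding frechet_derivative_eqI[OF f] Xx by (simp add: field_apply_def flip: c_def)
  qed
  \<comment> \<open>Functions on the one-point type stand for numbers: with \<open>Q\<close> saying
    that the value is 0, coefficients are extracted as in the smoothness proof.\<close>
  then show ?thesis
    using polynomial_coefficients_closed[where Q = "\<lambda>f. f () = 0" and C = "\<lambda>j _. field_apply A X (C j) p"
        and N = "n + 1" and j = j] assms(1) by simp
qed

end

end

text \<open>Smoothness of \<beta> and of the coefficients belongs to the conclusion because
  \<open>frechet_derivative\<close> is unspecified where a function is not differentiable. Where
  \<open>K\<close> vanishes, division by zero makes \<beta> equal to 0; as \<open>U\<close> is open,
  this does not affect derivatives in \<open>U\<close>. The coefficients are quantified: a family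
  exists, and every such family is smooth and conserved.\<close>

theorem proposition4:
  fixes A :: "('m::{t2_space, second_countable_topology}, 'e::euclidean_space) chart set"
    and n :: nat
    and \<eta> \<beta> :: "('m, 'e) form"
    and H a K :: "'m \<Rightarrow> real"
    and R X :: "'m \<Rightarrow> 'e"
    and \<Phi> :: "'m \<Rightarrow> 'm"
    and U :: "'m set"
  assumes "n \<ge> 1"
    and "smooth_manifold A"
    and "DIM('e) = 2 * n + 1"
    and "contact_form A n \<eta>"
    and "smooth_fun A UNIV H"
    and "is_reeb_field A \<eta> R"
    and "is_hamiltonian_field A \<eta> R H X"
    and "contact_canonoid A \<eta> X \<Phi>"
    and "a = field_apply A R H"
    and "K = (\<lambda>p. - pullback A \<Phi> \<eta> p (\<lambda>_. X p))"
    and "U = {p. K p \<noteq> 0}"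
    and "\<beta> = (\<lambda>p v. H p / K p * pullback A \<Phi> \<eta> p v)"
  shows "open U \<and> smooth_form A 1 U \<beta> \<and>
     (\<forall>p\<in>U. \<forall>v. lie_deriv A 1 X \<beta> p v = - a p * \<beta> p v) \<and>
     (\<exists>C. pencil_coeffs A n \<eta> \<beta> U C) \<and>
     (\<forall>C. pencil_coeffs A n \<eta> \<beta> U C \<longrightarrow>
        (\<forall>j\<in>{1..n+1}. smooth_fun A U (C j) \<and> (\<forall>p\<in>U. field_apply A X (C j) p = 0)))"
proof -
  interpret manifold A by standard fact
  define \<zeta> where "\<zeta> = pullback A \<Phi> \<eta>"
  obtain b where \<Phi>: "smooth_self_map A \<Phi>" and
    lie_\<zeta>: "lie_deriv A 1 X \<zeta> p v = - b p * \<zeta> p v" for p v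
    using assms(8) unfolding contact_canonoid_def \<zeta>_def by metis
  have \<eta>: "smooth_form A 1 UNIV \<eta>"
    and nondeg: "\<And>p. \<exists>v. contact_top n \<eta> (ext_deriv A 1 \<eta>) p v \<noteq> 0"
    using assms(4) by (auto simp: contact_form_def)
  have R: "smooth_field A R" using assms(6) by (simp add: is_reeb_field_def)
  have X: "smooth_field A X" using assms(7) by (simp add: is_hamiltonian_field_def)
  note H = assms(5)
  have a: "smooth_fun A UNIV a"
    unfolding assms(9) by (rule smooth_fun_field_apply[OF open_UNIV H R])
  have \<eta>X: "\<eta> p (\<lambda>_. X p) = - H p" for p
  proof -
    have "interior_product X \<eta> p (\<lambda>_. X p) = - H p"
      using assms(7) by (simp add: is_hamiltonian_field_def fun_form_def)
    then show ?thesis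
      using one_form_eval[of \<eta> p "X p" "case_nat (X p) (\<lambda>_. X p)"] smooth_form_alternating[OF \<eta>]
      by (simp add: interior_product_def)
  qed
  have d\<eta>X: "ext_deriv A 1 \<eta> p (case_nat (X p) v) = ext_deriv A 0 (fun_form H) p v - a p * \<eta> p v" for p v
  proof -
    have "interior_product X (ext_deriv A 1 \<eta>) p v = ext_deriv A 0 (fun_form H) p v - a p * \<eta> p v"
      using assms(7) by (simp add: is_hamiltonian_field_def assms(9))
    then show ?thesis by (simp add: interior_product_def)
  qed
  \<comment> \<open>Since d\<alpha>(X, X) = 0, an equation for L_X or i_X d evaluated on X leaves
    only the derivative of a function along X.\<close>
  have curl0: "ext_deriv A 1 \<alpha> p (case_nat (X p) (\<lambda>_. X p)) = 0" if "smooth_form A 1 UNIV \<alpha>" for \<alpha> p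
    unfolding ext_deriv_chart_at[OF open_UNIV that UNIV_I] by (simp add: curl_def)
  have XH: "field_apply A X H p = - a p * H p" for p
    using d\<eta>X[of p "\<lambda>_. X p"] curl0[OF \<eta>, of p] \<eta>X[of p] by (simp add: field_apply_eq)
  have \<zeta>: "smooth_form A 1 UNIV \<zeta>"
    unfolding \<zeta>_def by (rule smooth_form_pullback[OF \<Phi> \<eta>])
  have K: "K = (\<lambda>p. (- 1) * \<zeta> p (\<lambda>_. X p))" by (simp add: assms(10) \<zeta>_def)
  have sK: "smooth_fun A UNIV K"
    unfolding K by (rule smooth_fun_cmult[OF open_UNIV smooth_fun_one_form_field[OF open_UNIV \<zeta> X]])
  have XK: "field_apply A X K p = - b p * K p" for p
  proof -
    have "field_apply A X K p = (- 1) * ext_deriv A 0 (fun_form (\<lambda>p. \<zeta> p (\<lambda>_. X p))) p (\<lambda>_. X p)"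
      unfolding field_apply_eq K
      by (rule ext_deriv_fun_cmult[OF open_UNIV smooth_fun_one_form_field[OF open_UNIV \<zeta> X] UNIV_I])
    \<comment> \<open>On X itself, Cartan's formula reduces (L_X \<zeta>)(X) to
      X(\<zeta>(X)).\<close>
    also have "ext_deriv A 0 (fun_form (\<lambda>p. \<zeta> p (\<lambda>_. X p))) p (\<lambda>_. X p) = - b p * \<zeta> p (\<lambda>_. X p)"
      using cartan_formula[OF open_UNIV \<zeta> X UNIV_I, of p "\<lambda>_. X p"] curl0[OF \<zeta>] lie_\<zeta> by simp
    finally show ?thesis by (simp add: K)
  qed
  have U: "open U"
  proof -
    have "U = K -` (- {0})" by (auto simp: assms(11))
    then show ?thesis
      using smooth_fun_continuous[OF sK] by (simp add: continuous_on_open_vimage open_Compl)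
  qed
  have nz: "K p \<noteq> 0" if "p \<in> U" for p using that by (simp add: assms(11))
  have HU: "smooth_fun A U H" and KU: "smooth_fun A U K" and aU: "smooth_fun A U a"
    and \<zeta>U: "smooth_form A 1 U \<zeta>" and \<eta>U: "smooth_form A 1 U \<eta>"
    using H sK a \<zeta> \<eta> by (auto intro: smooth_fun_subset smooth_form_subset)
  have f: "smooth_fun A U (\<lambda>p. H p / K p)"
    by (rule smooth_fun_divide[OF U HU KU nz])
  have \<beta>_eq: "\<beta> = (\<lambda>p v. H p / K p * \<zeta> p v)" by (simp add: assms(12) \<zeta>_def)
  have \<beta>: "smooth_form A 1 U \<beta>"
    unfolding \<beta>_eq by (rule smooth_form_scale[OF U f \<zeta>U])
  have lie_\<beta>: "lie_deriv A 1 X \<beta> p v = - a p * \<beta> p v" if p: "p \<in> U" for p v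
  proof -
    have "lie_deriv A 1 X \<beta> p v =
        (field_apply A X H p * K p - H p * field_apply A X K p) / (K p * K p) * \<zeta> p v +
        H p / K p * (- b p * \<zeta> p v)"
      unfolding \<beta>_eq lie_deriv_scale[OF U f \<zeta>U p] field_apply_divide[OF U HU KU p nz[OF p]] lie_\<zeta> ..
    also have "\<dots> = - a p * \<beta> p v"
      unfolding XH XK \<beta>_eq using nz[OF p] by (simp add: field_simps)
    finally show ?thesis .
  qed
  have \<beta>X: "\<beta> p (\<lambda>_. X p) = - H p" if "p \<in> U" for p
    using nz[OF that] by (simp add: \<beta>_eq K)
  have d\<beta>X: "ext_deriv A 1 \<beta> p (case_nat (X p) v) = ext_deriv A 0 (fun_form H) p v - a p * \<beta> p v"
    if p: "p \<in> U" for p v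
  proof -
    \<comment> \<open>\<beta>(X) = -H holds on U only, and the derivative at p depends only on
      values near p.\<close>
    have "ext_deriv A 0 (fun_form (\<lambda>q. \<beta> q (\<lambda>_. X q))) p v = ext_deriv A 0 (fun_form (\<lambda>q. (- 1) * H q)) p v"
      by (rule ext_deriv_fun_cong[OF U p]) (simp add: \<beta>X)
    also have "\<dots> = - ext_deriv A 0 (fun_form H) p v"
      unfolding ext_deriv_fun_cmult[OF U HU p] by simp
    finally show ?thesis
      using cartan_formula[OF U \<beta> X p, of v] lie_\<beta>[OF p, of v] by simp
  qed
  interpret conformal_pencil A n U \<eta> \<beta> X H a
    by unfold_locales
      (assumption | rule assms(3) U \<eta>U \<beta> X HU aU nondeg \<eta>X \<beta>X d\<eta>X d\<beta>X)+
  show ?thesis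
    using U \<beta> lie_\<beta> pencil_coeffs_exist smooth_coeffs conserved_coeffs by blast
qed

end
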